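(* Let $\pi:G\to\overline{G}$ be an epimorphism of abelian groups with kernel $H$, let $\chi:G\to U\subset\mathbb{C}^\times$ be a character, and let $\xi:\overline{G}\to G$ be a (set-theoretic) section of $\pi$. Then the functor $\widetilde{L_\pi^\chi}:\widetilde{\mathfrak{M}}\to\mathfrak{N}$ is an equivalence of groupoids.
   Context: Algebras are over $\mathbb{R}$ and are not assumed associative, unital or finite-dimensional. A $G$-grading on $\mathcal{B}$ is a decomposition $\mathcal{B}=\bigoplus_{g\in G}\mathcal{B}_g$ with $\mathcal{B}_g\mathcal{B}_h\subset\mathcal{B}_{gh}$. Isomorphisms of graded algebras are algebra isomorphisms preserving degrees. $\mathcal{B}$ is graded-simple if $\mathcal{B}^2\ne0$ and it has no graded ideals except $0$ and $\mathcal{B}$. The centroid $C(\mathcal{B})$ is the algebra of linear operators commuting with all left and right multiplications; for graded-simple $\mathcal{B}$ it is $G$-graded, with $C(\mathcal{B})_g=\{c\in C(\mathcal{B}): c(\mathcal{B}_h)\subset\mathcal{B}_{gh}\ \forall h\in G\}$. Central simple means simple with centroid equal to the scalars $\mathbb{R}$. Let $U=\{z\in\mathbb{C}:|z|=1\}$. For each $g\in G$ choose $z_g\in U$ with $z_g^2=\chi(g)$ and put $u_g=z_g\otimes g\in\mathbb{C}\otimes_{\mathbb{R}}\mathbb{R}G=\mathbb{C}G$. For a $\overline{G}$-graded real algebra $\mathcal{A}$, the loop algebra is $L_\pi^\chi(\mathcal{A})=\bigoplus_{g\in G}\mathcal{A}_{\pi(g)}\otimes u_g\subset\mathcal{A}\otimes_{\mathbb{R}}\mathbb{C}G$,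 with $L_\pi^\chi(\mathcal{A})_g=\mathcal{A}_{\pi(g)}\otimes u_g$. With $\mathbb{R}$ trivially graded, $L_\pi^\chi(\mathbb{R})=\bigoplus_{h\in H}\mathbb{R}u_h$. Twists: let $\sigma(\bar g_1,\bar g_2)=\xi(\bar g_1)\xi(\bar g_2)\xi(\bar g_1\bar g_2)^{-1}\in H$. For a character $\lambda:H\to\mathbb{R}^\times$ and a $\overline{G}$-graded algebra $\mathcal{A}$, let $\mathcal{A}^\lambda$ be $\mathcal{A}$ as a $\overline{G}$-graded space with the multiplication $a_1\ast a_2=\lambda(\sigma(\bar g_1,\bar g_2))a_1a_2$ for $a_1\in\mathcal{A}_{\bar g_1}$, $a_2\in\mathcal{A}_{\bar g_2}$. $\mathfrak{N}$ is the groupoid whose objects are the graded-simple $G$-graded real algebras with centroid isomorphic to $L_\pi^\chi(\mathbb{R})$ (as a $G$-graded algebra) and whose morphisms are the isomorphisms of $G$-graded algebras. $\widetilde{\mathfrak{M}}$ is the groupoid whose objects are the central simple algebras over $\mathbb{R}$ equipped with a $\overline{G}$-grading; the morphisms $\mathcal{A}\to\mathcal{A}'$ are the pairs $(\psi,\lambda)$ where $\lambda:H\to\mathbb{R}^\times$ is a character and $\psi:\mathcal{A}^\lambda\to\mathcal{A}'$ is an isomorphism of $\overline{G}$-graded algebras; composition is $(\psi',\lambda')(\psi,\lambda)=(\psi'\psi,\lambda'\lambda)$. The functor $\widetilde{L_\pi^\chi}$ sends an object $\mathcal{A}$ to $L_\pi^\chi(\mathcal{A})$ and a morphism $(\psi,\lambda):\mathcal{A}\to\mathcal{A}'$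 to the map $L_\pi^\chi(\mathcal{A})\to L_\pi^\chi(\mathcal{A}')$ given by $a\otimes u_g\mapsto\psi(a)\,\lambda\big(g\,\xi(\pi(g))^{-1}\big)\otimes u_g$ for all $a\in\mathcal{A}_{\pi(g)}$, $g\in G$. *)

theory Defs
  imports "HOL-Analysis.Product_Vector" "HOL-Library.Function_Algebras" "HOL-Library.Indicator_Function"
begin

section \<open>Functions into a real vector space\<close>

instantiation "fun" :: (type, real_vector) real_vector
begin

definition scaleR_fun :: "real \<Rightarrow> ('a \<Rightarrow> 'b) \<Rightarrow> 'a \<Rightarrow> 'b"
  where "r *\<^sub>R f = (\<lambda>x. r *\<^sub>R f x)"

instance
  by standard (auto simp: scaleR_fun_def fun_eq_iff scaleR_add_right scaleR_add_left)

end

lemma scaleR_fun_apply [simp]: "(r *\<^sub>R f) x = r *\<^sub>R f x"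
  by (simp add: scaleR_fun_def)


section \<open>Groupoids and equivalences\<close>

text \<open>Hom-sets need not be disjoint, so the morphism part of a functor takes the source and the
  target as additional arguments.\<close>

record ('o, 'm) category =
  Ob :: "'o set"
  Hom :: "'o \<Rightarrow> 'o \<Rightarrow> 'm set"
  Ident :: "'o \<Rightarrow> 'm"
  Comp :: "'m \<Rightarrow> 'm \<Rightarrow> 'm"

definition is_category :: "('o, 'm) category \<Rightarrow> bool" where
  "is_category C \<longleftrightarrow>
     (\<forall>A\<in>Ob C. Ident C A \<in> Hom C A A) \<and>
     (\<forall>A\<in>Ob C. \<forall>B\<in>Ob C. \<forall>D\<in>Ob C. \<forall>f\<in>Hom C A B. \<forall>g\<in>Hom C B D. Comp C g f \<in> Hom C A D) \<and>
     (\<forall>A\<in>Ob C. \<forall>B\<in>Ob C. \<forall>f\<in>Hom C A B. Comp C f (Ident C A) = f \<and> Comp C (Ident C B) f = f) \<and>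
     (\<forall>A\<in>Ob C. \<forall>B\<in>Ob C. \<forall>D\<in>Ob C. \<forall>E\<in>Ob C.
        \<forall>f\<in>Hom C A B. \<forall>g\<in>Hom C B D. \<forall>h\<in>Hom C D E.
          Comp C h (Comp C g f) = Comp C (Comp C h g) f)"

definition is_iso :: "('o, 'm) category \<Rightarrow> 'o \<Rightarrow> 'o \<Rightarrow> 'm \<Rightarrow> bool" where
  "is_iso C A B f \<longleftrightarrow> f \<in> Hom C A B \<and>
     (\<exists>g\<in>Hom C B A. Comp C g f = Ident C A \<and> Comp C f g = Ident C B)"

definition is_groupoid :: "('o, 'm) category \<Rightarrow> bool" where
  "is_groupoid C \<longleftrightarrow> is_category C \<and> (\<forall>A\<in>Ob C. \<forall>B\<in>Ob C. \<forall>f\<in>Hom C A B. is_iso C A B f)"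

record ('o, 'm, 'p, 'n) ftor =
  on_ob :: "'o \<Rightarrow> 'p"
  on_mor :: "'o \<Rightarrow> 'o \<Rightarrow> 'm \<Rightarrow> 'n"

definition is_functor ::
  "('o, 'm) category \<Rightarrow> ('p, 'n) category \<Rightarrow> ('o, 'm, 'p, 'n) ftor \<Rightarrow> bool" where
  "is_functor C D F \<longleftrightarrow>
     (\<forall>A\<in>Ob C. on_ob F A \<in> Ob D) \<and>
     (\<forall>A\<in>Ob C. \<forall>B\<in>Ob C. \<forall>f\<in>Hom C A B. on_mor F A B f \<in> Hom D (on_ob F A) (on_ob F B)) \<and>
     (\<forall>A\<in>Ob C. on_mor F A A (Ident C A) = Ident D (on_ob F A)) \<and>
     (\<forall>A\<in>Ob C. \<forall>B\<in>Ob C. \<forall>E\<in>Ob C. \<forall>f\<in>Hom C A B. \<forall>g\<in>Hom C B E.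
        on_mor F A E (Comp C g f) = Comp D (on_mor F B E g) (on_mor F A B f))"

definition id_ftor :: "('o, 'm, 'o, 'm) ftor" where
  "id_ftor = \<lparr>on_ob = (\<lambda>A. A), on_mor = (\<lambda>A B f. f)\<rparr>"

definition comp_ftor ::
  "('p, 'n, 'q, 'k) ftor \<Rightarrow> ('o, 'm, 'p, 'n) ftor \<Rightarrow> ('o, 'm, 'q, 'k) ftor" where
  "comp_ftor G F = \<lparr>on_ob = (\<lambda>A. on_ob G (on_ob F A)),
     on_mor = (\<lambda>A B f. on_mor G (on_ob F A) (on_ob F B) (on_mor F A B f))\<rparr>"

definition natural_iso :: "('o, 'm) category \<Rightarrow> ('p, 'n) category \<Rightarrow>
    ('o, 'm, 'p, 'n) ftor \<Rightarrow> ('o, 'm, 'p, 'n) ftor \<Rightarrow> ('o \<Rightarrow> 'n) \<Rightarrow> bool" where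
  "natural_iso C D F G \<eta> \<longleftrightarrow>
     (\<forall>A\<in>Ob C. is_iso D (on_ob F A) (on_ob G A) (\<eta> A)) \<and>
     (\<forall>A\<in>Ob C. \<forall>B\<in>Ob C. \<forall>f\<in>Hom C A B.
        Comp D (\<eta> B) (on_mor F A B f) = Comp D (on_mor G A B f) (\<eta> A))"

definition equivalence_of_groupoids ::
  "('o, 'm) category \<Rightarrow> ('p, 'n) category \<Rightarrow> ('o, 'm, 'p, 'n) ftor \<Rightarrow> bool" where
  "equivalence_of_groupoids C D F \<longleftrightarrow>
     is_groupoid C \<and> is_groupoid D \<and> is_functor C D F \<and>
     (\<exists>G. is_functor D C G \<and>
        (\<exists>\<eta>. natural_iso C C id_ftor (comp_ftor G F) \<eta>) \<and>
        (\<exists>\<epsilon>. natural_iso D D (comp_ftor F G) id_ftor \<epsilon>))"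


section \<open>Graded real algebras\<close>

text \<open>The underlying vector space of an algebra is a linear subspace of an ambient real vector
  space, given by the type \<open>'v\<close>. The grading group is written additively. Only the values of
  \<open>mult\<close> on the carrier matter.\<close>

record ('g, 'v) galg =
  carrier :: "'v set"
  mult :: "'v \<Rightarrow> 'v \<Rightarrow> 'v"
  comp :: "'g \<Rightarrow> 'v set"

definition linear_on :: "'v::real_vector set \<Rightarrow> 'w::real_vector set \<Rightarrow> ('v \<Rightarrow> 'w) \<Rightarrow> bool" where
  "linear_on V W f \<longleftrightarrow> f ` V \<subseteq> W \<and>
     (\<forall>x\<in>V. \<forall>y\<in>V. f (x + y) = f x + f y) \<and> (\<forall>r. \<forall>x\<in>V. f (r *\<^sub>R x) = r *\<^sub>R f x)"

definition real_algebra :: "('g, 'v::real_vector) galg \<Rightarrow> bool" where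
  "real_algebra A \<longleftrightarrow> subspace (carrier A) \<and>
     (\<forall>x\<in>carrier A. linear_on (carrier A) (carrier A) (\<lambda>y. mult A x y)) \<and>
     (\<forall>y\<in>carrier A. linear_on (carrier A) (carrier A) (\<lambda>x. mult A x y))"

definition decomposes ::
    "('g, 'v::real_vector) galg \<Rightarrow> 'v \<Rightarrow> ('g \<Rightarrow> 'v) \<Rightarrow> bool" where
  "decomposes A x f \<longleftrightarrow>
     (\<forall>g. f g \<in> comp A g) \<and> finite {g. f g \<noteq> 0} \<and> x = (\<Sum>g | f g \<noteq> 0. f g)"

definition graded_algebra :: "('g::ab_group_add, 'v::real_vector) galg \<Rightarrow> bool" where
  "graded_algebra A \<longleftrightarrow> real_algebra A \<and>
     (\<forall>g. subspace (comp A g) \<and> comp A g \<subseteq> carrier A) \<and>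
     (\<forall>x\<in>carrier A. \<exists>!f. decomposes A x f) \<and>
     (\<forall>g h. \<forall>x\<in>comp A g. \<forall>y\<in>comp A h. mult A x y \<in> comp A (g + h))"

definition hcomp :: "('g, 'v::real_vector) galg \<Rightarrow> 'v \<Rightarrow> 'g \<Rightarrow> 'v" where
  "hcomp A x = (THE f. decomposes A x f)"

definition alg_ideal :: "('g, 'v::real_vector) galg \<Rightarrow> 'v set \<Rightarrow> bool" where
  "alg_ideal A I \<longleftrightarrow> subspace I \<and> I \<subseteq> carrier A \<and>
     (\<forall>x\<in>carrier A. \<forall>y\<in>I. mult A x y \<in> I \<and> mult A y x \<in> I)"

definition graded_ideal :: "('g, 'v::real_vector) galg \<Rightarrow> 'v set \<Rightarrow> bool" where
  "graded_ideal A I \<longleftrightarrow> alg_ideal A I \<and> I = span (\<Union>g. I \<inter> comp A g)"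

definition nontrivial_product :: "('g, 'v::real_vector) galg \<Rightarrow> bool" where
  "nontrivial_product A \<longleftrightarrow> (\<exists>x\<in>carrier A. \<exists>y\<in>carrier A. mult A x y \<noteq> 0)"

definition simple_algebra :: "('g, 'v::real_vector) galg \<Rightarrow> bool" where
  "simple_algebra A \<longleftrightarrow> real_algebra A \<and> nontrivial_product A \<and>
     (\<forall>I. alg_ideal A I \<longrightarrow> I = {0} \<or> I = carrier A)"

definition graded_simple :: "('g::ab_group_add, 'v::real_vector) galg \<Rightarrow> bool" where
  "graded_simple A \<longleftrightarrow> graded_algebra A \<and> nontrivial_product A \<and>
     (\<forall>I. graded_ideal A I \<longrightarrow> I = {0} \<or> I = carrier A)"

text \<open>Maps defined on a carrier are represented by total functions that vanish outside that
  carrier. This makes the representation unique, and the linear operators on a carrier form a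
  linear subspace of the function space.\<close>

definition vanishes_outside :: "'v set \<Rightarrow> ('v \<Rightarrow> 'w::zero) \<Rightarrow> bool" where
  "vanishes_outside V f \<longleftrightarrow> (\<forall>x. x \<notin> V \<longrightarrow> f x = 0)"

definition scalar_op :: "'v::real_vector set \<Rightarrow> real \<Rightarrow> 'v \<Rightarrow> 'v" where
  "scalar_op V r = (\<lambda>x. if x \<in> V then r *\<^sub>R x else 0)"

definition graded_iso ::
    "('g, 'v::real_vector) galg \<Rightarrow> ('g, 'w::real_vector) galg \<Rightarrow> ('v \<Rightarrow> 'w) \<Rightarrow> bool" where
  "graded_iso A B \<phi> \<longleftrightarrow> vanishes_outside (carrier A) \<phi> \<and>
     linear_on (carrier A) (carrier B) \<phi> \<and> bij_betw \<phi> (carrier A) (carrier B) \<and>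
     (\<forall>x\<in>carrier A. \<forall>y\<in>carrier A. \<phi> (mult A x y) = mult B (\<phi> x) (\<phi> y)) \<and>
     (\<forall>g. \<phi> ` comp A g = comp B g)"

definition centroid ::
    "('g::ab_group_add, 'v::real_vector) galg \<Rightarrow> ('g, 'v \<Rightarrow> 'v) galg" where
  "centroid A =
     (let C = {c. vanishes_outside (carrier A) c \<and> linear_on (carrier A) (carrier A) c \<and>
                  (\<forall>x\<in>carrier A. \<forall>y\<in>carrier A.
                     c (mult A x y) = mult A x (c y) \<and> c (mult A x y) = mult A (c x) y)}
      in \<lparr>carrier = C, mult = (\<lambda>c d. c \<circ> d),
          comp = (\<lambda>g. {c \<in> C. \<forall>h. c ` comp A h \<subseteq> comp A (g + h)})\<rparr>)"

definition central_simple :: "('g::ab_group_add, 'v::real_vector) galg \<Rightarrow> bool" where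
  "central_simple A \<longleftrightarrow> simple_algebra A \<and>
     carrier (centroid A) = range (scalar_op (carrier A))"

definition trivially_graded_reals :: "('g::ab_group_add, real) galg" where
  "trivially_graded_reals =
     \<lparr>carrier = UNIV, mult = (*), comp = (\<lambda>g. if g = 0 then UNIV else {0})\<rparr>"


section \<open>Loop algebras\<close>

text \<open>Elements of the complex group algebra are finitely supported functions \<open>'g \<Rightarrow> complex\<close>.
  Elements of the tensor product over the reals of \<open>A\<close> with the complex group algebra are finitely
  supported functions \<open>'g \<Rightarrow> 'v \<times> 'v\<close>, where the value \<open>(a, b)\<close> at \<open>g\<close> represents the summand
  \<open>a \<otimes> g + b \<otimes> \<i>g\<close>.\<close>

definition group_element :: "complex \<Rightarrow> 'g \<Rightarrow> 'g \<Rightarrow> complex" where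
  "group_element c g = (\<lambda>k. if k = g then c else 0)"

definition tensor :: "'v::real_vector \<Rightarrow> ('g \<Rightarrow> complex) \<Rightarrow> 'g \<Rightarrow> 'v \<times> 'v" where
  "tensor a w = (\<lambda>k. (Re (w k) *\<^sub>R a, Im (w k) *\<^sub>R a))"

definition complexified_mult ::
    "('v \<Rightarrow> 'v \<Rightarrow> 'v::real_vector) \<Rightarrow> 'v \<times> 'v \<Rightarrow> 'v \<times> 'v \<Rightarrow> 'v \<times> 'v" where
  "complexified_mult m p q =
     (m (fst p) (fst q) - m (snd p) (snd q), m (fst p) (snd q) + m (snd p) (fst q))"

definition tensor_mult :: "('v \<Rightarrow> 'v \<Rightarrow> 'v::real_vector) \<Rightarrow>
    ('g::ab_group_add \<Rightarrow> 'v \<times> 'v) \<Rightarrow> ('g \<Rightarrow> 'v \<times> 'v) \<Rightarrow> 'g \<Rightarrow> 'v \<times> 'v" where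
  "tensor_mult m p q = (\<lambda>k. \<Sum>g | p g \<noteq> 0. complexified_mult m (p g) (q (k - g)))"

text \<open>The argument \<open>z\<close> is the chosen family of square roots \<open>z\<^sub>g\<close> of \<open>\<chi> g\<close>.\<close>

definition loop :: "('g::ab_group_add \<Rightarrow> 'h) \<Rightarrow> ('g \<Rightarrow> complex) \<Rightarrow>
    ('h, 'v::real_vector) galg \<Rightarrow> ('g, 'g \<Rightarrow> 'v \<times> 'v) galg" where
  "loop \<pi> z A =
     (let L = (\<lambda>g. {tensor a (group_element (z g) g) | a. a \<in> comp A (\<pi> g)})
      in \<lparr>carrier = span (\<Union>g. L g), mult = tensor_mult (mult A), comp = L\<rparr>)"


section \<open>The two groupoids and the functor\<close>

definition ker :: "('g::ab_group_add \<Rightarrow> 'h::ab_group_add) \<Rightarrow> 'g set" where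
  "ker \<pi> = {g. \<pi> g = 0}"

definition real_characters :: "'g::ab_group_add set \<Rightarrow> ('g \<Rightarrow> real) set" where
  "real_characters H = {\<mu>. vanishes_outside H \<mu> \<and> (\<forall>h\<in>H. \<mu> h \<noteq> 0) \<and>
     (\<forall>h\<in>H. \<forall>k\<in>H. \<mu> (h + k) = \<mu> h * \<mu> k)}"

definition cocycle :: "('h::ab_group_add \<Rightarrow> 'g::ab_group_add) \<Rightarrow> 'h \<Rightarrow> 'h \<Rightarrow> 'g" where
  "cocycle \<xi> p q = \<xi> p + \<xi> q - \<xi> (p + q)"

definition twist :: "('h::ab_group_add \<Rightarrow> 'g::ab_group_add) \<Rightarrow> ('g \<Rightarrow> real) \<Rightarrow>
    ('h, 'v::real_vector) galg \<Rightarrow> ('h, 'v) galg" where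
  "twist \<xi> \<mu> A = A\<lparr>mult := (\<lambda>x y.
     \<Sum>p | hcomp A x p \<noteq> 0. \<Sum>q | hcomp A y q \<noteq> 0.
       \<mu> (cocycle \<xi> p q) *\<^sub>R mult A (hcomp A x p) (hcomp A y q))\<rparr>"

definition N_groupoid :: "('g::ab_group_add \<Rightarrow> 'h::ab_group_add) \<Rightarrow> ('g \<Rightarrow> complex) \<Rightarrow>
    (('g, 'v::real_vector) galg, 'v \<Rightarrow> 'v) category" where
  "N_groupoid \<pi> z =
     \<lparr>Ob = {B. graded_simple B \<and>
               (\<exists>\<phi>. graded_iso (centroid B) (loop \<pi> z trivially_graded_reals) \<phi>)},
      Hom = (\<lambda>B B'. {\<phi>. graded_iso B B' \<phi>}),
      Ident = (\<lambda>B. scalar_op (carrier B) 1),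
      Comp = (\<lambda>\<phi>' \<phi>. \<phi>' \<circ> \<phi>)\<rparr>"

definition M_groupoid :: "('g::ab_group_add \<Rightarrow> 'h::ab_group_add) \<Rightarrow> ('h \<Rightarrow> 'g) \<Rightarrow>
    (('h, 'v::real_vector) galg, ('v \<Rightarrow> 'v) \<times> ('g \<Rightarrow> real)) category" where
  "M_groupoid \<pi> \<xi> =
     \<lparr>Ob = {A. central_simple A \<and> graded_algebra A},
      Hom = (\<lambda>A A'. {(\<psi>, \<mu>). \<mu> \<in> real_characters (ker \<pi>) \<and> graded_iso (twist \<xi> \<mu> A) A' \<psi>}),
      Ident = (\<lambda>A. (scalar_op (carrier A) 1, indicator (ker \<pi>))),
      Comp = (\<lambda>(\<psi>', \<mu>') (\<psi>, \<mu>). (\<psi>' \<circ> \<psi>, \<mu>' * \<mu>))\<rparr>"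

definition loop_mor :: "('g::ab_group_add \<Rightarrow> 'h::ab_group_add) \<Rightarrow> ('g \<Rightarrow> complex) \<Rightarrow> ('h \<Rightarrow> 'g) \<Rightarrow>
    ('h, 'v::real_vector) galg \<Rightarrow> ('v \<Rightarrow> 'v) \<times> ('g \<Rightarrow> real) \<Rightarrow>
    ('g \<Rightarrow> 'v \<times> 'v) \<Rightarrow> 'g \<Rightarrow> 'v \<times> 'v" where
  "loop_mor \<pi> z \<xi> A = (\<lambda>(\<psi>, \<mu>) f.
     if f \<in> carrier (loop \<pi> z A)
     then (\<lambda>g. \<mu> (g - \<xi> (\<pi> g)) *\<^sub>R (\<psi> (fst (f g)), \<psi> (snd (f g))))
     else 0)"

definition loop_functor ::
    "('g::ab_group_add \<Rightarrow> 'h::ab_group_add) \<Rightarrow> ('g \<Rightarrow> complex) \<Rightarrow> ('h \<Rightarrow> 'g) \<Rightarrow>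
     (('h, 'v::real_vector) galg, ('v \<Rightarrow> 'v) \<times> ('g \<Rightarrow> real),
      ('g, 'g \<Rightarrow> 'v \<times> 'v) galg, ('g \<Rightarrow> 'v \<times> 'v) \<Rightarrow> ('g \<Rightarrow> 'v \<times> 'v)) ftor" where
  "loop_functor \<pi> z \<xi> =
     \<lparr>on_ob = loop \<pi> z, on_mor = (\<lambda>A A'. loop_mor \<pi> z \<xi> A)\<rparr>"

text \<open>A groupoid of all algebras has to be relative to a universe of vector spaces. Let \<open>'w\<close> be an
  arbitrary real vector space and \<open>V\<close> the space \<open>('g, 'w) universe\<close>. Algebras over the quotient
  group live on subspaces of \<open>V\<close>, and \<open>'g\<close>-graded algebras on subspaces of \<open>'g \<Rightarrow> V \<times> V\<close>, which
  is where the loop construction lands. As \<open>'g \<Rightarrow> V \<times> V\<close> embeds linearly into \<open>V\<close> and \<open>V\<close> into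
  \<open>'g \<Rightarrow> V \<times> V\<close>, the same vector spaces occur up to isomorphism on both sides. As \<open>'w\<close> embeds
  into \<open>V\<close>, every real vector space occurs for a suitable \<open>'w\<close>.\<close>

type_synonym ('g, 'w) universe = "'g \<times> nat \<Rightarrow> 'w"


section \<open>The defining formulas on homogeneous elements\<close>

lemma tensor_mult_tensor:
  fixes A :: "('h, 'v::real_vector) galg" and g h :: "'g::ab_group_add"
  assumes A: "real_algebra A" and a: "a \<in> carrier A" and b: "b \<in> carrier A"
  shows "tensor_mult (mult A) (tensor a (group_element c g)) (tensor b (group_element d h)) =
         tensor (mult A a b) (group_element (c * d) (g + h))"
proof -
  have R: "mult A x (r *\<^sub>R y) = r *\<^sub>R mult A x y" and L: "mult A (r *\<^sub>R x) y = r *\<^sub>R mult A x y"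
    if "x \<in> carrier A" "y \<in> carrier A" for x y r
    using A that by (auto simp: real_algebra_def linear_on_def)
  have sc: "r *\<^sub>R x \<in> carrier A" if "x \<in> carrier A" for x r
    using A that by (auto simp: real_algebra_def intro: subspace_scale)
  have z: "mult A x 0 = 0" "mult A 0 x = 0" if "x \<in> carrier A" for x
    using R[OF that that, of 0] L[OF that that, of 0] by simp_all
  have mem0: "0 \<in> carrier A" using A by (auto simp: real_algebra_def intro: subspace_0)
  show ?thesis
  proof
    fix k
    let ?p = "tensor a (group_element c g)" and ?q = "tensor b (group_element d h)"
    have sub: "{x. ?p x \<noteq> 0} \<subseteq> {g}"
      by (auto simp: tensor_def group_element_def zero_prod_def split: if_splits)
    have "tensor_mult (mult A) ?p ?q k = (\<Sum>x\<in>{g}. complexified_mult (mult A) (?p x) (?q (k - x)))"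
      unfolding tensor_mult_def
    proof (rule sum.mono_neutral_left)
      show "\<forall>x\<in>{g} - {x. ?p x \<noteq> 0}. complexified_mult (mult A) (?p x) (?q (k - x)) = 0"
        using z sc[OF b] mem0
        by (auto simp: complexified_mult_def tensor_def zero_prod_def)
    qed (use sub in auto)
    also have "\<dots> = tensor (mult A a b) (group_element (c * d) (g + h)) k"
      using a b sc[OF a] sc[OF b] z mem0
      by (auto simp: complexified_mult_def tensor_def group_element_def R L zero_prod_def
          scaleR_diff_left scaleR_add_left algebra_simps)
    finally show "tensor_mult (mult A) ?p ?q k =
      tensor (mult A a b) (group_element (c * d) (g + h)) k" .
  qed
qed

lemma hcomp_homogeneous:
  assumes A: "graded_algebra A" and x: "x \<in> comp A g"
  shows "hcomp A x = (\<lambda>k. if k = g then x else 0)"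
proof -
  let ?f = "\<lambda>k. if k = g then x else 0"
  have "x \<in> carrier A" "\<forall>k. 0 \<in> comp A k"
    using A x by (auto simp: graded_algebra_def intro: subspace_0)
  moreover have "{k. ?f k \<noteq> 0} = (if x = 0 then {} else {g})" by auto
  ultimately have "decomposes A x ?f" "\<exists>!f. decomposes A x f"
    using A x by (auto simp: decomposes_def graded_algebra_def)
  then show ?thesis unfolding hcomp_def by (intro the1_equality)
qed

lemma twist_mult_homogeneous:
  assumes A: "graded_algebra A" and x: "x \<in> comp A p" and y: "y \<in> comp A q"
  shows "mult (twist \<xi> \<mu> A) x y = \<mu> (cocycle \<xi> p q) *\<^sub>R mult A x y"
proof -
  have c: "x \<in> carrier A" "y \<in> carrier A"
    using A x y by (auto simp: graded_algebra_def)
  have z: "mult A x 0 = 0" "mult A 0 y = 0"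
  proof -
    have "mult A x (0 *\<^sub>R y) = 0 *\<^sub>R mult A x y" "mult A (0 *\<^sub>R x) y = 0 *\<^sub>R mult A x y"
      using A c by (auto simp: graded_algebra_def real_algebra_def linear_on_def simp del: scaleR_zero_left)
    then show "mult A x 0 = 0" "mult A 0 y = 0" by simp_all
  qed
  have "{k. (if k = p then x else 0) \<noteq> 0} = (if x = 0 then {} else {p})"
    "{k. (if k = q then y else 0) \<noteq> 0} = (if y = 0 then {} else {q})" by auto
  then show ?thesis
    using z by (simp add: twist_def hcomp_homogeneous[OF A x] hcomp_homogeneous[OF A y])
qed

lemma loop_mor_tensor:
  assumes A: "graded_algebra A" and \<psi>: "linear_on (carrier A) W \<psi>" and a: "a \<in> comp A (\<pi> g)"
  shows "loop_mor \<pi> z \<xi> A (\<psi>, \<mu>) (tensor a (group_element (z g) g)) =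
         tensor (\<mu> (g - \<xi> (\<pi> g)) *\<^sub>R \<psi> a) (group_element (z g) g)"
proof -
  have c: "a \<in> carrier A" using A a by (auto simp: graded_algebra_def)
  then have s: "\<psi> (r *\<^sub>R a) = r *\<^sub>R \<psi> a" for r using \<psi> by (auto simp: linear_on_def)
  then have z: "\<psi> 0 = 0" by (metis scaleR_zero_left)
  have "tensor a (group_element (z g) g) \<in> carrier (loop \<pi> z A)"
    using a by (auto simp: loop_def Let_def intro!: span_base)
  then show ?thesis
    by (auto simp: loop_mor_def tensor_def group_element_def fun_eq_iff s z zero_prod_def)
qed

end

theory Submission
  imports Defs
begin

text \<open>Full faithfulness and essential surjectivity both rest on the centroid of a loop algebra. For
  central simple \<open>A\<close>, a homogeneous centroid element of \<open>L(A)\<close> acts as \<open>a \<otimes> u\<^sub>g \<mapsto> t\<^sub>g(a) \<otimes> u\<^sub>e u\<^sub>g\<close>,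
  where \<open>t\<^sub>g\<close> depends only on \<open>\<pi> g\<close> because \<open>A\<close> has no annihilator; so it comes from the centroid of
  \<open>A\<close> and is a multiple of the action of \<open>u\<^sub>e\<close> with \<open>e \<in> H\<close>. An isomorphism \<open>L(A) \<rightarrow> L(A')\<close> therefore
  conjugates \<open>u\<^sub>h\<close> to \<open>\<lambda>(h) u\<^sub>h\<close> for a character \<open>\<lambda>\<close>, and its restrictions to the degrees \<open>\<xi> p\<close>
  form the isomorphism \<open>\<psi>\<close> from the twist.

  Conversely, let \<open>c\<^sub>h\<close> be the centroid element of \<open>B\<close> that corresponds to \<open>u\<^sub>h\<close>. The components of \<open>B\<close> of
  degrees \<open>\<xi> p\<close>, with products brought back to such degrees by the inverses of the \<open>c\<^sub>h\<close>, form
  an algebra \<open>A\<close> with \<open>L(A) \<cong> B\<close>. It is graded-simple, and its homogeneous centroid elements are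
  scalars of degree \<open>0\<close>. The components of an element of minimal support in a nonzero ideal are
  related by homogeneous centroid elements, so the element is homogeneous and the ideal is all of \<open>A\<close>.\<close>

section \<open>Linear maps between subspaces\<close>

text \<open>Neither \<open>z\<close> nor \<open>\<xi>\<close> is a homomorphism, and both defects
  run through the proof. As \<open>z g * z k\<close> and \<open>z (g + k)\<close> have the same
  square, they differ by a sign \<open>eps g k\<close>, so u_g u_k is \<open>eps g k\<close> times
  u_{g+k}; the bookkeeping rests on \<open>eps\<close> being a symmetric 2-cocycle. The defect of
  \<open>\<xi>\<close> is \<open>cocycle\<close>: the kernel part \<open>g - \<xi> (\<pi> g)\<close>
  of a sum is the sum of the kernel parts plus a value of \<open>cocycle\<close>. This is why a
  character of the kernel acts on morphisms through a twist.

  The centroid of an object of the target is known only up to isomorphism, and a centroid need not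
  be the sum of its homogeneous parts. A \<open>centroid_frame\<close> records what is needed:
  operators that multiply like the u_h and exhaust the homogeneous centroid elements up to scalars.
  Frames are transported by isomorphisms, and on a nonzero algebra two frames differ by a character.

  Both groupoids live in fixed ambient spaces, and the loop construction enlarges the ambient space.
  Essential surjectivity therefore also needs an injective linear map from the larger space back
  into the universe.\<close>

lemma linear_on_mem: "linear_on V W f \<Longrightarrow> x \<in> V \<Longrightarrow> f x \<in> W"
  by (auto simp: linear_on_def)

lemma linear_on_add: "linear_on V W f \<Longrightarrow> x \<in> V \<Longrightarrow> y \<in> V \<Longrightarrow> f (x + y) = f x + f y"
  by (auto simp: linear_on_def)

lemma linear_on_scaleR: "linear_on V W f \<Longrightarrow> x \<in> V \<Longrightarrow> f (r *\<^sub>R x) = r *\<^sub>R f x"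
  by (auto simp: linear_on_def)

lemma linear_on_zero: "linear_on V W f \<Longrightarrow> x \<in> V \<Longrightarrow> f 0 = 0"
  using linear_on_scaleR[of V W f x 0] by simp

lemma linear_on_diff:
  assumes "linear_on V W f" "subspace V" "x \<in> V" "y \<in> V"
  shows "f (x - y) = f x - f y"
proof -
  have "f (x + (- 1) *\<^sub>R y) = f x + (- 1) *\<^sub>R f y"
    using assms by (metis linear_on_add linear_on_scaleR subspace_scale)
  then show ?thesis by simp
qed

lemma linear_on_sum:
  assumes f: "linear_on V W f" and V: "subspace V" and v: "\<And>i. i \<in> I \<Longrightarrow> v i \<in> V"
  shows "f (\<Sum>i\<in>I. v i) = (\<Sum>i\<in>I. f (v i))"
proof (cases "finite I")
  case True
  then show ?thesis using v
  proof (induction I)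
    case empty
    then show ?case using linear_on_zero[OF f subspace_0[OF V]] by simp
  next
    case (insert i I)
    then have "(\<Sum>i\<in>I. v i) \<in> V" using V by (auto intro: subspace_sum)
    then show ?case using insert linear_on_add[OF f] by simp
  qed
next
  case False
  then show ?thesis using linear_on_zero[OF f subspace_0[OF V]] by simp
qed

lemma linear_on_compose:
  "linear_on V W f \<Longrightarrow> linear_on W X g \<Longrightarrow> linear_on V X (g \<circ> f)"
  by (auto simp: linear_on_def image_subset_iff)

lemma linear_on_subset:
  "linear_on V W f \<Longrightarrow> V' \<subseteq> V \<Longrightarrow> (\<And>x. x \<in> V' \<Longrightarrow> f x \<in> W') \<Longrightarrow> linear_on V' W' f"
  unfolding linear_on_def by blast

lemma linear_on_inv_into:
  assumes f: "linear_on V W f" and V: "subspace V" and b: "bij_betw f V W"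
  shows "linear_on W V (inv_into V f)"
proof -
  let ?g = "inv_into V f"
  have g: "?g y \<in> V" "f (?g y) = y" if "y \<in> W" for y
    using b that by (auto simp: bij_betw_def inv_into_into f_inv_into_f)
  have gf: "?g (f x) = x" if "x \<in> V" for x using b that by (auto simp: bij_betw_def)
  show ?thesis unfolding linear_on_def
  proof (intro conjI ballI allI)
    show "?g ` W \<subseteq> V" using g by auto
    show "?g (x + y) = ?g x + ?g y" if "x \<in> W" "y \<in> W" for x y
      using gf[of "?g x + ?g y"] g that linear_on_add[OF f] subspace_add[OF V] by metis
    show "?g (r *\<^sub>R x) = r *\<^sub>R ?g x" if "x \<in> W" for r x
      using gf[of "r *\<^sub>R ?g x"] g that linear_on_scaleR[OF f] subspace_scale[OF V] by metis
  qed
qed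


section \<open>Homogeneous components\<close>

text \<open>Stated for a bare family of subspaces, so that it serves both the components of an
  algebra and the pieces \<open>I \<inter> comp A g\<close> of a graded ideal.\<close>

lemma span_UN_decomposes:
  assumes C: "\<And>g. subspace (C g)" and x: "x \<in> span (\<Union>g. C g)"
  shows "\<exists>f. (\<forall>g. f g \<in> C g) \<and> finite {g. f g \<noteq> 0} \<and> x = (\<Sum>g | f g \<noteq> 0. f g)"
  using x
proof (induction rule: span_induct_alt)
  case base
  show ?case using C by (intro exI[of _ "\<lambda>_. 0"]) (auto intro: subspace_0)
next
  case (step c x y)
  then obtain g f where g: "x \<in> C g" and f: "\<forall>g. f g \<in> C g" "finite {g. f g \<noteq> 0}"
    "y = (\<Sum>g | f g \<noteq> 0. f g)" by blast
  let ?h = "\<lambda>k. (if k = g then c *\<^sub>R x else 0) + f k"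
  \<comment> \<open>Adding \<open>c *\<^sub>R x\<close> in degree \<open>g\<close> may cancel
    \<open>f g\<close>, so the sum is taken over \<open>?S\<close>, which contains the support of
    \<open>?h\<close>.\<close>
  let ?S = "insert g {g. f g \<noteq> 0}"
  have mem: "\<forall>k. ?h k \<in> C k" using g f C by (auto intro: subspace_add subspace_scale)
  have sub: "{k. ?h k \<noteq> 0} \<subseteq> ?S" by auto
  have fin: "finite {k. ?h k \<noteq> 0}" using sub f(2) by (meson finite_insert finite_subset)
  have "(\<Sum>k | ?h k \<noteq> 0. ?h k) = (\<Sum>k\<in>?S. ?h k)"
    using sub f(2) by (intro sum.mono_neutral_left) auto
  also have "\<dots> = (\<Sum>k\<in>?S. if k = g then c *\<^sub>R x else 0) + (\<Sum>k\<in>?S. f k)"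
    by (rule sum.distrib)
  also have "(\<Sum>k\<in>?S. f k) = (\<Sum>k | f k \<noteq> 0. f k)"
    using f(2) by (intro sum.mono_neutral_right) auto
  also have "(\<Sum>k\<in>?S. if k = g then c *\<^sub>R x else 0) = c *\<^sub>R x"
    using f(2) by (subst sum.delta) auto
  finally have "(\<Sum>k | ?h k \<noteq> 0. ?h k) = c *\<^sub>R x + y" using f(3) by simp
  then show ?case using mem fin by (intro exI[of _ ?h]) auto
qed

text \<open>Uniqueness of decompositions is reduced to independence: the difference of two
  decompositions of an element is a decomposition of 0. The loop algebra, the centroid, the reals
  and the auxiliary algebra of \<open>loop_representative\<close> are all shown to be graded this
  way.\<close>

lemma graded_algebraI:
  fixes A :: "('g::ab_group_add, 'v::real_vector) galg"
  assumes A: "real_algebra A" and C: "\<And>g. subspace (comp A g)"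
    and sp: "carrier A = span (\<Union>g. comp A g)"
    and ind: "\<And>f. \<forall>g. f g \<in> comp A g \<Longrightarrow> finite {g. f g \<noteq> 0} \<Longrightarrow> (\<Sum>g | f g \<noteq> 0. f g) = 0
      \<Longrightarrow> \<forall>g. f g = 0"
    and m: "\<And>g h x y. x \<in> comp A g \<Longrightarrow> y \<in> comp A h \<Longrightarrow> mult A x y \<in> comp A (g + h)"
  shows "graded_algebra A"
  unfolding graded_algebra_def
proof (intro conjI allI ballI)
  show "comp A g \<subseteq> carrier A" for g unfolding sp by (auto intro: span_base)
  fix x assume x: "x \<in> carrier A"
  then obtain f where f: "decomposes A x f"
    using span_UN_decomposes[of "comp A" x, OF C] sp by (auto simp: decomposes_def)
  moreover have "f' = f" if f': "decomposes A x f'" for f'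
  proof -
    let ?d = "\<lambda>g. f' g - f g" and ?S = "{g. f g \<noteq> 0} \<union> {g. f' g \<noteq> 0}"
    have fin: "finite ?S" using f f' by (auto simp: decomposes_def)
    have sub: "{g. ?d g \<noteq> 0} \<subseteq> ?S" by auto
    have "(\<Sum>g | ?d g \<noteq> 0. ?d g) = (\<Sum>g\<in>?S. ?d g)"
      using sub fin by (intro sum.mono_neutral_left) auto
    also have "\<dots> = (\<Sum>g\<in>?S. f' g) - (\<Sum>g\<in>?S. f g)" by (rule sum_subtractf)
    also have "(\<Sum>g\<in>?S. f' g) = x" using f' fin unfolding decomposes_def
      by (auto intro: sum.mono_neutral_right)
    also have "(\<Sum>g\<in>?S. f g) = x" using f fin unfolding decomposes_def
      by (auto intro: sum.mono_neutral_right)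
    finally have "(\<Sum>g | ?d g \<noteq> 0. ?d g) = 0" by simp
    moreover have "\<forall>g. ?d g \<in> comp A g"
      using f f' C by (auto simp: decomposes_def intro: subspace_diff)
    ultimately have "\<forall>g. ?d g = 0"
      using fin sub by (intro ind) (auto intro: finite_subset)
    then show ?thesis by (auto simp: fun_eq_iff)
  qed
  ultimately show "\<exists>!f. decomposes A x f" by blast
qed (use A C m in auto)

locale graded =
  fixes A :: "('g::ab_group_add, 'v::real_vector) galg"
  assumes graded_algebra: "graded_algebra A"
begin

lemma algebra: "real_algebra A" using graded_algebra by (simp add: graded_algebra_def)
lemma subspace_carrier: "subspace (carrier A)" using algebra by (simp add: real_algebra_def)
lemma subspace_comp: "subspace (comp A g)" using graded_algebra by (simp add: graded_algebra_def)
lemma comp_carrier: "x \<in> comp A g \<Longrightarrow> x \<in> carrier A"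
  using graded_algebra by (auto simp: graded_algebra_def)

lemma zero_carrier [simp]: "0 \<in> carrier A" using subspace_carrier by (rule subspace_0)
lemma zero_comp [simp]: "0 \<in> comp A g" using subspace_comp by (rule subspace_0)
lemma add_carrier: "x \<in> carrier A \<Longrightarrow> y \<in> carrier A \<Longrightarrow> x + y \<in> carrier A"
  using subspace_carrier by (rule subspace_add)
lemma scaleR_carrier: "x \<in> carrier A \<Longrightarrow> r *\<^sub>R x \<in> carrier A"
  using subspace_carrier by (rule subspace_scale)
lemma add_comp: "x \<in> comp A g \<Longrightarrow> y \<in> comp A g \<Longrightarrow> x + y \<in> comp A g"
  using subspace_comp by (rule subspace_add)
lemma scaleR_comp: "x \<in> comp A g \<Longrightarrow> r *\<^sub>R x \<in> comp A g"
  using subspace_comp by (rule subspace_scale)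

lemma mult_comp: "x \<in> comp A g \<Longrightarrow> y \<in> comp A h \<Longrightarrow> mult A x y \<in> comp A (g + h)"
  using graded_algebra by (simp add: graded_algebra_def)
lemma linear_mult_right: "x \<in> carrier A \<Longrightarrow> linear_on (carrier A) (carrier A) (\<lambda>y. mult A x y)"
  using algebra by (auto simp: real_algebra_def)
lemma linear_mult_left: "y \<in> carrier A \<Longrightarrow> linear_on (carrier A) (carrier A) (\<lambda>x. mult A x y)"
  using algebra by (auto simp: real_algebra_def)
lemma mult_carrier: "x \<in> carrier A \<Longrightarrow> y \<in> carrier A \<Longrightarrow> mult A x y \<in> carrier A"
  using linear_on_mem[OF linear_mult_right] .
lemma mult_zero_right [simp]: "x \<in> carrier A \<Longrightarrow> mult A x 0 = 0"
  using linear_mult_right linear_on_zero by fastforce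
lemma mult_zero_left [simp]: "x \<in> carrier A \<Longrightarrow> mult A 0 x = 0"
  using linear_mult_left linear_on_zero by fastforce
lemma mult_add_right:
  "x \<in> carrier A \<Longrightarrow> y \<in> carrier A \<Longrightarrow> y' \<in> carrier A \<Longrightarrow> mult A x (y + y') = mult A x y + mult A x y'"
  using linear_on_add[OF linear_mult_right] .
lemma mult_add_left:
  "y \<in> carrier A \<Longrightarrow> x \<in> carrier A \<Longrightarrow> x' \<in> carrier A \<Longrightarrow> mult A (x + x') y = mult A x y + mult A x' y"
  using linear_on_add[OF linear_mult_left] .
lemma mult_scaleR_right:
  "x \<in> carrier A \<Longrightarrow> y \<in> carrier A \<Longrightarrow> mult A x (r *\<^sub>R y) = r *\<^sub>R mult A x y"
  using linear_on_scaleR[OF linear_mult_right] .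
lemma mult_scaleR_left:
  "y \<in> carrier A \<Longrightarrow> x \<in> carrier A \<Longrightarrow> mult A (r *\<^sub>R x) y = r *\<^sub>R mult A x y"
  using linear_on_scaleR[OF linear_mult_left] .

lemma decomposes_hcomp: "x \<in> carrier A \<Longrightarrow> decomposes A x (hcomp A x)"
  using graded_algebra unfolding graded_algebra_def hcomp_def by (metis theI')

lemma hcomp_comp: "x \<in> carrier A \<Longrightarrow> hcomp A x g \<in> comp A g"
  using decomposes_hcomp by (auto simp: decomposes_def)

lemma hcomp_carrier: "x \<in> carrier A \<Longrightarrow> hcomp A x g \<in> carrier A"
  using hcomp_comp comp_carrier by blast

lemma finite_hcomp: "x \<in> carrier A \<Longrightarrow> finite {g. hcomp A x g \<noteq> 0}"
  using decomposes_hcomp by (auto simp: decomposes_def)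

lemma sum_hcomp_superset:
  assumes "x \<in> carrier A" "finite S" "{g. hcomp A x g \<noteq> 0} \<subseteq> S"
  shows "(\<Sum>g\<in>S. hcomp A x g) = x"
proof -
  have "(\<Sum>g\<in>S. hcomp A x g) = (\<Sum>g | hcomp A x g \<noteq> 0. hcomp A x g)"
    using assms by (intro sum.mono_neutral_right) auto
  then show ?thesis using decomposes_hcomp[OF assms(1)] by (simp add: decomposes_def)
qed

lemma sum_hcomp: "x \<in> carrier A \<Longrightarrow> (\<Sum>g | hcomp A x g \<noteq> 0. hcomp A x g) = x"
  using sum_hcomp_superset finite_hcomp by blast

text \<open>Allowing any finite \<open>S\<close> outside which \<open>f\<close> vanishes avoids
  determining the support of \<open>f\<close> exactly, which cancellation would make
  awkward.\<close>

lemma hcomp_eqI: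
  assumes "finite S" "\<And>g. f g \<in> comp A g" "\<And>g. g \<notin> S \<Longrightarrow> f g = 0" "x = (\<Sum>g\<in>S. f g)"
  shows "hcomp A x = f"
proof -
  have x: "x \<in> carrier A" unfolding assms(4)
    by (rule subspace_sum[OF subspace_carrier]) (use assms(2) comp_carrier in blast)
  have sub: "{g. f g \<noteq> 0} \<subseteq> S" using assms(3) by auto
  have "(\<Sum>g | f g \<noteq> 0. f g) = x" unfolding assms(4) using assms(1) sub
    by (intro sum.mono_neutral_left) auto
  then have "decomposes A x f" using assms(1,2) sub by (auto simp: decomposes_def finite_subset)
  then show ?thesis using decomposes_hcomp[OF x] graded_algebra x
    unfolding graded_algebra_def by blast
qed

lemmas hcomp_hom = hcomp_homogeneous[OF graded_algebra]

lemma hcomp_zero [simp]: "hcomp A 0 g = 0"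
  using hcomp_hom[OF zero_comp] by simp

lemma linear_hcomp: "linear_on (carrier A) (comp A g) (\<lambda>x. hcomp A x g)"
proof -
  have "hcomp A (x + y) = (\<lambda>g. hcomp A x g + hcomp A y g)"
    if "x \<in> carrier A" "y \<in> carrier A" for x y
  proof (rule hcomp_eqI)
    let ?S = "{g. hcomp A x g \<noteq> 0} \<union> {g. hcomp A y g \<noteq> 0}"
    show "finite ?S" using that finite_hcomp by auto
    then show "x + y = (\<Sum>g\<in>?S. hcomp A x g + hcomp A y g)"
      using sum_hcomp_superset[of x ?S] sum_hcomp_superset[of y ?S] that
      by (simp add: sum.distrib)
  qed (use that hcomp_comp add_comp in auto)
  moreover have "hcomp A (r *\<^sub>R x) = (\<lambda>g. r *\<^sub>R hcomp A x g)" if "x \<in> carrier A" for r x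
  proof (rule hcomp_eqI)
    let ?S = "{g. hcomp A x g \<noteq> 0}"
    show "finite ?S" using that finite_hcomp by auto
    then show "r *\<^sub>R x = (\<Sum>g\<in>?S. r *\<^sub>R hcomp A x g)"
      using sum_hcomp[of x] that by (simp flip: scaleR_sum_right)
  qed (use that hcomp_comp scaleR_comp in auto)
  ultimately show ?thesis using hcomp_comp by (auto simp: linear_on_def)
qed

lemmas hcomp_add = linear_on_add[OF linear_hcomp]
lemmas hcomp_scaleR = linear_on_scaleR[OF linear_hcomp]

lemma hcomp_eq_0: "x \<in> carrier A \<Longrightarrow> (\<And>g. hcomp A x g = 0) \<Longrightarrow> x = 0"
  using sum_hcomp[of x] by simp

lemma comp_disjoint: "x \<in> comp A g \<Longrightarrow> x \<in> comp A h \<Longrightarrow> x \<noteq> 0 \<Longrightarrow> g = h"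
  using hcomp_hom[of x g] hcomp_hom[of x h] by (auto simp: fun_eq_iff split: if_splits)

text \<open>The basic reduction to homogeneous elements: both sides of an identity between linear or
  bilinear expressions are additive in each argument, so it can be checked degree by degree.\<close>

lemma carrier_induct [consumes 1, case_names homogeneous add]:
  assumes x: "x \<in> carrier A" and hom: "\<And>g x. x \<in> comp A g \<Longrightarrow> P x"
    and add: "\<And>x y. x \<in> carrier A \<Longrightarrow> y \<in> carrier A \<Longrightarrow> P x \<Longrightarrow> P y \<Longrightarrow> P (x + y)"
  shows "P x"
proof -
  have "(\<Sum>g\<in>S. hcomp A x g) \<in> carrier A \<and> P (\<Sum>g\<in>S. hcomp A x g)" if "finite S" for S
    using that
  proof (induction S)
    case empty
    then show ?case using hom[OF zero_comp] by simp
  next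
    case (insert g S)
    then show ?case using hom[OF hcomp_comp[OF x]] add hcomp_carrier[OF x] add_carrier by simp
  qed
  from this[OF finite_hcomp[OF x]] show ?thesis using sum_hcomp[OF x] by simp
qed

lemma linear_on_eqI:
  assumes "linear_on (carrier A) W f" "linear_on (carrier A) W' f'"
    and "\<And>g x. x \<in> comp A g \<Longrightarrow> f x = f' x" and "x \<in> carrier A"
  shows "f x = f' x"
  using assms(4) by (induction rule: carrier_induct)
    (use assms in \<open>auto simp: linear_on_add\<close>)

lemma nonzero_homogeneous:
  assumes "carrier A \<noteq> {0}"
  obtains g x where "x \<in> comp A g" "x \<noteq> 0"
proof -
  obtain x where "x \<in> carrier A" "x \<noteq> 0" using assms zero_carrier by blast
  then show ?thesis using hcomp_eq_0[of x] hcomp_comp[of x] that by blast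
qed

text \<open>Multiplication by a homogeneous element shifts all degrees by the same amount, so
  different components are never mixed.\<close>

lemma hcomp_mult_left:
  assumes x: "x \<in> comp A g" and y: "y \<in> carrier A"
  shows "hcomp A (mult A x y) (g + k) = mult A x (hcomp A y k)"
  using y
proof (induction rule: carrier_induct)
  case (homogeneous h y)
  show ?case using comp_carrier[OF x]
    by (simp add: hcomp_hom[OF homogeneous] hcomp_hom[OF mult_comp[OF x homogeneous]])
next
  case (add y y')
  then show ?case using comp_carrier[OF x]
    by (simp add: mult_add_right hcomp_add mult_carrier hcomp_carrier)
qed

lemma hcomp_mult_right:
  assumes x: "x \<in> comp A g" and y: "y \<in> carrier A"
  shows "hcomp A (mult A y x) (k + g) = mult A (hcomp A y k) x"
  using y
proof (induction rule: carrier_induct)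
  case (homogeneous h y)
  show ?case using comp_carrier[OF x]
    by (simp add: hcomp_hom[OF homogeneous] hcomp_hom[OF mult_comp[OF homogeneous x]])
next
  case (add y y')
  then show ?case using comp_carrier[OF x]
    by (simp add: mult_add_left hcomp_add mult_carrier hcomp_carrier)
qed

lemma sum_hcomp_linear:
  assumes t: "\<And>g. linear_on (comp A g) W (t g)" and x: "x \<in> carrier A"
    and S: "finite S" "{g. hcomp A x g \<noteq> 0} \<subseteq> S"
  shows "(\<Sum>g | hcomp A x g \<noteq> 0. t g (hcomp A x g)) = (\<Sum>g\<in>S. t g (hcomp A x g))"
  using S linear_on_zero[OF t zero_comp] by (intro sum.mono_neutral_left) auto

end

section \<open>Linear and bilinear maps given degree by degree\<close>

definition graded_ext :: "('g, 'v::real_vector) galg \<Rightarrow> ('g \<Rightarrow> 'v \<Rightarrow> 'w::real_vector) \<Rightarrow> 'v \<Rightarrow> 'w" where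
  "graded_ext A t x =
     (if x \<in> carrier A then \<Sum>g | hcomp A x g \<noteq> 0. t g (hcomp A x g) else 0)"

text \<open>The instance \<open>m p q x y = \<mu> (cocycle \<xi> p q) *\<^sub>R mult A x y\<close>
  is the product of \<open>twist\<close>; \<open>loop_representative\<close> uses another
  instance.\<close>

definition graded_bilinear ::
  "('g, 'v::real_vector) galg \<Rightarrow> ('g \<Rightarrow> 'g \<Rightarrow> 'v \<Rightarrow> 'v \<Rightarrow> 'w::real_vector) \<Rightarrow> 'v \<Rightarrow> 'v \<Rightarrow> 'w" where
  "graded_bilinear A m x y =
     (\<Sum>p | hcomp A x p \<noteq> 0. \<Sum>q | hcomp A y q \<noteq> 0. m p q (hcomp A x p) (hcomp A y q))"

context graded
begin

lemma vanishes_graded_ext: "vanishes_outside (carrier A) (graded_ext A t)"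
  by (simp add: vanishes_outside_def graded_ext_def)

lemma graded_ext_hom:
  assumes "\<And>g. linear_on (comp A g) W (t g)" "x \<in> comp A g"
  shows "graded_ext A t x = t g x"
proof -
  have c: "x \<in> carrier A" and sub: "{k. hcomp A x k \<noteq> 0} \<subseteq> {g}"
    using comp_carrier[OF assms(2)] by (auto simp: hcomp_hom[OF assms(2)])
  have "graded_ext A t x = (\<Sum>k\<in>{g}. t k (hcomp A x k))"
    using c sum_hcomp_linear[OF assms(1) c _ sub] by (simp add: graded_ext_def)
  then show ?thesis by (simp add: hcomp_hom[OF assms(2)])
qed

lemma linear_graded_ext:
  assumes t: "\<And>g. linear_on (comp A g) W (t g)" and W: "subspace W"
  shows "linear_on (carrier A) W (graded_ext A t)"
  unfolding linear_on_def
proof (intro conjI ballI allI)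
  show "graded_ext A t ` carrier A \<subseteq> W"
    using linear_on_mem[OF t hcomp_comp] by (auto simp: graded_ext_def intro!: subspace_sum[OF W])
next
  fix x y assume xy: "x \<in> carrier A" "y \<in> carrier A"
  let ?S = "{g. hcomp A x g \<noteq> 0} \<union> {g. hcomp A y g \<noteq> 0} \<union> {g. hcomp A (x + y) g \<noteq> 0}"
  have S: "finite ?S" using xy finite_hcomp add_carrier by blast
  have sub: "{g. hcomp A x g \<noteq> 0} \<subseteq> ?S" "{g. hcomp A y g \<noteq> 0} \<subseteq> ?S" "{g. hcomp A (x + y) g \<noteq> 0} \<subseteq> ?S"
    by auto
  note e = sum_hcomp_linear[OF t xy(1) S sub(1)] sum_hcomp_linear[OF t xy(2) S sub(2)]
    sum_hcomp_linear[OF t add_carrier[OF xy] S sub(3)]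
  have "(\<Sum>g\<in>?S. t g (hcomp A (x + y) g)) =
      (\<Sum>g\<in>?S. t g (hcomp A x g)) + (\<Sum>g\<in>?S. t g (hcomp A y g))"
    unfolding sum.distrib[symmetric]
    by (rule sum.cong) (use xy hcomp_comp hcomp_add linear_on_add[OF t] in auto)
  then show "graded_ext A t (x + y) = graded_ext A t x + graded_ext A t y"
    unfolding graded_ext_def using xy add_carrier[OF xy] e by simp
next
  fix r x assume x: "x \<in> carrier A"
  let ?S = "{g. hcomp A x g \<noteq> 0} \<union> {g. hcomp A (r *\<^sub>R x) g \<noteq> 0}"
  have S: "finite ?S" using x finite_hcomp scaleR_carrier by blast
  have sub: "{g. hcomp A x g \<noteq> 0} \<subseteq> ?S" "{g. hcomp A (r *\<^sub>R x) g \<noteq> 0} \<subseteq> ?S"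
    by auto
  note e = sum_hcomp_linear[OF t x S sub(1)] sum_hcomp_linear[OF t scaleR_carrier[OF x] S sub(2)]
  have "(\<Sum>g\<in>?S. t g (hcomp A (r *\<^sub>R x) g)) = r *\<^sub>R (\<Sum>g\<in>?S. t g (hcomp A x g))"
    unfolding scaleR_sum_right
    by (rule sum.cong) (use x hcomp_comp hcomp_scaleR linear_on_scaleR[OF t] in auto)
  then show "graded_ext A t (r *\<^sub>R x) = r *\<^sub>R graded_ext A t x"
    unfolding graded_ext_def using x scaleR_carrier[OF x] e by simp
qed

text \<open>The double sum is an extension inside an extension, so bilinearity comes from linearity
  of \<open>graded_ext\<close>.\<close>

lemma graded_bilinear_eq:
  assumes x: "x \<in> carrier A" and y: "y \<in> carrier A"
  shows "graded_bilinear A m x y = graded_ext A (\<lambda>p a. graded_ext A (\<lambda>q b. m p q a b) y) x"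
  using assms by (simp add: graded_bilinear_def graded_ext_def)

context
  fixes W :: "'w::real_vector set" and m :: "'g \<Rightarrow> 'g \<Rightarrow> 'v \<Rightarrow> 'v \<Rightarrow> 'w"
  assumes W: "subspace W"
    and right: "\<And>p q x. x \<in> comp A p \<Longrightarrow> linear_on (comp A q) W (\<lambda>y. m p q x y)"
    and left: "\<And>p q y. y \<in> comp A q \<Longrightarrow> linear_on (comp A p) W (\<lambda>x. m p q x y)"
begin

lemma linear_graded_bilinear_aux:
  assumes y: "y \<in> carrier A"
  shows "linear_on (comp A p) W (\<lambda>a. graded_ext A (\<lambda>q b. m p q a b) y)"
proof -
  have "m p q a (hcomp A y q) \<in> W" if "a \<in> comp A p" for a q
    using linear_on_mem[OF left[OF hcomp_comp[OF y]] that] .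
  then show ?thesis
    using y linear_on_add[OF left[OF hcomp_comp[OF y]]] linear_on_scaleR[OF left[OF hcomp_comp[OF y]]]
    by (auto simp: linear_on_def graded_ext_def sum.distrib scaleR_sum_right intro!: subspace_sum[OF W])
qed

lemma linear_graded_bilinear_left:
  assumes y: "y \<in> carrier A"
  shows "linear_on (carrier A) W (\<lambda>x. graded_bilinear A m x y)"
  using linear_graded_ext[OF linear_graded_bilinear_aux[OF y] W] y subspace_carrier
  by (auto simp: linear_on_def graded_bilinear_eq image_subset_iff subspace_add subspace_scale)

lemma linear_graded_bilinear_right:
  assumes x: "x \<in> carrier A"
  shows "linear_on (carrier A) W (\<lambda>y. graded_bilinear A m x y)"
proof -
  have "linear_on (carrier A) W (graded_ext A (\<lambda>q b. m p q (hcomp A x p) b))" for p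
    by (rule linear_graded_ext[OF right[OF hcomp_comp[OF x]] W])
  then have l: "linear_on (carrier A) W (\<lambda>y. graded_ext A (\<lambda>q b. m p q (hcomp A x p) b) y)" for p
    by simp
  show ?thesis
    unfolding linear_on_def
    using x linear_on_add[OF l] linear_on_scaleR[OF l] linear_on_mem[OF l] subspace_carrier
    by (auto simp: graded_bilinear_eq graded_ext_def[of A _ x] sum.distrib scaleR_sum_right
        subspace_add subspace_scale intro!: subspace_sum[OF W])
qed

lemma graded_bilinear_hom:
  assumes x: "x \<in> comp A p" and y: "y \<in> comp A q"
  shows "graded_bilinear A m x y = m p q x y"
proof -
  note c = comp_carrier[OF x] comp_carrier[OF y]
  show ?thesis
    unfolding graded_bilinear_eq[OF c]
      graded_ext_hom[OF linear_graded_bilinear_aux[OF c(2)] x]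
    by (rule graded_ext_hom[OF right[OF x] y])
qed

end

text \<open>No identity such as associativity has to be preserved, so every family of bilinear maps
  that adds degrees is the product of a graded algebra.\<close>

lemma graded_algebra_graded_bilinear:
  assumes right: "\<And>p q x. x \<in> comp A p \<Longrightarrow> linear_on (comp A q) (comp A (p + q)) (\<lambda>y. m p q x y)"
    and left: "\<And>p q y. y \<in> comp A q \<Longrightarrow> linear_on (comp A p) (comp A (p + q)) (\<lambda>x. m p q x y)"
  shows "graded_algebra (A\<lparr>mult := graded_bilinear A m\<rparr>)"
    and "x \<in> comp A p \<Longrightarrow> y \<in> comp A q \<Longrightarrow> graded_bilinear A m x y = m p q x y"
proof -
  have r: "linear_on (comp A q) (carrier A) (\<lambda>y. m p q x y)" if "x \<in> comp A p" for p q x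
    by (rule linear_on_subset[OF right[OF that]]) (use linear_on_mem[OF right[OF that]] comp_carrier in auto)
  have l: "linear_on (comp A p) (carrier A) (\<lambda>x. m p q x y)" if "y \<in> comp A q" for p q y
    by (rule linear_on_subset[OF left[OF that]]) (use linear_on_mem[OF left[OF that]] comp_carrier in auto)
  have hom: "graded_bilinear A m x y = m p q x y" if "x \<in> comp A p" "y \<in> comp A q" for x y p q
    by (rule graded_bilinear_hom[OF subspace_carrier r l that])
  show "x \<in> comp A p \<Longrightarrow> y \<in> comp A q \<Longrightarrow> graded_bilinear A m x y = m p q x y"
    by (rule hom)
  have "graded_bilinear A m x y \<in> comp A (p + q)" if "x \<in> comp A p" "y \<in> comp A q" for x y p q
    using hom[OF that] linear_on_mem[OF left that(1)] that by auto
  then show "graded_algebra (A\<lparr>mult := graded_bilinear A m\<rparr>)"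
    using graded_algebra linear_graded_bilinear_left[OF subspace_carrier r l]
      linear_graded_bilinear_right[OF subspace_carrier r l]
    by (simp add: graded_algebra_def real_algebra_def decomposes_def)
qed

end

section \<open>Fully faithful and essentially surjective functors\<close>

text \<open>In a groupoid every arrow is invertible, so essential surjectivity asks merely for an
  arrow from \<open>F A\<close> to \<open>X\<close>. A quasi-inverse is obtained by choosing an
  object and an arrow for each \<open>X\<close> and conjugating by these arrows.\<close>

lemma equivalence_of_groupoidsI:
  fixes C :: "('o, 'm) category" and D :: "('p, 'n) category"
  assumes C: "is_groupoid C" and D: "is_groupoid D" and F: "is_functor C D F"
    and ff: "\<And>A B. A \<in> Ob C \<Longrightarrow> B \<in> Ob C \<Longrightarrow>
      bij_betw (on_mor F A B) (Hom C A B) (Hom D (on_ob F A) (on_ob F B))"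
    and ess: "\<And>X. X \<in> Ob D \<Longrightarrow> \<exists>A\<in>Ob C. \<exists>f. f \<in> Hom D (on_ob F A) X"
  shows "equivalence_of_groupoids C D F"
proof -
  let ?F = "on_ob F" and ?c = "Comp D"
  have catC: "is_category C" and catD: "is_category D"
    using C D by (auto simp: is_groupoid_def)
  have idC: "Ident C A \<in> Hom C A A" if "A \<in> Ob C" for A
    using catC that by (auto simp: is_category_def)
  have compC: "Comp C g f \<in> Hom C A E"
    if "A \<in> Ob C" "B \<in> Ob C" "E \<in> Ob C" "f \<in> Hom C A B" "g \<in> Hom C B E" for A B E f g
    using catC that unfolding is_category_def by blast
  have compD: "?c g f \<in> Hom D A E"
    if "A \<in> Ob D" "B \<in> Ob D" "E \<in> Ob D" "f \<in> Hom D A B" "g \<in> Hom D B E" for A B E f g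
    using catD that unfolding is_category_def by blast
  have unitD: "?c f (Ident D A) = f" "?c (Ident D B) f = f"
    if "A \<in> Ob D" "B \<in> Ob D" "f \<in> Hom D A B" for A B f
    using catD that unfolding is_category_def by blast+
  have assocD: "?c h (?c g f) = ?c (?c h g) f"
    if "A \<in> Ob D" "B \<in> Ob D" "E \<in> Ob D" "E' \<in> Ob D"
      "f \<in> Hom D A B" "g \<in> Hom D B E" "h \<in> Hom D E E'" for A B E E' f g h
    using catD that unfolding is_category_def by blast
  have Fob: "?F A \<in> Ob D" if "A \<in> Ob C" for A using F that by (auto simp: is_functor_def)
  have Fmor: "on_mor F A B f \<in> Hom D (?F A) (?F B)"
    if "A \<in> Ob C" "B \<in> Ob C" "f \<in> Hom C A B" for A B f
    using F that by (auto simp: is_functor_def)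
  have Fid: "on_mor F A A (Ident C A) = Ident D (?F A)" if "A \<in> Ob C" for A
    using F that by (auto simp: is_functor_def)
  have Fcomp: "on_mor F A E (Comp C g f) = ?c (on_mor F B E g) (on_mor F A B f)"
    if "A \<in> Ob C" "B \<in> Ob C" "E \<in> Ob C" "f \<in> Hom C A B" "g \<in> Hom C B E" for A B E f g
    using F that unfolding is_functor_def by blast
  \<comment> \<open>The equations in \<open>C\<close> below are proved by applying \<open>F\<close>
    and computing in \<open>D\<close>; faithfulness brings them back.\<close>
  have inj: "f = f'" if "A \<in> Ob C" "B \<in> Ob C" "f \<in> Hom C A B" "f' \<in> Hom C A B"
    "on_mor F A B f = on_mor F A B f'" for A B f f'
    using bij_betw_imp_inj_on[OF ff[OF that(1,2)]] that by (auto dest: inj_onD)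
  define lift where "lift A B = inv_into (Hom C A B) (on_mor F A B)" for A B
  have lift: "lift A B f \<in> Hom C A B" "on_mor F A B (lift A B f) = f"
    if "A \<in> Ob C" "B \<in> Ob C" "f \<in> Hom D (?F A) (?F B)" for A B f
    using bij_betw_imp_surj_on[OF ff[OF that(1,2)]] that
    by (auto simp: lift_def inv_into_into f_inv_into_f)
  define G where "G X = (SOME A. A \<in> Ob C \<and> (\<exists>f. f \<in> Hom D (?F A) X))" for X
  have G: "G X \<in> Ob C" "\<exists>f. f \<in> Hom D (?F (G X)) X" if "X \<in> Ob D" for X
    using someI_ex[of "\<lambda>A. A \<in> Ob C \<and> (\<exists>f. f \<in> Hom D (?F A) X)"] ess[OF that]
    by (auto simp: G_def)
  define e where "e X = (SOME f. f \<in> Hom D (?F (G X)) X)" for X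
  have e: "e X \<in> Hom D (?F (G X)) X" if "X \<in> Ob D" for X
    using someI_ex[OF G(2)[OF that]] by (simp add: e_def)
  define e' where "e' X = (SOME g. g \<in> Hom D X (?F (G X)) \<and>
      ?c g (e X) = Ident D (?F (G X)) \<and> ?c (e X) g = Ident D X)" for X
  have e': "e' X \<in> Hom D X (?F (G X))" "?c (e' X) (e X) = Ident D (?F (G X))"
    "?c (e X) (e' X) = Ident D X" if "X \<in> Ob D" for X
  proof -
    have "is_iso D (?F (G X)) X (e X)"
      using D Fob[OF G(1)[OF that]] that e[OF that] by (auto simp: is_groupoid_def)
    then have "\<exists>g. g \<in> Hom D X (?F (G X)) \<and>
      ?c g (e X) = Ident D (?F (G X)) \<and> ?c (e X) g = Ident D X" by (auto simp: is_iso_def)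
    from someI_ex[OF this] show "e' X \<in> Hom D X (?F (G X))"
      "?c (e' X) (e X) = Ident D (?F (G X))" "?c (e X) (e' X) = Ident D X"
      by (auto simp: e'_def)
  qed
  \<comment> \<open>An arrow from \<open>X\<close> to \<open>Y\<close> is carried to one from
    \<open>F (G X)\<close> to \<open>F (G Y)\<close> by the chosen \<open>e X\<close> and the
    inverse \<open>e' Y\<close>, and then lifted by fullness.\<close>
  define GG where "GG = \<lparr>on_ob = G,
    on_mor = (\<lambda>X Y f. lift (G X) (G Y) (?c (e' Y) (?c f (e X))))\<rparr>"
  have FG: "?F (G X) \<in> Ob D" if "X \<in> Ob D" for X using Fob G(1) that by blast
  have conj: "?c (e' Y) (?c f (e X)) \<in> Hom D (?F (G X)) (?F (G Y))"
    if "X \<in> Ob D" "Y \<in> Ob D" "f \<in> Hom D X Y" for X Y f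
    by (meson that compD FG e e'(1))
  have FGmor: "on_mor F (G X) (G Y) (on_mor GG X Y f) = ?c (e' Y) (?c f (e X))"
    "on_mor GG X Y f \<in> Hom C (G X) (G Y)" if "X \<in> Ob D" "Y \<in> Ob D" "f \<in> Hom D X Y" for X Y f
    using lift G(1) conj that by (auto simp: GG_def)
  \<comment> \<open>The cancellation of \<open>e' Y\<close> by \<open>e Y\<close>, used for
    functoriality of \<open>GG\<close> and for naturality of \<open>e\<close>.\<close>
  have can: "?c (e Y) (?c (e' Y) f) = f"
    if "X \<in> Ob D" "Y \<in> Ob D" "f \<in> Hom D X Y" for X Y f
    using assocD[OF that(1,2) FG[OF that(2)] that(2,3) e'(1)[OF that(2)] e[OF that(2)]]
      e'(3)[OF that(2)] unitD[OF that] by simp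
  have "is_functor D C GG"
    unfolding is_functor_def
  proof (intro conjI ballI)
    show "on_ob GG X \<in> Ob C" if "X \<in> Ob D" for X using G(1) that by (simp add: GG_def)
    show "on_mor GG X Y f \<in> Hom C (on_ob GG X) (on_ob GG Y)"
      if "X \<in> Ob D" "Y \<in> Ob D" "f \<in> Hom D X Y" for X Y f
      using FGmor(2)[OF that] by (simp add: GG_def)
    show "on_mor GG X X (Ident D X) = Ident C (on_ob GG X)" if X: "X \<in> Ob D" for X
    proof -
      have i: "Ident D X \<in> Hom D X X" using catD X by (auto simp: is_category_def)
      have "on_mor F (G X) (G X) (on_mor GG X X (Ident D X)) = Ident D (?F (G X))"
        using FGmor(1)[OF X X i] unitD[OF FG[OF X] X e[OF X]] e'(2)[OF X] by simp
      then show ?thesis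
        using inj[OF G(1)[OF X] G(1)[OF X] FGmor(2)[OF X X i] idC[OF G(1)[OF X]]]
          Fid[OF G(1)[OF X]] by (simp add: GG_def)
    qed
    show "on_mor GG X Z (?c g f) = Comp C (on_mor GG Y Z g) (on_mor GG X Y f)"
      if X: "X \<in> Ob D" and Y: "Y \<in> Ob D" and Z: "Z \<in> Ob D"
        and f: "f \<in> Hom D X Y" and g: "g \<in> Hom D Y Z" for X Y Z f g
    proof -
      note ob = X Y Z FG[OF X] FG[OF Y] FG[OF Z]
      have fe: "?c f (e X) \<in> Hom D (?F (G X)) Y" using compD[OF ob(4,1,2) e[OF X] f] .
      have h: "?c (e' Y) (?c f (e X)) \<in> Hom D (?F (G X)) (?F (G Y))" using conj[OF X Y f] .
      have "?c (?c (e' Z) (?c g (e Y))) (?c (e' Y) (?c f (e X)))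
          = ?c (e' Z) (?c (?c g (e Y)) (?c (e' Y) (?c f (e X))))"
        using assocD[OF ob(4,5,3,6) h compD[OF ob(5,2,3) e[OF Y] g] e'(1)[OF Z]] by simp
      also have "\<dots> = ?c (e' Z) (?c g (?c (e Y) (?c (e' Y) (?c f (e X)))))"
        using assocD[OF ob(4,5,2,3) h e[OF Y] g] by simp
      also have "\<dots> = ?c (e' Z) (?c g (?c f (e X)))" using can[OF ob(4,2) fe] by simp
      also have "\<dots> = ?c (e' Z) (?c (?c g f) (e X))"
        using assocD[OF ob(4,1,2,3) e[OF X] f g] by simp
      finally have "on_mor F (G X) (G Z) (on_mor GG X Z (?c g f)) =
          on_mor F (G X) (G Z) (Comp C (on_mor GG Y Z g) (on_mor GG X Y f))"
        using FGmor(1)[OF X Y f] FGmor(1)[OF Y Z g] FGmor(1)[OF X Z compD[OF ob(1,2,3) f g]]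
          Fcomp[OF G(1)[OF X] G(1)[OF Y] G(1)[OF Z] FGmor(2)[OF X Y f] FGmor(2)[OF Y Z g]]
        by simp
      then show ?thesis
        using inj[OF G(1)[OF X] G(1)[OF Z] FGmor(2)[OF X Z compD[OF ob(1,2,3) f g]]
          compC[OF G(1)[OF X] G(1)[OF Y] G(1)[OF Z] FGmor(2)[OF X Y f] FGmor(2)[OF Y Z g]]]
        by simp
    qed
  qed
  moreover have "natural_iso D D (comp_ftor F GG) id_ftor e"
    unfolding natural_iso_def
  proof (intro conjI ballI)
    show "is_iso D (on_ob (comp_ftor F GG) X) (on_ob id_ftor X) (e X)" if "X \<in> Ob D" for X
      using D e[OF that] that FG[OF that]
      by (simp add: is_groupoid_def comp_ftor_def id_ftor_def GG_def)
    show "?c (e Y) (on_mor (comp_ftor F GG) X Y f) = ?c (on_mor id_ftor X Y f) (e X)"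
      if X: "X \<in> Ob D" and Y: "Y \<in> Ob D" and f: "f \<in> Hom D X Y" for X Y f
      using can[OF FG[OF X] Y compD[OF FG[OF X] X Y e[OF X] f]] FGmor(1)[OF X Y f]
      by (simp add: comp_ftor_def id_ftor_def) (simp add: GG_def)
  qed
  \<comment> \<open>The unit at \<open>A\<close> must be an arrow of \<open>C\<close> from
    \<open>A\<close> to \<open>G (F A)\<close>; fullness provides one over
    \<open>e' (F A)\<close>.\<close>
  moreover have "natural_iso C C id_ftor (comp_ftor GG F)
      (\<lambda>A. lift A (G (?F A)) (e' (?F A)))"
    unfolding natural_iso_def
  proof (intro conjI ballI)
    note l = lift[OF _ G(1)[OF Fob] e'(1)[OF Fob]]
    show "is_iso C (on_ob id_ftor A) (on_ob (comp_ftor GG F) A) (lift A (G (?F A)) (e' (?F A)))"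
      if "A \<in> Ob C" for A
      using C l(1)[OF that that that] that G(1)[OF Fob[OF that]]
      by (simp add: is_groupoid_def comp_ftor_def id_ftor_def GG_def)
    show "Comp C (lift B (G (?F B)) (e' (?F B))) (on_mor id_ftor A B f) =
        Comp C (on_mor (comp_ftor GG F) A B f) (lift A (G (?F A)) (e' (?F A)))"
      if A: "A \<in> Ob C" and B: "B \<in> Ob C" and f: "f \<in> Hom C A B" for A B f
    proof -
      note X = Fob[OF A] and Y = Fob[OF B]
      let ?f = "on_mor F A B f"
      have Ff: "?f \<in> Hom D (?F A) (?F B)" using Fmor[OF A B f] .
      note lA = l(1)[OF A A A] and lB = l(1)[OF B B B]
      have "?c (?c (e' (?F B)) (?c ?f (e (?F A)))) (e' (?F A))
          = ?c (e' (?F B)) (?c (?c ?f (e (?F A))) (e' (?F A)))"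
        using assocD[OF X FG[OF X] Y FG[OF Y] e'(1)[OF X] compD[OF FG[OF X] X Y e[OF X] Ff]
            e'(1)[OF Y]] by simp
      also have "\<dots> = ?c (e' (?F B)) ?f"
        using assocD[OF X FG[OF X] X Y e'(1)[OF X] e[OF X] Ff] e'(3)[OF X] unitD[OF X Y Ff] by simp
      finally have "on_mor F A (G (?F B)) (Comp C (lift B (G (?F B)) (e' (?F B))) f) =
          on_mor F A (G (?F B)) (Comp C (on_mor GG (?F A) (?F B) ?f) (lift A (G (?F A)) (e' (?F A))))"
        using Fcomp[OF A B G(1)[OF Y] f lB] l(2)[OF A A A] l(2)[OF B B B] FGmor(1)[OF X Y Ff]
          Fcomp[OF A G(1)[OF X] G(1)[OF Y] lA FGmor(2)[OF X Y Ff]] by simp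
      then show ?thesis
        using inj[OF A G(1)[OF Y] compC[OF A B G(1)[OF Y] f lB]
            compC[OF A G(1)[OF X] G(1)[OF Y] lA FGmor(2)[OF X Y Ff]]]
        by (simp add: comp_ftor_def id_ftor_def)
    qed
  qed
  ultimately show ?thesis using C D F unfolding equivalence_of_groupoids_def by blast
qed

section \<open>Isomorphisms of graded algebras\<close>

text \<open>Zero outside \<open>carrier B\<close>, so that the inverse again satisfies the vanishing
  condition in \<open>graded_iso\<close>.\<close>

definition iso_inv :: "('g, 'v::real_vector) galg \<Rightarrow> ('g, 'w::real_vector) galg \<Rightarrow> ('v \<Rightarrow> 'w) \<Rightarrow> 'w \<Rightarrow> 'v" where
  "iso_inv A B \<phi> y = (if y \<in> carrier B then inv_into (carrier A) \<phi> y else 0)"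

lemma graded_iso_linear: "graded_iso A B \<phi> \<Longrightarrow> linear_on (carrier A) (carrier B) \<phi>"
  by (simp add: graded_iso_def)

lemma graded_iso_mem: "graded_iso A B \<phi> \<Longrightarrow> x \<in> carrier A \<Longrightarrow> \<phi> x \<in> carrier B"
  by (auto simp: graded_iso_def linear_on_def)

lemma graded_iso_comp: "graded_iso A B \<phi> \<Longrightarrow> x \<in> comp A g \<Longrightarrow> \<phi> x \<in> comp B g"
  unfolding graded_iso_def by blast

lemma graded_iso_mult:
  "graded_iso A B \<phi> \<Longrightarrow> x \<in> carrier A \<Longrightarrow> y \<in> carrier A \<Longrightarrow> \<phi> (mult A x y) = mult B (\<phi> x) (\<phi> y)"
  by (simp add: graded_iso_def)

lemma graded_iso_inj:
  "graded_iso A B \<phi> \<Longrightarrow> x \<in> carrier A \<Longrightarrow> y \<in> carrier A \<Longrightarrow> \<phi> x = \<phi> y \<longleftrightarrow> x = y"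
  by (auto simp: graded_iso_def bij_betw_def dest: inj_onD)

lemma iso_inv_left: "graded_iso A B \<phi> \<Longrightarrow> x \<in> carrier A \<Longrightarrow> iso_inv A B \<phi> (\<phi> x) = x"
  by (simp add: iso_inv_def graded_iso_mem) (simp add: graded_iso_def bij_betw_def)

lemma iso_inv_right: "graded_iso A B \<phi> \<Longrightarrow> y \<in> carrier B \<Longrightarrow> \<phi> (iso_inv A B \<phi> y) = y"
  by (auto simp: iso_inv_def graded_iso_def bij_betw_def f_inv_into_f)

lemma graded_iso_inv:
  fixes A :: "('g::ab_group_add, 'v::real_vector) galg"
  assumes A: "graded_algebra A" and \<phi>: "graded_iso A B \<phi>"
  shows "graded_iso B A (iso_inv A B \<phi>)"
proof -
  interpret graded A using A by unfold_locales
  let ?i = "iso_inv A B \<phi>"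
  have b: "bij_betw \<phi> (carrier A) (carrier B)" using \<phi> by (simp add: graded_iso_def)
  have eq: "?i y = inv_into (carrier A) \<phi> y" if "y \<in> carrier B" for y
    using that by (simp add: iso_inv_def)
  have subB: "subspace (carrier B)"
  proof -
    have im: "carrier B = \<phi> ` carrier A" using b by (simp add: bij_betw_def)
    show ?thesis unfolding im subspace_def
    proof (intro conjI ballI allI)
      show "0 \<in> \<phi> ` carrier A"
        using linear_on_zero[OF graded_iso_linear[OF \<phi>] zero_carrier] by (metis image_eqI zero_carrier)
      show "x + y \<in> \<phi> ` carrier A" if "x \<in> \<phi> ` carrier A" "y \<in> \<phi> ` carrier A" for x y
        using that linear_on_add[OF graded_iso_linear[OF \<phi>], symmetric] add_carrier by auto
      show "r *\<^sub>R x \<in> \<phi> ` carrier A" if "x \<in> \<phi> ` carrier A" for r x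
        using that linear_on_scaleR[OF graded_iso_linear[OF \<phi>], symmetric] scaleR_carrier by auto
    qed
  qed
  have lin: "linear_on (carrier B) (carrier A) ?i"
    using linear_on_inv_into[OF graded_iso_linear[OF \<phi>] subspace_carrier b] eq subB
    by (auto simp: linear_on_def subspace_add subspace_scale image_subset_iff)
  have bij: "bij_betw ?i (carrier B) (carrier A)"
    using bij_betw_inv_into[OF b] bij_betw_cong[of "carrier B" ?i] eq by blast
  have mul: "?i (mult B x y) = mult A (?i x) (?i y)" if "x \<in> carrier B" "y \<in> carrier B" for x y
  proof -
    have c: "?i x \<in> carrier A" "?i y \<in> carrier A" using that linear_on_mem[OF lin] by auto
    have "mult B x y = \<phi> (mult A (?i x) (?i y))"
      using graded_iso_mult[OF \<phi> c] iso_inv_right[OF \<phi>] that by simp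
    then show ?thesis using iso_inv_left[OF \<phi> mult_carrier[OF c]] by simp
  qed
  have "?i ` comp B g = comp A g" for g
  proof -
    have "comp B g = \<phi> ` comp A g" using \<phi> by (simp add: graded_iso_def)
    then show ?thesis using iso_inv_left[OF \<phi>] comp_carrier by (force simp: image_image)
  qed
  then show ?thesis using lin bij mul
    by (auto simp: graded_iso_def vanishes_outside_def iso_inv_def)
qed

text \<open>Outside \<open>carrier A\<close> the composite takes the value \<open>\<psi> 0\<close>,
  so \<open>\<phi> 0 = 0\<close> and \<open>\<psi> 0 = 0\<close> have to be derived;
  \<open>0 \<in> carrier A\<close> gives both by linearity.\<close>

lemma graded_iso_compose:
  assumes 0: "0 \<in> carrier A" and \<phi>: "graded_iso A B \<phi>" and \<psi>: "graded_iso B C \<psi>"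
  shows "graded_iso A C (\<psi> \<circ> \<phi>)"
proof -
  have "\<phi> 0 = 0" using linear_on_zero[OF graded_iso_linear[OF \<phi>] 0] .
  then have "\<psi> 0 = 0"
    using linear_on_zero[OF graded_iso_linear[OF \<psi>] graded_iso_mem[OF \<phi> 0]] by simp
  moreover have "(\<psi> \<circ> \<phi>) ` comp A g = comp C g" for g
    unfolding image_comp[symmetric] using \<phi> \<psi> by (simp add: graded_iso_def)
  ultimately show ?thesis
    using \<phi> \<psi> linear_on_compose[OF graded_iso_linear[OF \<phi>] graded_iso_linear[OF \<psi>]]
      bij_betw_trans[of \<phi> "carrier A" "carrier B" \<psi> "carrier C"] graded_iso_mem[OF \<phi>]
    by (simp add: graded_iso_def vanishes_outside_def)
qed

lemma graded_iso_ident: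
  fixes A :: "('g::ab_group_add, 'v::real_vector) galg"
  assumes A: "graded_algebra A"
  shows "graded_iso A A (scalar_op (carrier A) 1)"
proof -
  interpret graded A using A by unfold_locales
  have "bij_betw (scalar_op (carrier A) 1) (carrier A) (carrier A)"
    using bij_betw_cong[of "carrier A" id "scalar_op (carrier A) 1"] bij_betw_id
    by (auto simp: scalar_op_def)
  moreover have "scalar_op (carrier A) 1 ` comp A g = comp A g" for g
    using comp_carrier by (force simp: scalar_op_def)
  ultimately show ?thesis
    using add_carrier scaleR_carrier mult_carrier
    by (auto simp: graded_iso_def vanishes_outside_def linear_on_def scalar_op_def)
qed

lemma hcomp_degree_map:
  fixes A :: "('g::ab_group_add, 'v::real_vector) galg" and B :: "('g, 'w::real_vector) galg"
  assumes A: "graded_algebra A" and B: "graded_algebra B"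
    and f: "linear_on (carrier A) (carrier B) f"
    and deg: "\<And>g x. x \<in> comp A g \<Longrightarrow> f x \<in> comp B (d + g)"
    and x: "x \<in> carrier A"
  shows "hcomp B (f x) (d + g) = f (hcomp A x g)"
proof -
  interpret A: graded A using A by unfold_locales
  interpret B: graded B using B by unfold_locales
  show ?thesis using x
  proof (induction rule: A.carrier_induct)
    case (homogeneous h x)
    then show ?case using linear_on_zero[OF f A.zero_carrier]
      by (simp add: B.hcomp_hom[OF deg] A.hcomp_hom)
  next
    case (add x y)
    then show ?case using linear_on_mem[OF f] A.hcomp_carrier
      by (simp add: linear_on_add[OF f] A.hcomp_add B.hcomp_add)
  qed
qed

text \<open>A linear map that preserves degrees commutes with taking components, so injectivity and
  surjectivity may be checked in each degree, and multiplicativity on homogeneous elements.\<close>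

lemma graded_isoI:
  fixes A :: "('g::ab_group_add, 'v::real_vector) galg" and B :: "('g, 'w::real_vector) galg"
  assumes A: "graded_algebra A" and B: "graded_algebra B"
    and v: "vanishes_outside (carrier A) \<phi>"
    and lin: "linear_on (carrier A) (carrier B) \<phi>"
    and bij: "\<And>g. bij_betw \<phi> (comp A g) (comp B g)"
    and mul: "\<And>g h x y. x \<in> comp A g \<Longrightarrow> y \<in> comp A h \<Longrightarrow> \<phi> (mult A x y) = mult B (\<phi> x) (\<phi> y)"
  shows "graded_iso A B \<phi>"
proof -
  interpret A: graded A using A by unfold_locales
  interpret B: graded B using B by unfold_locales
  have im: "\<phi> ` comp A g = comp B g" for g using bij by (simp add: bij_betw_def)
  have inj: "x = 0" if "x \<in> carrier A" "\<phi> x = 0" for x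
  proof (rule A.hcomp_eq_0[OF that(1)])
    fix g
    have "\<phi> (hcomp A x g) = hcomp B (\<phi> x) (0 + g)"
      by (rule hcomp_degree_map[OF A B lin _ that(1), symmetric]) (use im in auto)
    then have "\<phi> (hcomp A x g) = \<phi> 0"
      using that linear_on_zero[OF lin A.zero_carrier] by simp
    then show "hcomp A x g = 0"
      using bij[of g] A.hcomp_comp[OF that(1)] by (auto simp: bij_betw_def dest: inj_onD)
  qed
  have "inj_on \<phi> (carrier A)"
  proof (rule inj_onI)
    fix x y assume "x \<in> carrier A" "y \<in> carrier A" "\<phi> x = \<phi> y"
    then show "x = y" using inj[of "x - y"] linear_on_diff[OF lin A.subspace_carrier]
      subspace_diff[OF A.subspace_carrier] by simp
  qed
  moreover have "\<phi> ` carrier A = carrier B"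
  proof
    show "\<phi> ` carrier A \<subseteq> carrier B" using lin by (simp add: linear_on_def)
    show "carrier B \<subseteq> \<phi> ` carrier A"
    proof
      fix y assume "y \<in> carrier B"
      then show "y \<in> \<phi> ` carrier A"
      proof (induction rule: B.carrier_induct)
        case (homogeneous g y)
        then show ?case using im[of g] A.comp_carrier by blast
      next
        case (add x y)
        then show ?case using linear_on_add[OF lin] A.add_carrier by (metis (no_types, lifting) image_iff)
      qed
    qed
  qed
  moreover have "\<phi> (mult A x y) = mult B (\<phi> x) (\<phi> y)" if x: "x \<in> carrier A" and y: "y \<in> carrier A" for x y
    using x
  proof (induction rule: A.carrier_induct)
    case x: (homogeneous g x)
    show ?case using y
    proof (induction rule: A.carrier_induct)
      case (homogeneous h y)
      show ?case using mul[OF x homogeneous] .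
    next
      case (add y y')
      then show ?case using A.comp_carrier[OF x] linear_on_mem[OF lin] A.mult_carrier
        by (simp add: A.mult_add_right B.mult_add_right linear_on_add[OF lin])
    qed
  next
    case (add x x')
    then show ?case using y linear_on_mem[OF lin] A.mult_carrier
      by (simp add: A.mult_add_left B.mult_add_left linear_on_add[OF lin])
  qed
  ultimately show ?thesis using v lin im by (auto simp: graded_iso_def bij_betw_def)
qed

section \<open>Graded ideals and the centroid\<close>

lemma centroid_carrier_iff:
  "T \<in> carrier (centroid A) \<longleftrightarrow>
     vanishes_outside (carrier A) T \<and> linear_on (carrier A) (carrier A) T \<and>
     (\<forall>x\<in>carrier A. \<forall>y\<in>carrier A.
        T (mult A x y) = mult A x (T y) \<and> T (mult A x y) = mult A (T x) y)"
  by (simp add: centroid_def Let_def)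

lemma centroid_comp_iff:
  "T \<in> comp (centroid A) g \<longleftrightarrow>
     T \<in> carrier (centroid A) \<and> (\<forall>h x. x \<in> comp A h \<longrightarrow> T x \<in> comp A (g + h))"
  by (auto simp: centroid_def Let_def image_subset_iff)

lemma mult_centroid [simp]: "mult (centroid A) S T = S \<circ> T"
  by (simp add: centroid_def Let_def)

lemma centroid_linear: "T \<in> carrier (centroid A) \<Longrightarrow> linear_on (carrier A) (carrier A) T"
  by (simp add: centroid_carrier_iff)

lemma centroid_outside: "T \<in> carrier (centroid A) \<Longrightarrow> x \<notin> carrier A \<Longrightarrow> T x = 0"
  by (simp add: centroid_carrier_iff vanishes_outside_def)

lemma centroid_compD: "T \<in> comp (centroid A) g \<Longrightarrow> x \<in> comp A h \<Longrightarrow> T x \<in> comp A (g + h)"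
  by (simp add: centroid_comp_iff)

lemma centroid_comp_carrier: "T \<in> comp (centroid A) g \<Longrightarrow> T \<in> carrier (centroid A)"
  by (simp add: centroid_comp_iff)

context graded
begin

lemma centroidI:
  assumes v: "vanishes_outside (carrier A) T" and lin: "linear_on (carrier A) (carrier A) T"
    and hom: "\<And>g h x y. x \<in> comp A g \<Longrightarrow> y \<in> comp A h \<Longrightarrow>
      T (mult A x y) = mult A x (T y) \<and> T (mult A x y) = mult A (T x) y"
  shows "T \<in> carrier (centroid A)"
proof -
  have "T (mult A x y) = mult A x (T y) \<and> T (mult A x y) = mult A (T x) y"
    if x: "x \<in> carrier A" and y: "y \<in> carrier A" for x y
    using x
  proof (induction rule: carrier_induct)
    case x: (homogeneous g x)
    show ?case using y
    proof (induction rule: carrier_induct)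
      case (homogeneous h y)
      show ?case using hom[OF x homogeneous] .
    next
      case (add y y')
      then show ?case using comp_carrier[OF x] linear_on_mem[OF lin] mult_carrier
        by (simp add: mult_add_right linear_on_add[OF lin]) metis
    qed
  next
    case (add x x')
    then show ?case using y linear_on_mem[OF lin] mult_carrier
      by (simp add: mult_add_left linear_on_add[OF lin]) metis
  qed
  then show ?thesis using v lin unfolding centroid_carrier_iff by blast
qed

text \<open>The source of new centroid elements: maps given on single components, each raising
  degrees by \<open>d\<close>, are glued together. It yields the parts of a centroid element, the
  lifts to the loop algebra and the operators of the minimal support argument.\<close>

lemma centroid_family:
  assumes t: "\<And>g. linear_on (comp A g) (comp A (d + g)) (t g)"
    and hom: "\<And>g h x y. x \<in> comp A g \<Longrightarrow> y \<in> comp A h \<Longrightarrow>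
      t (g + h) (mult A x y) = mult A x (t h y) \<and> t (g + h) (mult A x y) = mult A (t g x) y"
  shows "graded_ext A t \<in> comp (centroid A) d"
    and "x \<in> comp A g \<Longrightarrow> graded_ext A t x = t g x"
proof -
  have t': "linear_on (comp A g) (carrier A) (t g)" for g
    by (rule linear_on_subset[OF t]) (use linear_on_mem[OF t] comp_carrier in auto)
  show ext: "x \<in> comp A g \<Longrightarrow> graded_ext A t x = t g x" for x g
    by (rule graded_ext_hom[OF t'])
  have "graded_ext A t \<in> carrier (centroid A)"
    by (rule centroidI[OF vanishes_graded_ext linear_graded_ext[OF t' subspace_carrier]])
      (simp add: ext[OF mult_comp] ext, use hom in blast)
  then show "graded_ext A t \<in> comp (centroid A) d"
    using linear_on_mem[OF t] by (auto simp: centroid_comp_iff ext)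
qed

text \<open>The part of degree \<open>d\<close> of a centroid element is again in the centroid,
  since multiplication by homogeneous elements is compatible with taking components. How many of
  these parts are nonzero is a separate matter, settled in \<open>frame_span\<close>.\<close>

lemma centroid_component:
  assumes T: "T \<in> carrier (centroid A)"
  shows "graded_ext A (\<lambda>g x. hcomp A (T x) (d + g)) \<in> comp (centroid A) d"
    and "x \<in> comp A g \<Longrightarrow> graded_ext A (\<lambda>g x. hcomp A (T x) (d + g)) x = hcomp A (T x) (d + g)"
proof -
  note lin = centroid_linear[OF T]
  have l: "linear_on (comp A g) (comp A (d + g)) (\<lambda>x. hcomp A (T x) (d + g))" for g
    by (rule linear_on_subset[OF linear_on_compose[OF lin linear_hcomp, unfolded o_def]])
      (use comp_carrier hcomp_comp linear_on_mem[OF lin] in auto)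
  have "hcomp A (T (mult A x y)) (d + (g + h)) = mult A x (hcomp A (T y) (d + h)) \<and>
      hcomp A (T (mult A x y)) (d + (g + h)) = mult A (hcomp A (T x) (d + g)) y"
    if x: "x \<in> comp A g" and y: "y \<in> comp A h" for g h x y
  proof -
    note c = comp_carrier[OF x] comp_carrier[OF y]
    have "T (mult A x y) = mult A x (T y)" "T (mult A x y) = mult A (T x) y"
      using T c unfolding centroid_carrier_iff by blast+
    moreover have "d + (g + h) = g + (d + h)" "d + (g + h) = (d + g) + h" by (simp_all add: algebra_simps)
    ultimately show ?thesis
      using hcomp_mult_left[OF x, of "T y" "d + h"] hcomp_mult_right[OF y, of "T x" "d + g"]
        linear_on_mem[OF lin] c by metis
  qed
  note f = centroid_family[of d "\<lambda>g x. hcomp A (T x) (d + g)", OF l this]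
  show "graded_ext A (\<lambda>g x. hcomp A (T x) (d + g)) \<in> comp (centroid A) d"
    by (rule f(1))
  show "x \<in> comp A g \<Longrightarrow> graded_ext A (\<lambda>g x. hcomp A (T x) (d + g)) x = hcomp A (T x) (d + g)"
    by (rule f(2))
qed

lemma scalar_op_centroid: "scalar_op (carrier A) r \<in> comp (centroid A) 0"
proof -
  have "scalar_op (carrier A) r \<in> carrier (centroid A)"
    using scaleR_carrier add_carrier mult_carrier mult_scaleR_left mult_scaleR_right
    by (auto simp: centroid_carrier_iff vanishes_outside_def scalar_op_def linear_on_def
        scaleR_add_right)
  then show ?thesis using scaleR_comp by (auto simp: centroid_comp_iff scalar_op_def comp_carrier)
qed

section \<open>Ideals given by their pieces in single degrees\<close>

lemma hcomp_graded_ideal: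
  assumes I: "graded_ideal A I" and x: "x \<in> I"
  shows "hcomp A x g \<in> I"
proof -
  have sub: "subspace I" and sp: "I = span (\<Union>g. I \<inter> comp A g)"
    using I by (auto simp: graded_ideal_def alg_ideal_def)
  have "subspace (I \<inter> comp A g)" for g using sub subspace_comp by (rule subspace_inter)
  from span_UN_decomposes[of "\<lambda>g. I \<inter> comp A g", OF this] x sp
  obtain f where f: "\<forall>g. f g \<in> I \<inter> comp A g" "finite {g. f g \<noteq> 0}" "x = (\<Sum>g | f g \<noteq> 0. f g)"
    by auto
  have "hcomp A x = f" by (rule hcomp_eqI[OF f(2) _ _ f(3)]) (use f(1) in auto)
  then show ?thesis using f(1) by auto
qed

lemma graded_ideal_family:
  assumes sub: "\<And>g. subspace (I g)" and I: "\<And>g. I g \<subseteq> comp A g"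
    and ideal: "\<And>s g a y. a \<in> comp A s \<Longrightarrow> y \<in> I g \<Longrightarrow> mult A a y \<in> I (s + g) \<and> mult A y a \<in> I (s + g)"
  shows "graded_ideal A {x \<in> carrier A. \<forall>g. hcomp A x g \<in> I g}" (is "graded_ideal A ?J")
proof -
  have subJ: "subspace ?J"
    using subspace_0[OF sub] subspace_add[OF sub] subspace_scale[OF sub] add_carrier scaleR_carrier
    by (auto simp: subspace_def hcomp_add hcomp_scaleR)
  have IJ: "x \<in> ?J" if "x \<in> I g" for x g
  proof -
    have "x \<in> comp A g" using that I by auto
    then show ?thesis using that subspace_0[OF sub] by (auto simp: hcomp_hom comp_carrier)
  qed
  have mJ: "mult A x y \<in> ?J \<and> mult A y x \<in> ?J" if x: "x \<in> carrier A" and y: "y \<in> ?J" for x y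
    using x
  proof (induction rule: carrier_induct)
    case x: (homogeneous s x)
    have "mult A x (hcomp A y g) \<in> ?J \<and> mult A (hcomp A y g) x \<in> ?J" for g
      using ideal[OF x] y IJ by blast
    then have "(\<Sum>g\<in>S. mult A x (hcomp A y g)) \<in> ?J \<and> (\<Sum>g\<in>S. mult A (hcomp A y g) x) \<in> ?J" for S
      by (intro conjI subspace_sum[OF subJ]) (rule conjunct1 conjunct2, assumption)+
    from this[of "{g. hcomp A y g \<noteq> 0}"]
    have "(\<Sum>g | hcomp A y g \<noteq> 0. mult A x (hcomp A y g)) \<in> ?J"
      "(\<Sum>g | hcomp A y g \<noteq> 0. mult A (hcomp A y g) x) \<in> ?J" by (rule conjunct1 conjunct2)+
    moreover have c: "y \<in> carrier A" using y by simp
    moreover have "mult A x y = (\<Sum>g | hcomp A y g \<noteq> 0. mult A x (hcomp A y g))"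
      using linear_on_sum[OF linear_mult_right[OF comp_carrier[OF x]] subspace_carrier,
          of "{g. hcomp A y g \<noteq> 0}" "hcomp A y"] hcomp_carrier[OF c] sum_hcomp[OF c] by simp
    moreover have "mult A y x = (\<Sum>g | hcomp A y g \<noteq> 0. mult A (hcomp A y g) x)"
      using linear_on_sum[OF linear_mult_left[OF comp_carrier[OF x]] subspace_carrier,
          of "{g. hcomp A y g \<noteq> 0}" "hcomp A y"] hcomp_carrier[OF c] sum_hcomp[OF c] by simp
    ultimately show ?case by (simp only:)
  next
    case (add x x')
    have "y \<in> carrier A" using y by simp
    then have m: "mult A (x + x') y = mult A x y + mult A x' y" "mult A y (x + x') = mult A y x + mult A y x'"
      using add mult_add_left mult_add_right by auto
    show ?case unfolding m by (intro conjI subspace_add[OF subJ]) (use add in blast)+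
  qed
  have "?J = span (\<Union>g. ?J \<inter> comp A g)"
  proof
    show "span (\<Union>g. ?J \<inter> comp A g) \<subseteq> ?J" by (rule span_minimal[OF _ subJ]) auto
    show "?J \<subseteq> span (\<Union>g. ?J \<inter> comp A g)"
    proof
      fix x assume x: "x \<in> ?J"
      then have "hcomp A x g \<in> ?J \<inter> comp A g" for g using IJ hcomp_comp by blast
      then have "(\<Sum>g | hcomp A x g \<noteq> 0. hcomp A x g) \<in> span (\<Union>g. ?J \<inter> comp A g)"
        by (intro span_sum span_base) blast
      then show "x \<in> span (\<Union>g. ?J \<inter> comp A g)" using sum_hcomp x by simp
    qed
  qed
  then show ?thesis using subJ mJ by (auto simp: graded_ideal_def alg_ideal_def)
qed

text \<open>Working with pieces in single degrees keeps the ideals of later arguments, such as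
  annihilators and intersections with components, free of spans.\<close>

lemma graded_simple_family:
  assumes simple: "graded_simple A"
    and sub: "\<And>g. subspace (I g)" and I: "\<And>g. I g \<subseteq> comp A g"
    and ideal: "\<And>s g a y. a \<in> comp A s \<Longrightarrow> y \<in> I g \<Longrightarrow> mult A a y \<in> I (s + g) \<and> mult A y a \<in> I (s + g)"
    and y: "y \<in> I k" "y \<noteq> 0"
  shows "I g = comp A g"
proof -
  let ?J = "{x \<in> carrier A. \<forall>g. hcomp A x g \<in> I g}"
  have yc: "y \<in> comp A k" using y I by auto
  then have "y \<in> ?J" using y subspace_0[OF sub] by (auto simp: hcomp_hom comp_carrier)
  then have "?J \<noteq> {0}" using y by auto
  moreover have "graded_ideal A ?J" by (rule graded_ideal_family[OF sub I ideal])
  ultimately have J: "?J = carrier A" using simple unfolding graded_simple_def by blast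
  have "x \<in> I g" if x: "x \<in> comp A g" for x
  proof -
    have "x \<in> ?J" using comp_carrier[OF x] J by simp
    then have "hcomp A x g \<in> I g" by simp
    then show ?thesis by (simp add: hcomp_hom[OF x])
  qed
  then show ?thesis using I by auto
qed

lemma graded_simpleI:
  assumes nt: "nontrivial_product A"
    and J: "\<And>J k y g x. alg_ideal A J \<Longrightarrow> y \<in> J \<Longrightarrow> y \<in> comp A k \<Longrightarrow> y \<noteq> 0 \<Longrightarrow> x \<in> comp A g \<Longrightarrow> x \<in> J"
  shows "graded_simple A"
  unfolding graded_simple_def
proof (intro conjI allI impI)
  fix I assume I: "graded_ideal A I"
  then have ideal: "alg_ideal A I" by (simp add: graded_ideal_def)
  show "I = {0} \<or> I = carrier A"
  proof (cases "I = {0}")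
    case False
    moreover have "0 \<in> I" using ideal by (auto simp: alg_ideal_def subspace_0)
    ultimately obtain y where y: "y \<in> I" "y \<noteq> 0" by blast
    have yc: "y \<in> carrier A" using y ideal by (auto simp: alg_ideal_def)
    obtain k where k: "hcomp A y k \<noteq> 0" using hcomp_eq_0[OF yc] y by blast
    have "x \<in> I" if "x \<in> carrier A" for x
      using that
    proof (induction rule: carrier_induct)
      case (homogeneous g x)
      then show ?case using J[OF ideal hcomp_graded_ideal[OF I y(1)] hcomp_comp[OF yc] k] by blast
    next
      case (add x y)
      then show ?case using ideal by (auto simp: alg_ideal_def subspace_add)
    qed
    then show ?thesis using ideal by (auto simp: alg_ideal_def)
  qed simp
qed (use graded_algebra nt in auto)

lemma simple_imp_graded_simple: "simple_algebra A \<Longrightarrow> graded_simple A"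
  using graded_algebra by (auto simp: simple_algebra_def graded_simple_def graded_ideal_def)

lemma nonzero_product_homogeneous:
  assumes "nontrivial_product A"
  shows "\<exists>g h x y. x \<in> comp A g \<and> y \<in> comp A h \<and> mult A x y \<noteq> 0"
proof (rule ccontr)
  assume n: "\<not> ?thesis"
  have hom: "mult A x y = 0" if "x \<in> comp A g" "y \<in> comp A h" for g h x y
    using n that by blast
  have "mult A x y = 0" if x: "x \<in> carrier A" and y: "y \<in> carrier A" for x y
    using x
  proof (induction rule: carrier_induct)
    case x: (homogeneous g x)
    show ?case using y
      by (induction rule: carrier_induct) (use hom x comp_carrier in \<open>auto simp: mult_add_right\<close>)
  next
    case (add x x')
    then show ?case using y by (simp add: mult_add_left)
  qed
  then show False using assms by (auto simp: nontrivial_product_def)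
qed

text \<open>The homogeneous two-sided annihilators form an ideal degree by degree. If one of them is
  nonzero, graded simplicity makes everything annihilate everything, against the nonzero
  product.\<close>

lemma annihilator_zero:
  assumes simple: "graded_simple A" and x: "x \<in> comp A k"
    and ann: "\<And>q b. b \<in> comp A q \<Longrightarrow> mult A x b = 0 \<and> mult A b x = 0"
  shows "x = 0"
proof (rule ccontr)
  assume "x \<noteq> 0"
  define I where "I g = {x \<in> comp A g. \<forall>q b. b \<in> comp A q \<longrightarrow> mult A x b = 0 \<and> mult A b x = 0}" for g
  have sub: "subspace (I g)" for g
    unfolding subspace_def I_def
    using comp_carrier by (auto simp: add_comp scaleR_comp mult_add_left mult_add_right mult_scaleR_left mult_scaleR_right)
  have "I g = comp A g" for g
  proof (rule graded_simple_family[OF simple sub])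
    show "I g \<subseteq> comp A g" for g by (auto simp: I_def)
    show "mult A a y \<in> I (s + g) \<and> mult A y a \<in> I (s + g)" if "a \<in> comp A s" "y \<in> I g" for s g a y
      using that subspace_0[OF sub] by (auto simp: I_def)
    show "x \<in> I k" using x ann by (auto simp: I_def)
  qed (rule \<open>x \<noteq> 0\<close>)
  moreover obtain g h x y where "x \<in> comp A g" "y \<in> comp A h" "mult A x y \<noteq> 0"
    using simple nonzero_product_homogeneous unfolding graded_simple_def by metis
  ultimately show False by (auto simp: I_def)
qed

text \<open>Even if \<open>J\<close> is not graded, its intersections with the components are the
  pieces of a graded ideal, and the nonzero homogeneous element makes them fill the algebra.\<close>

lemma ideal_eq_carrier:
  assumes J: "alg_ideal A J" and simple: "graded_simple A" and y: "y \<in> J" "y \<in> comp A k" "y \<noteq> 0"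
  shows "J = carrier A"
proof -
  have subJ: "subspace J" and JA: "J \<subseteq> carrier A"
    and id: "\<And>x y. x \<in> carrier A \<Longrightarrow> y \<in> J \<Longrightarrow> mult A x y \<in> J \<and> mult A y x \<in> J"
    using J by (auto simp: alg_ideal_def)
  have "J \<inter> comp A g = comp A g" for g
  proof (rule graded_simple_family[OF simple])
    show "subspace (J \<inter> comp A g)" for g using subJ subspace_comp by (rule subspace_inter)
    show "mult A a y \<in> J \<inter> comp A (s + g) \<and> mult A y a \<in> J \<inter> comp A (s + g)"
      if "a \<in> comp A s" "y \<in> J \<inter> comp A g" for s g a y
      using that id[OF comp_carrier] mult_comp[of a s y g] mult_comp[of y g a s]
      by (auto simp: add.commute)
  qed (use y in auto)
  note all = this
  have "x \<in> J" if "x \<in> carrier A" for x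
    using that by (induction rule: carrier_induct) (use all subspace_add[OF subJ] in blast)+
  then show ?thesis using JA by auto
qed

text \<open>For a nonzero element of minimal support in an ideal, each of its components determines
  all the others linearly; these correspondences extend to homogeneous elements of the centroid.\<close>

lemma ideal_homogeneous_element:
  assumes simple: "graded_simple A"
    and cent: "\<And>d T. T \<in> comp (centroid A) d \<Longrightarrow> T \<noteq> 0 \<Longrightarrow> d = 0"
    and J: "alg_ideal A J" and J0: "J \<noteq> {0}"
  obtains y k where "y \<in> J" "y \<in> comp A k" "y \<noteq> 0"
proof -
  have subJ: "subspace J" and JA: "\<And>x. x \<in> J \<Longrightarrow> x \<in> carrier A"
    and id: "\<And>x y. x \<in> carrier A \<Longrightarrow> y \<in> J \<Longrightarrow> mult A x y \<in> J \<and> mult A y x \<in> J"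
    using J by (auto simp: alg_ideal_def)
  let ?supp = "\<lambda>x. {g. hcomp A x g \<noteq> 0}"
  have "\<exists>x. x \<in> J \<and> x \<noteq> 0" using J0 subspace_0[OF subJ] by blast
  from ex_has_least_nat[of "\<lambda>x. x \<in> J \<and> x \<noteq> 0" _ "\<lambda>x. card (?supp x)"] this
  obtain x where x: "x \<in> J" "x \<noteq> 0"
    and min: "\<And>y. y \<in> J \<Longrightarrow> y \<noteq> 0 \<Longrightarrow> card (?supp x) \<le> card (?supp y)" by blast
  define P where "P = ?supp x"
  have finP: "finite P" using finite_hcomp[OF JA[OF x(1)]] by (simp add: P_def)
  obtain p where p: "p \<in> P" using hcomp_eq_0[OF JA[OF x(1)]] x(2) by (auto simp: P_def)
  \<comment> \<open>\<open>K q\<close> collects the elements of \<open>J\<close> whose support lies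
    in the translate of \<open>P\<close> by \<open>q\<close>. Multiplying by an element of degree
    \<open>s\<close> moves \<open>K q\<close> into \<open>K (s + q)\<close>, and \<open>x\<close>
    lies in \<open>K 0\<close>.\<close>
  define K where "K q = {y \<in> J. \<forall>g. hcomp A y g \<noteq> 0 \<longrightarrow> g - q \<in> P}" for q
  have KA: "y \<in> carrier A" if "y \<in> K q" for y q using that JA by (auto simp: K_def)
  have subK: "subspace (K q)" for q
    unfolding subspace_def
  proof (intro conjI ballI allI)
    show "0 \<in> K q" using subspace_0[OF subJ] by (simp add: K_def)
    show "y + y' \<in> K q" if "y \<in> K q" "y' \<in> K q" for y y'
    proof -
      have "hcomp A y g \<noteq> 0 \<or> hcomp A y' g \<noteq> 0" if "hcomp A (y + y') g \<noteq> 0" for g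
        using that hcomp_add[OF KA KA, OF \<open>y \<in> K q\<close> \<open>y' \<in> K q\<close>] by auto
      then show ?thesis using that subspace_add[OF subJ] unfolding K_def by blast
    qed
    show "r *\<^sub>R y \<in> K q" if "y \<in> K q" for y r
      using that KA[OF that] subspace_scale[OF subJ] by (auto simp: K_def hcomp_scaleR)
  qed
  have Kmult: "mult A a y \<in> K (s + q) \<and> mult A y a \<in> K (s + q)"
    if a: "a \<in> comp A s" and y: "y \<in> K q" for a s y q
  proof -
    have "hcomp A (mult A a y) g = mult A a (hcomp A y (g - s))"
      "hcomp A (mult A y a) g = mult A (hcomp A y (g - s)) a" for g
      using hcomp_mult_left[OF a KA[OF y], of "g - s"] hcomp_mult_right[OF a KA[OF y], of "g - s"]
      by (simp_all add: algebra_simps)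
    moreover have "g - (s + q) \<in> P" if "hcomp A y (g - s) \<noteq> 0" for g
    proof -
      have "g - s - q \<in> P" using y that by (simp add: K_def)
      then show ?thesis by (simp add: algebra_simps)
    qed
    ultimately have "g - (s + q) \<in> P" if "hcomp A (mult A a y) g \<noteq> 0 \<or> hcomp A (mult A y a) g \<noteq> 0" for g
      using that comp_carrier[OF a] by (metis mult_zero_left mult_zero_right)
    then show ?thesis using id[OF comp_carrier[OF a]] y unfolding K_def by blast
  qed
  \<comment> \<open>Removing one point from the translate of \<open>P\<close> leaves fewer than
    \<open>card P\<close> degrees, so minimality kills the element. Hence an element of
    \<open>K q\<close> is determined by its component of degree \<open>p + q\<close>.\<close>
  have K0: "y = 0" if y: "y \<in> K q" and 0: "hcomp A y (p + q) = 0" for y q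
  proof (rule ccontr)
    assume "y \<noteq> 0"
    have "?supp y \<subseteq> (\<lambda>g. g + q) ` (P - {p})"
    proof
      fix g assume g: "g \<in> ?supp y"
      then have "g - q \<in> P" "g - q \<noteq> p" using y 0 by (auto simp: K_def)
      then show "g \<in> (\<lambda>g. g + q) ` (P - {p})" by (intro image_eqI[of _ _ "g - q"]) auto
    qed
    then have "card (?supp y) \<le> card (P - {p})"
      using finP by (meson card_image_le card_mono finite_Diff finite_imageI le_trans)
    also have "\<dots> < card P" using card_Diff1_less[OF finP p] .
    finally show False using min[of y] y \<open>y \<noteq> 0\<close> by (simp add: K_def P_def)
  qed
  \<comment> \<open>The translation by \<open>g - p\<close> moves the index \<open>p\<close> of the
    support to \<open>g\<close>. The components found there form an ideal degree by degree; it
    contains the nonzero component of \<open>x\<close> at \<open>p\<close>, so it exhausts every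
    \<open>comp A g\<close>.\<close>
  define I where "I g = (\<lambda>y. hcomp A y g) ` K (g - p)" for g
  have subI: "subspace (I g)" for g
    unfolding subspace_def I_def
  proof (intro conjI ballI allI)
    let ?I = "(\<lambda>y. hcomp A y g) ` K (g - p)"
    show "0 \<in> ?I" using subspace_0[OF subK] by (intro image_eqI[of _ _ 0]) auto
    fix u assume "u \<in> ?I"
    then obtain y where y: "y \<in> K (g - p)" "u = hcomp A y g" by auto
    show "r *\<^sub>R u \<in> ?I" for r
      using y subspace_scale[OF subK y(1)] hcomp_scaleR[OF KA[OF y(1)]]
      by (intro image_eqI[of _ _ "r *\<^sub>R y"]) simp_all
    fix v assume "v \<in> ?I"
    then obtain y' where y': "y' \<in> K (g - p)" "v = hcomp A y' g" by auto
    show "u + v \<in> ?I"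
      using y y' subspace_add[OF subK y(1) y'(1)] hcomp_add[OF KA[OF y(1)] KA[OF y'(1)]]
      by (intro image_eqI[of _ _ "y + y'"]) simp_all
  qed
  have xK: "x \<in> K (p - p)" using x by (auto simp: K_def P_def)
  have I: "I g = comp A g" for g
  proof (rule graded_simple_family[OF simple subI])
    show "I g \<subseteq> comp A g" for g using KA hcomp_comp by (auto simp: I_def)
    show "mult A a y \<in> I (s + g) \<and> mult A y a \<in> I (s + g)" if a: "a \<in> comp A s" and y: "y \<in> I g" for s g a y
    proof -
      obtain w where w: "w \<in> K (g - p)" "y = hcomp A w g" using y by (auto simp: I_def)
      have e: "s + g - p = s + (g - p)" by (simp add: algebra_simps)
      have "hcomp A (mult A a w) (s + g) = mult A a y" "hcomp A (mult A w a) (s + g) = mult A y a"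
        using hcomp_mult_left[OF a KA[OF w(1)], of g] hcomp_mult_right[OF a KA[OF w(1)], of g] w(2)
        by (simp_all add: add.commute)
      then show ?thesis using Kmult[OF a w(1)] unfolding I_def e by (metis image_eqI)
    qed
    show "hcomp A x p \<in> I p" using xK by (auto simp: I_def)
    show "hcomp A x p \<noteq> 0" using p by (simp add: P_def)
  qed
  \<comment> \<open>The inverse of taking the component in degree \<open>g\<close>, which is
    injective on \<open>K (g - p)\<close> by \<open>K0\<close> and onto \<open>comp A g\<close> by
    \<open>I\<close>.\<close>
  define Y where "Y g a = inv_into (K (g - p)) (\<lambda>y. hcomp A y g) a" for g a
  have Y: "Y g a \<in> K (g - p)" "hcomp A (Y g a) g = a" if "a \<in> comp A g" for g a
    using that I[of g] inv_into_into[of a "\<lambda>y. hcomp A y g" "K (g - p)"]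
      f_inv_into_f[of a "\<lambda>y. hcomp A y g" "K (g - p)"] by (simp_all add: Y_def I_def)
  have Yuniq: "Y g a = y" if "y \<in> K (g - p)" "hcomp A y g = a" for g a y
  proof -
    have a: "a \<in> comp A g" using that KA hcomp_comp by blast
    have "hcomp A (Y g a - y) g = 0"
      using linear_on_diff[OF linear_hcomp subspace_carrier KA[OF Y(1)[OF a]] KA[OF that(1)], of g]
        Y(2)[OF a] that(2) by simp
    then have "Y g a - y = 0"
      using K0[of "Y g a - y" "g - p"] subspace_diff[OF subK Y(1)[OF a] that(1)] by simp
    then show ?thesis by simp
  qed
  have "P \<subseteq> {p}"
  proof
    fix i assume i: "i \<in> P"
    \<comment> \<open>Passes from the component in degree \<open>g\<close> to the one whose degree
      is shifted by \<open>i - p\<close>, so the component of \<open>x\<close> at \<open>p\<close>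
      is sent to the one at \<open>i\<close>. The resulting centroid element is nonzero of degree
      \<open>i - p\<close>, and the hypothesis on the centroid forces \<open>i = p\<close>.\<close>
    define t where "t g a = hcomp A (Y g a) ((i - p) + g)" for g a
    have t_linear: "linear_on (comp A g) (comp A ((i - p) + g)) (t g)" for g
      unfolding linear_on_def
    proof (intro conjI ballI allI)
      show "t g ` comp A g \<subseteq> comp A (i - p + g)"
        using hcomp_comp[OF KA[OF Y(1)]] by (auto simp: t_def)
      show "t g (a + b) = t g a + t g b" if "a \<in> comp A g" "b \<in> comp A g" for a b
      proof -
        have "Y g (a + b) = Y g a + Y g b"
          using Y[OF that(1)] Y[OF that(2)] hcomp_add[OF KA KA]
          by (intro Yuniq subspace_add[OF subK]) auto
        then show ?thesis using hcomp_add[OF KA KA, OF Y(1) Y(1), OF that] by (simp add: t_def)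
      qed
      show "t g (r *\<^sub>R a) = r *\<^sub>R t g a" if "a \<in> comp A g" for r a
      proof -
        have "Y g (r *\<^sub>R a) = r *\<^sub>R Y g a"
          using Y[OF that] hcomp_scaleR[OF KA] by (intro Yuniq subspace_scale[OF subK]) auto
        then show ?thesis using hcomp_scaleR[OF KA, OF Y(1), OF that] by (simp add: t_def)
      qed
    qed
    have t_mult: "t (g + h) (mult A a b) = mult A a (t h b) \<and> t (g + h) (mult A a b) = mult A (t g a) b"
      if a: "a \<in> comp A g" and b: "b \<in> comp A h" for g h a b
    proof -
      note YA = KA[OF Y(1)[OF a]] KA[OF Y(1)[OF b]]
      have e: "g + h - p = g + (h - p)" "g + h - p = h + (g - p)"
        "(i - p) + (g + h) = g + ((i - p) + h)" "(i - p) + (g + h) = ((i - p) + g) + h"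
        by (simp_all add: algebra_simps)
      have Y1: "Y (g + h) (mult A a b) = mult A a (Y h b)"
        using Kmult[OF a Y(1)[OF b]] hcomp_mult_left[OF a YA(2), of h] Y(2)[OF b] e
        by (intro Yuniq) metis+
      have Y2: "Y (g + h) (mult A a b) = mult A (Y g a) b"
        using Kmult[OF b Y(1)[OF a]] hcomp_mult_right[OF b YA(1), of g] Y(2)[OF a] e
        by (intro Yuniq) metis+
      show ?thesis unfolding t_def
        using Y1 Y2 hcomp_mult_left[OF a YA(2), of "(i - p) + h"]
          hcomp_mult_right[OF b YA(1), of "(i - p) + g"] e by metis
    qed
    have T: "graded_ext A t \<in> comp (centroid A) (i - p)"
      by (rule centroid_family(1)[OF t_linear t_mult])
    have hom: "graded_ext A t a = t g a" if "a \<in> comp A g" for g a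
      by (rule centroid_family(2)[OF t_linear t_mult that])
    have "graded_ext A t (hcomp A x p) = hcomp A x i"
      using hom[OF hcomp_comp[OF JA[OF x(1)]], of p] Yuniq[OF xK refl] by (simp add: t_def)
    then have "graded_ext A t \<noteq> 0" using i by (auto simp: P_def)
    then show "i \<in> {p}" using cent[OF T] by simp
  qed
  then have "P = {p}" using p by auto
  then have "x = hcomp A x p" using sum_hcomp[OF JA[OF x(1)]] by (simp add: P_def)
  then have "x \<in> comp A p" using hcomp_comp[OF JA[OF x(1)], of p] by simp
  then show thesis using that x by blast
qed

text \<open>A nonzero ideal contains a nonzero homogeneous element by
  \<open>ideal_homogeneous_element\<close> and is therefore everything. For an arbitrary centroid
  element the hypothesis kills all parts \<open>S d\<close> with \<open>d \<noteq> 0\<close>, so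
  that it equals the scalar \<open>S 0\<close>.\<close>

lemma central_simpleI:
  assumes simple: "graded_simple A"
    and cent: "\<And>d T. T \<in> comp (centroid A) d \<Longrightarrow> T \<noteq> 0 \<Longrightarrow> d = 0 \<and> (\<exists>r. T = scalar_op (carrier A) r)"
  shows "central_simple A"
proof -
  have "I = {0} \<or> I = carrier A" if I: "alg_ideal A I" for I
  proof (cases "I = {0}")
    case False
    from ideal_homogeneous_element[OF simple _ I False] cent
    obtain y k where "y \<in> I" "y \<in> comp A k" "y \<noteq> 0" by blast
    then show ?thesis using ideal_eq_carrier[OF I simple] by blast
  qed simp
  then have "simple_algebra A"
    using algebra simple by (auto simp: simple_algebra_def graded_simple_def)
  moreover have "carrier (centroid A) = range (scalar_op (carrier A))"
  proof
    show "range (scalar_op (carrier A)) \<subseteq> carrier (centroid A)"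
      using scalar_op_centroid centroid_comp_carrier by blast
    show "carrier (centroid A) \<subseteq> range (scalar_op (carrier A))"
    proof
      fix T assume T: "T \<in> carrier (centroid A)"
      define S where "S d = graded_ext A (\<lambda>g x. hcomp A (T x) (d + g))" for d
      have S: "S d \<in> comp (centroid A) d" for d using centroid_component(1)[OF T] by (simp add: S_def)
      have Sx: "S d x = hcomp A (T x) (d + g)" if "x \<in> comp A g" for d g x
        using centroid_component(2)[OF T that] by (simp add: S_def)
      have S0: "S d = 0" if "d \<noteq> 0" for d using cent[OF S] that by auto
      have "\<exists>r. S 0 = scalar_op (carrier A) r"
      \<comment> \<open>\<open>cent\<close> speaks of nonzero operators; the zero operator is the
        scalar 0.\<close>
      proof (cases "S 0 = 0")
        case True
        then show ?thesis by (intro exI[of _ 0]) (auto simp: scalar_op_def fun_eq_iff)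
      qed (use cent[OF S] in auto)
      then obtain r where r: "S 0 = scalar_op (carrier A) r" by blast
      have "T x = scalar_op (carrier A) r x" if "x \<in> carrier A" for x
      proof (rule linear_on_eqI[OF centroid_linear[OF T] _ _ that])
        show "linear_on (carrier A) (carrier A) (scalar_op (carrier A) r)"
          using scalar_op_centroid centroid_comp_carrier centroid_linear by blast
        fix g x assume x: "x \<in> comp A g"
        have Tx: "T x \<in> carrier A" using linear_on_mem[OF centroid_linear[OF T] comp_carrier[OF x]] .
        have S0x: "S 0 x \<in> comp A g" using centroid_compD[OF S x, of 0] by simp
        have "hcomp A (T x) k = (if k = g then S 0 x else 0)" for k
          using Sx[OF x, of "k - g"] Sx[OF x, of 0] S0[of "k - g"] by auto
        then have "hcomp A (T x) = hcomp A (S 0 x)"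
          by (simp add: hcomp_hom[OF S0x] fun_eq_iff)
        then have "T x = S 0 x"
          using sum_hcomp[OF Tx] sum_hcomp[OF comp_carrier[OF S0x]] by metis
        then show "T x = scalar_op (carrier A) r x" using r by simp
      qed
      then have "T = scalar_op (carrier A) r"
        using centroid_outside[OF T] by (auto simp: fun_eq_iff scalar_op_def)
      then show "T \<in> range (scalar_op (carrier A))" by simp
    qed
  qed
  ultimately show ?thesis by (simp add: central_simple_def)
qed

end

section \<open>Transport along graded isomorphisms\<close>

lemma centroid_conjugate:
  fixes B :: "('g::ab_group_add, 'v::real_vector) galg" and B' :: "('g, 'w::real_vector) galg"
  assumes B: "graded_algebra B" and \<phi>: "graded_iso B B' \<phi>" and T: "T \<in> comp (centroid B) d"
  shows "\<phi> \<circ> T \<circ> iso_inv B B' \<phi> \<in> comp (centroid B') d"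
proof -
  let ?i = "iso_inv B B' \<phi>"
  have \<psi>: "graded_iso B' B ?i" using graded_iso_inv[OF B \<phi>] .
  interpret graded B using B by unfold_locales
  note Tc = centroid_comp_carrier[OF T]
  note lT = centroid_linear[OF Tc]
  have "\<phi> (T 0) = 0"
    using linear_on_zero[OF lT zero_carrier] linear_on_zero[OF graded_iso_linear[OF \<phi>] zero_carrier] by simp
  then have "vanishes_outside (carrier B') (\<phi> \<circ> T \<circ> ?i)"
    by (auto simp: vanishes_outside_def iso_inv_def)
  moreover have "linear_on (carrier B') (carrier B') (\<phi> \<circ> T \<circ> ?i)"
    using linear_on_compose[OF graded_iso_linear[OF \<psi>] linear_on_compose[OF lT graded_iso_linear[OF \<phi>]]] .
  moreover have "(\<phi> \<circ> T \<circ> ?i) (mult B' x y) = mult B' x ((\<phi> \<circ> T \<circ> ?i) y) \<and>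
      (\<phi> \<circ> T \<circ> ?i) (mult B' x y) = mult B' ((\<phi> \<circ> T \<circ> ?i) x) y"
    if "x \<in> carrier B'" "y \<in> carrier B'" for x y
  proof -
    have c: "?i x \<in> carrier B" "?i y \<in> carrier B" using graded_iso_mem[OF \<psi>] that by auto
    have "T (mult B (?i x) (?i y)) = mult B (?i x) (T (?i y))"
      "T (mult B (?i x) (?i y)) = mult B (T (?i x)) (?i y)"
      using Tc c unfolding centroid_carrier_iff by blast+
    then show ?thesis
      using c linear_on_mem[OF lT c(1)] linear_on_mem[OF lT c(2)]
        graded_iso_mult[OF \<phi> c(1), of "T (?i y)"] graded_iso_mult[OF \<phi> _ c(2), of "T (?i x)"]
      by (simp add: graded_iso_mult[OF \<psi> that] iso_inv_right[OF \<phi> that(1)] iso_inv_right[OF \<phi> that(2)])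
  qed
  ultimately have "\<phi> \<circ> T \<circ> ?i \<in> carrier (centroid B')" unfolding centroid_carrier_iff by blast
  then show ?thesis
    using graded_iso_comp[OF \<phi> centroid_compD[OF T graded_iso_comp[OF \<psi>]]]
    by (simp add: centroid_comp_iff[of _ B'])
qed

text \<open>The preimage of an ideal of \<open>B'\<close> is an ideal of \<open>B\<close>, and it
  contains a nonzero homogeneous element when the ideal does; \<open>ideal_eq_carrier\<close> then
  applies in \<open>B\<close>.\<close>

lemma graded_simple_iso:
  fixes B :: "('g::ab_group_add, 'v::real_vector) galg" and B' :: "('g, 'w::real_vector) galg"
  assumes B: "graded_simple B" and B': "graded_algebra B'" and \<phi>: "graded_iso B B' \<phi>"
  shows "graded_simple B'"
proof -
  have gB: "graded_algebra B" using B by (simp add: graded_simple_def)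
  have \<psi>: "graded_iso B' B (iso_inv B B' \<phi>)" using graded_iso_inv[OF gB \<phi>] .
  interpret B: graded B using gB by unfold_locales
  interpret B': graded B' using B' by unfold_locales
  note lin = graded_iso_linear[OF \<phi>]
  show ?thesis
  proof (rule B'.graded_simpleI)
    obtain x y where xy: "x \<in> carrier B" "y \<in> carrier B" "mult B x y \<noteq> 0"
      using B by (auto simp: graded_simple_def nontrivial_product_def)
    have "\<phi> (mult B x y) \<noteq> \<phi> 0"
      using graded_iso_inj[OF \<phi> B.mult_carrier B.zero_carrier] xy by simp
    then have "mult B' (\<phi> x) (\<phi> y) \<noteq> 0"
      using graded_iso_mult[OF \<phi>] linear_on_zero[OF lin B.zero_carrier] xy by simp
    then show "nontrivial_product B'"
      using graded_iso_mem[OF \<phi>] xy unfolding nontrivial_product_def by blast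
    fix J k y g x
    assume J: "alg_ideal B' J" and y: "y \<in> J" "y \<in> comp B' k" "y \<noteq> 0" and x: "x \<in> comp B' g"
    let ?i = "iso_inv B B' \<phi>" and ?J = "{u \<in> carrier B. \<phi> u \<in> J}"
    have "alg_ideal B ?J"
      using J linear_on_zero[OF lin B.zero_carrier] B.add_carrier B.scaleR_carrier B.mult_carrier
        graded_iso_mem[OF \<phi>]
      by (auto simp: alg_ideal_def subspace_def linear_on_add[OF lin] linear_on_scaleR[OF lin]
          graded_iso_mult[OF \<phi>])
    moreover have "?i y \<in> ?J" "?i y \<in> comp B k"
      using y iso_inv_right[OF \<phi> B'.comp_carrier] graded_iso_comp[OF \<psi> y(2)] B.comp_carrier by auto
    moreover have "?i y \<noteq> 0"
      using y iso_inv_right[OF \<phi> B'.comp_carrier] linear_on_zero[OF lin B.zero_carrier] by metis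
    ultimately have "?J = carrier B" using B.ideal_eq_carrier[OF _ B] by blast
    then have "?i x \<in> ?J" using graded_iso_comp[OF \<psi> x] B.comp_carrier by blast
    then show "x \<in> J" using iso_inv_right[OF \<phi> B'.comp_carrier[OF x]] by simp
  qed
qed

section \<open>Loop algebras\<close>

lemma sum_fun_apply: "(\<Sum>i\<in>I. f i) x = (\<Sum>i\<in>I. f i x)"
  by (induction I rule: infinite_finite_induct) auto

section \<open>Signs, pure tensors and their coefficients\<close>

locale loop_setup =
  fixes \<pi> :: "'g::ab_group_add \<Rightarrow> 'h::ab_group_add"
    and \<chi> z :: "'g \<Rightarrow> complex"
    and \<xi> :: "'h \<Rightarrow> 'g"
  assumes hom_pi: "\<And>g k. \<pi> (g + k) = \<pi> g + \<pi> k"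
    and hom_chi: "\<And>g k. \<chi> (g + k) = \<chi> g * \<chi> k"
    and unit_z: "\<And>g. cmod (z g) = 1"
    and sqrt_z: "\<And>g. (z g)\<^sup>2 = \<chi> g"
    and section_xi: "\<And>p. \<pi> (\<xi> p) = p"
begin

lemma pi_0 [simp]: "\<pi> 0 = 0"
  using hom_pi[of 0 0] by simp

lemma pi_minus [simp]: "\<pi> (- g) = - \<pi> g"
  using hom_pi[of g "- g"] by (simp add: eq_neg_iff_add_eq_0 add.commute)

lemma pi_diff [simp]: "\<pi> (g - k) = \<pi> g - \<pi> k"
  using hom_pi[of g "- k"] by simp

lemmas pi_add [simp] = hom_pi
lemmas pi_xi [simp] = section_xi

lemma ker_iff: "g \<in> ker \<pi> \<longleftrightarrow> \<pi> g = 0"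
  by (simp add: ker_def)

lemma z_nonzero [simp]: "z g \<noteq> 0"
  using unit_z[of g] by auto

text \<open>The structure constants of the elements u_g of the complex group algebra: u_g u_k is
  \<open>eps g k\<close> times u_{g+k}. Taking the real part loses nothing, because the quotient is
  1 or -1.\<close>

definition eps :: "'g \<Rightarrow> 'g \<Rightarrow> real" where
  "eps g k = Re (z g * z k / z (g + k))"

text \<open>By multiplicativity of \<open>\<chi>\<close> the square of the quotient is 1.\<close>

lemma of_real_eps: "complex_of_real (eps g k) = z g * z k / z (g + k)"
proof -
  let ?w = "z g * z k / z (g + k)"
  have "\<chi> (g + k) \<noteq> 0" using sqrt_z[of "g + k"] z_nonzero[of "g + k"] by auto
  then have "?w\<^sup>2 = 1"
    by (simp add: power_divide power_mult_distrib sqrt_z hom_chi)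
  then have "?w = 1 \<or> ?w = - 1" by (simp add: power2_eq_1_iff)
  then show ?thesis unfolding eps_def by (metis Re_complex_of_real of_real_1 of_real_minus)
qed

lemma eps_nonzero [simp]: "eps g k \<noteq> 0"
  using of_real_eps[of g k] by (metis divide_eq_0_iff mult_eq_0_iff of_real_0 z_nonzero)

lemma eps_square [simp]: "eps g k * eps g k = 1"
proof -
  have "\<chi> (g + k) \<noteq> 0" using sqrt_z[of "g + k"] z_nonzero[of "g + k"] by auto
  then have "(z g * z k / z (g + k))\<^sup>2 = 1"
    by (simp add: power_divide power_mult_distrib sqrt_z hom_chi)
  then have "complex_of_real (eps g k * eps g k) = of_real 1"
    by (simp add: of_real_eps power2_eq_square)
  then show ?thesis using of_real_eq_iff by blast
qed

lemma eps_commute: "eps g k = eps k g"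
  by (simp add: eps_def mult.commute add.commute)

text \<open>Both sides equal \<open>z g * z k * z l / z (g + k + l)\<close>: this is associativity
  of the product of the u_g.\<close>

lemma eps_cocycle: "eps g k * eps (g + k) l = eps k l * eps g (k + l)"
proof -
  have "complex_of_real (eps g k * eps (g + k) l) = of_real (eps k l * eps g (k + l))"
    by (simp add: of_real_eps field_simps add.assoc)
  then show ?thesis using of_real_eq_iff by blast
qed

text \<open>The cocycle identity combined with symmetry; it expresses u_h (u_g u_k) = u_g (u_h
  u_k).\<close>

lemma eps_left_commute: "eps g k * eps h (g + k) = eps h k * eps g (h + k)"
  using eps_cocycle[of h g k] eps_cocycle[of g h k] by (simp add: eps_commute mult_ac add_ac)

definition pure :: "'v::real_vector \<Rightarrow> 'g \<Rightarrow> 'g \<Rightarrow> 'v \<times> 'v" where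
  "pure a g = tensor a (group_element (z g) g)"

text \<open>The real inner product with \<open>z g\<close>; it inverts tensoring with u_g because
  \<open>z g\<close> has modulus 1.\<close>

definition coef :: "('g \<Rightarrow> 'v \<times> 'v) \<Rightarrow> 'g \<Rightarrow> 'v::real_vector" where
  "coef f g = Re (z g) *\<^sub>R fst (f g) + Im (z g) *\<^sub>R snd (f g)"

lemma pure_apply: "pure a g k = (if k = g then (Re (z g) *\<^sub>R a, Im (z g) *\<^sub>R a) else 0)"
  by (simp add: pure_def tensor_def group_element_def zero_prod_def)

lemma pure_add: "pure (a + b) g = pure a g + pure b g"
  by (auto simp: fun_eq_iff pure_apply scaleR_add_right)

lemma pure_scaleR: "pure (r *\<^sub>R a) g = r *\<^sub>R pure a g"
  by (auto simp: fun_eq_iff pure_apply mult.commute)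

lemma pure_zero [simp]: "pure 0 g = 0"
  by (auto simp: fun_eq_iff pure_apply zero_prod_def)

lemma coef_pure [simp]: "coef (pure a g) g = a"
proof -
  have "(Re (z g))\<^sup>2 + (Im (z g))\<^sup>2 = 1" using unit_z[of g] by (simp add: cmod_def)
  then show ?thesis
    by (simp add: coef_def pure_apply power2_eq_square flip: scaleR_add_left)
qed

lemma coef_add: "coef (f + f') g = coef f g + coef f' g"
  by (simp add: coef_def scaleR_add_right)

lemma coef_scaleR: "coef (r *\<^sub>R f) g = r *\<^sub>R coef f g"
  by (simp add: coef_def scaleR_add_right mult.commute)

lemma pure_eq_iff [simp]: "pure a g = pure b g \<longleftrightarrow> a = b"
  using coef_pure by metis

lemma pure_eq_0_iff [simp]: "pure a g = 0 \<longleftrightarrow> a = 0"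
  using pure_eq_iff[of a g 0] by simp

lemma comp_loop: "comp (loop \<pi> z A) g = (\<lambda>a. pure a g) ` comp A (\<pi> g)"
  by (auto simp: loop_def Let_def pure_def)

lemma comp_loopE:
  assumes "f \<in> comp (loop \<pi> z A) g"
  obtains a where "a \<in> comp A (\<pi> g)" "f = pure a g"
  using assms by (auto simp: comp_loop)

lemma pure_comp: "a \<in> comp A (\<pi> g) \<Longrightarrow> pure a g \<in> comp (loop \<pi> z A) g"
  by (auto simp: comp_loop)

lemma carrier_loop: "carrier (loop \<pi> z A) = span (\<Union>g. comp (loop \<pi> z A) g)"
  by (simp add: loop_def Let_def)

lemma mult_loop: "mult (loop \<pi> z A) = tensor_mult (mult A)"
  by (simp add: loop_def Let_def)

end

section \<open>The loop algebra as a graded algebra\<close>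

locale loop_algebra = loop_setup \<pi> \<chi> z \<xi> + graded A
  for \<pi> :: "'g::ab_group_add \<Rightarrow> 'h::ab_group_add" and \<chi> z :: "'g \<Rightarrow> complex" and \<xi> :: "'h \<Rightarrow> 'g"
    and A :: "('h, 'v::real_vector) galg"
begin

abbreviation "LA \<equiv> loop \<pi> z A"

lemma mult_pure:
  assumes "a \<in> comp A (\<pi> g)" "b \<in> comp A (\<pi> k)"
  shows "mult LA (pure a g) (pure b k) = eps g k *\<^sub>R pure (mult A a b) (g + k)"
proof -
  have e: "z g * z k = complex_of_real (eps g k) * z (g + k)" by (simp add: of_real_eps)
  have "mult LA (pure a g) (pure b k) = tensor (mult A a b) (group_element (z g * z k) (g + k))"
    unfolding mult_loop pure_def using assms comp_carrier by (intro tensor_mult_tensor[OF algebra])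
  then show ?thesis
    unfolding e by (auto simp: fun_eq_iff pure_def tensor_def group_element_def zero_prod_def)
qed

text \<open>All of the tensor product of \<open>A\<close> with the complex group algebra. The loop
  algebra is a span inside it, and \<open>tensor_mult\<close>, which sums over the support of its
  first argument, is bilinear here because supports are finite.\<close>

definition finite_functions :: "('g \<Rightarrow> 'v \<times> 'v) set" where
  "finite_functions = {f. finite {g. f g \<noteq> 0} \<and> (\<forall>g. f g \<in> carrier A \<times> carrier A)}"

lemma subspace_finite_functions: "subspace finite_functions"
  unfolding subspace_def finite_functions_def
proof (intro conjI ballI allI)
  show "0 \<in> {f. finite {g. f g \<noteq> 0} \<and> (\<forall>g. f g \<in> carrier A \<times> carrier A)}"
    by (simp add: zero_prod_def)
  fix f assume f: "f \<in> {f :: 'g \<Rightarrow> 'v \<times> 'v. finite {g. f g \<noteq> 0} \<and> (\<forall>g. f g \<in> carrier A \<times> carrier A)}"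
  show "r *\<^sub>R f \<in> {f. finite {g. f g \<noteq> 0} \<and> (\<forall>g. f g \<in> carrier A \<times> carrier A)}" for r
    using f by (auto simp: mem_Times_iff scaleR_carrier elim: rev_finite_subset)
  fix f' assume f': "f' \<in> {f :: 'g \<Rightarrow> 'v \<times> 'v. finite {g. f g \<noteq> 0} \<and> (\<forall>g. f g \<in> carrier A \<times> carrier A)}"
  have "{g. (f + f') g \<noteq> 0} \<subseteq> {g. f g \<noteq> 0} \<union> {g. f' g \<noteq> 0}" by auto
  then have "finite {g. (f + f') g \<noteq> 0}" by (rule finite_subset) (use f f' in simp)
  then show "f + f' \<in> {f. finite {g. f g \<noteq> 0} \<and> (\<forall>g. f g \<in> carrier A \<times> carrier A)}"
    using f f' by (auto simp: mem_Times_iff add_carrier)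
qed

lemma carrier_loop_finite_functions: "carrier LA \<subseteq> finite_functions"
  unfolding carrier_loop
proof (rule span_minimal[OF _ subspace_finite_functions])
  show "(\<Union>g. comp LA g) \<subseteq> finite_functions"
  proof clarify
    fix f g assume "f \<in> comp LA g"
    then obtain a where a: "a \<in> comp A (\<pi> g)" "f = pure a g" by (rule comp_loopE)
    have "{k. pure a g k \<noteq> 0} \<subseteq> {g}" by (auto simp: pure_apply)
    then show "f \<in> finite_functions"
      unfolding finite_functions_def a(2) using a(1) comp_carrier scaleR_carrier
      by (auto simp: pure_apply zero_prod_def elim: finite_subset)
  qed
qed

text \<open>A summation range independent of the support, for use when the first argument is a sum
  or a multiple.\<close>

lemma tensor_mult_superset:
  assumes p: "p \<in> finite_functions" and q: "q \<in> finite_functions"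
    and S: "finite S" "{g. p g \<noteq> 0} \<subseteq> S"
  shows "tensor_mult (mult A) p q k = (\<Sum>g\<in>S. complexified_mult (mult A) (p g) (q (k - g)))"
  unfolding tensor_mult_def
  using S q by (intro sum.mono_neutral_left)
    (auto simp: complexified_mult_def zero_prod_def finite_functions_def mem_Times_iff)

lemma tensor_mult_add_left:
  assumes p: "p \<in> finite_functions" and p': "p' \<in> finite_functions" and q: "q \<in> finite_functions"
  shows "tensor_mult (mult A) (p + p') q = tensor_mult (mult A) p q + tensor_mult (mult A) p' q"
proof
  fix k
  let ?S = "{g. p g \<noteq> 0} \<union> {g. p' g \<noteq> 0}"
  have S: "finite ?S" using p p' by (simp add: finite_functions_def)
  have sub: "{g. (p + p') g \<noteq> 0} \<subseteq> ?S" "{g. p g \<noteq> 0} \<subseteq> ?S" "{g. p' g \<noteq> 0} \<subseteq> ?S" by auto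
  have c: "p g \<in> carrier A \<times> carrier A" "p' g \<in> carrier A \<times> carrier A" "q g \<in> carrier A \<times> carrier A" for g
    using p p' q by (auto simp: finite_functions_def)
  have "complexified_mult (mult A) ((p + p') g) (q (k - g)) =
      complexified_mult (mult A) (p g) (q (k - g)) + complexified_mult (mult A) (p' g) (q (k - g))" for g
    using c[of g] c[of "k - g"] by (simp add: complexified_mult_def mem_Times_iff mult_add_left)
  then show "tensor_mult (mult A) (p + p') q k = (tensor_mult (mult A) p q + tensor_mult (mult A) p' q) k"
    unfolding tensor_mult_superset[OF subspace_add[OF subspace_finite_functions p p'] q S sub(1)]
      plus_fun_apply tensor_mult_superset[OF p q S sub(2)] tensor_mult_superset[OF p' q S sub(3)]
    by (simp add: sum.distrib)
qed

lemma tensor_mult_scaleR_left: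
  assumes p: "p \<in> finite_functions" and q: "q \<in> finite_functions"
  shows "tensor_mult (mult A) (r *\<^sub>R p) q = r *\<^sub>R tensor_mult (mult A) p q"
proof
  fix k
  let ?S = "{g. p g \<noteq> 0}"
  have S: "finite ?S" using p by (simp add: finite_functions_def)
  have sub: "{g. (r *\<^sub>R p) g \<noteq> 0} \<subseteq> ?S" by auto
  have c: "p g \<in> carrier A \<times> carrier A" "q g \<in> carrier A \<times> carrier A" for g
    using p q by (auto simp: finite_functions_def)
  have "complexified_mult (mult A) ((r *\<^sub>R p) g) (q (k - g)) =
      r *\<^sub>R complexified_mult (mult A) (p g) (q (k - g))" for g
    using c[of g] c[of "k - g"]
    by (simp add: complexified_mult_def mem_Times_iff mult_scaleR_left scaleR_diff_right scaleR_add_right)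
  then show "tensor_mult (mult A) (r *\<^sub>R p) q k = (r *\<^sub>R tensor_mult (mult A) p q) k"
    unfolding tensor_mult_superset[OF subspace_scale[OF subspace_finite_functions p] q S sub]
      scaleR_fun_apply tensor_mult_superset[OF p q S order_refl]
    by (simp add: scaleR_sum_right)
qed

lemma tensor_mult_add_right:
  assumes p: "p \<in> finite_functions" and q: "q \<in> finite_functions" and q': "q' \<in> finite_functions"
  shows "tensor_mult (mult A) p (q + q') = tensor_mult (mult A) p q + tensor_mult (mult A) p q'"
proof
  fix k
  have c: "p g \<in> carrier A \<times> carrier A" "q g \<in> carrier A \<times> carrier A" "q' g \<in> carrier A \<times> carrier A" for g
    using p q q' by (auto simp: finite_functions_def)
  have "complexified_mult (mult A) (p g) ((q + q') (k - g)) =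
      complexified_mult (mult A) (p g) (q (k - g)) + complexified_mult (mult A) (p g) (q' (k - g))" for g
    using c[of g] c[of "k - g"] by (simp add: complexified_mult_def mem_Times_iff mult_add_right)
  then show "tensor_mult (mult A) p (q + q') k = (tensor_mult (mult A) p q + tensor_mult (mult A) p q') k"
    by (simp add: tensor_mult_def sum.distrib)
qed

lemma tensor_mult_scaleR_right:
  assumes p: "p \<in> finite_functions" and q: "q \<in> finite_functions"
  shows "tensor_mult (mult A) p (r *\<^sub>R q) = r *\<^sub>R tensor_mult (mult A) p q"
proof
  fix k
  have c: "p g \<in> carrier A \<times> carrier A" "q g \<in> carrier A \<times> carrier A" for g
    using p q by (auto simp: finite_functions_def)
  have "complexified_mult (mult A) (p g) ((r *\<^sub>R q) (k - g)) =
      r *\<^sub>R complexified_mult (mult A) (p g) (q (k - g))" for g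
    using c[of g] c[of "k - g"]
    by (simp add: complexified_mult_def mem_Times_iff mult_scaleR_right scaleR_diff_right scaleR_add_right)
  then show "tensor_mult (mult A) p (r *\<^sub>R q) k = (r *\<^sub>R tensor_mult (mult A) p q) k"
    by (simp add: tensor_mult_def scaleR_sum_right)
qed

lemma graded_algebra_loop: "graded_algebra LA"
proof (rule graded_algebraI)
  note FF = subsetD[OF carrier_loop_finite_functions]
  have sub: "subspace (comp LA g)" for g
    unfolding comp_loop subspace_def
  proof (intro conjI ballI allI)
    show "0 \<in> (\<lambda>a. pure a g) ` comp A (\<pi> g)" by (intro image_eqI[of _ _ 0]) auto
    show "x + y \<in> (\<lambda>a. pure a g) ` comp A (\<pi> g)"
      if "x \<in> (\<lambda>a. pure a g) ` comp A (\<pi> g)" "y \<in> (\<lambda>a. pure a g) ` comp A (\<pi> g)" for x y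
      using that by (auto simp: add_comp simp flip: pure_add)
    show "r *\<^sub>R x \<in> (\<lambda>a. pure a g) ` comp A (\<pi> g)" if "x \<in> (\<lambda>a. pure a g) ` comp A (\<pi> g)" for r x
      using that by (auto simp: scaleR_comp simp flip: pure_scaleR)
  qed
  then show "subspace (comp LA g)" for g .
  show sp: "carrier LA = span (\<Union>g. comp LA g)" by (rule carrier_loop)
  have sc: "subspace (carrier LA)" unfolding sp by (rule subspace_span)
  have inc: "f \<in> carrier LA" if "f \<in> comp LA g" for f g
    unfolding sp using that by (intro span_base) blast
  show mc: "mult LA x y \<in> comp LA (g + h)" if xy: "x \<in> comp LA g" "y \<in> comp LA h" for g h x y
  proof -
    obtain a b where "a \<in> comp A (\<pi> g)" "x = pure a g" "b \<in> comp A (\<pi> h)" "y = pure b h"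
      using xy by (elim comp_loopE) blast
    then show ?thesis
      using mult_comp[of a "\<pi> g" b "\<pi> h"] by (simp add: mult_pure pure_comp subspace_scale[OF sub])
  qed
  \<comment> \<open>Closure under products in two passes: the \<open>y\<close> whose product with a
    fixed homogeneous \<open>x\<close> stays in the loop algebra form a subspace containing all
    components, and then the same is done for \<open>x\<close>.\<close>
  have mult1: "mult LA x y \<in> carrier LA" if x: "x \<in> comp LA g" and y: "y \<in> carrier LA" for g x y
  proof -
    have "carrier LA \<subseteq> {y \<in> carrier LA. mult LA x y \<in> carrier LA}" (is "_ \<subseteq> ?K")
      unfolding sp
    proof (rule span_minimal)
      show "(\<Union>g. comp LA g) \<subseteq> {y \<in> span (\<Union>g. comp LA g). mult LA x y \<in> span (\<Union>g. comp LA g)}"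
        using mc[OF x] inc unfolding sp by blast
      have "subspace ?K"
        using subspace_0[OF sc] subspace_add[OF sc] subspace_scale[OF sc] FF[OF inc[OF x]] FF
          tensor_mult_scaleR_right[of x 0 0] subspace_0[OF subspace_finite_functions]
        by (auto simp: subspace_def mult_loop tensor_mult_add_right tensor_mult_scaleR_right)
      then show "subspace {y \<in> span (\<Union>g. comp LA g). mult LA x y \<in> span (\<Union>g. comp LA g)}"
        unfolding sp .
    qed
    then show ?thesis using y by blast
  qed
  have mult2: "mult LA x y \<in> carrier LA" if x: "x \<in> carrier LA" and y: "y \<in> carrier LA" for x y
  proof -
    have "carrier LA \<subseteq> {x \<in> carrier LA. mult LA x y \<in> carrier LA}" (is "_ \<subseteq> ?K")
      unfolding sp
    proof (rule span_minimal)
      show "(\<Union>g. comp LA g) \<subseteq> {x \<in> span (\<Union>g. comp LA g). mult LA x y \<in> span (\<Union>g. comp LA g)}"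
        using mult1[OF _ y] inc unfolding sp by blast
      have "subspace ?K"
        using subspace_0[OF sc] subspace_add[OF sc] subspace_scale[OF sc] FF[OF y] FF
          tensor_mult_scaleR_left[of 0 y 0] subspace_0[OF subspace_finite_functions]
        by (auto simp: subspace_def mult_loop tensor_mult_add_left tensor_mult_scaleR_left)
      then show "subspace {x \<in> span (\<Union>g. comp LA g). mult LA x y \<in> span (\<Union>g. comp LA g)}"
        unfolding sp .
    qed
    then show ?thesis using x by blast
  qed
  show "real_algebra LA"
    using sc mult2 FF
    by (auto simp: real_algebra_def linear_on_def mult_loop tensor_mult_add_left
        tensor_mult_add_right tensor_mult_scaleR_left tensor_mult_scaleR_right)
  show "\<forall>g. f g = 0" if f: "\<forall>g. f g \<in> comp LA g" "finite {g. f g \<noteq> 0}" "(\<Sum>g | f g \<noteq> 0. f g) = 0" for f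
  proof
    fix k
    \<comment> \<open>An element of degree \<open>g\<close> vanishes away from the point
      \<open>g\<close>, so evaluating the sum at \<open>k\<close> isolates the summand
      \<open>f k\<close>.\<close>
    have val: "f g k = 0" if "g \<noteq> k" for g
    proof -
      have "f g \<in> comp LA g" using f(1) by blast
      then show ?thesis using that by (elim comp_loopE) (simp add: pure_apply)
    qed
    have "0 = (\<Sum>g | f g \<noteq> 0. f g k)" using f(3) by (simp flip: sum_fun_apply)
    also have "\<dots> = (\<Sum>g\<in>insert k {g. f g \<noteq> 0}. f g k)"
      using f(2) by (intro sum.mono_neutral_left) auto
    also have "\<dots> = (\<Sum>g\<in>{k}. f g k)"
      using f(2) val by (intro sum.mono_neutral_right) auto
    finally have 0: "f k k = 0" by simp
    have "f k \<in> comp LA k" using f(1) by blast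
    then obtain a where a: "f k = pure a k" by (rule comp_loopE)
    have "coef (f k) k = 0" using 0 by (simp add: coef_def)
    then show "f k = 0" using a by simp
  qed
qed

sublocale L: graded LA
  using graded_algebra_loop by unfold_locales

section \<open>Centroid elements of the algebra acting on its loop algebra\<close>

lemma coef_comp: "f \<in> comp LA g \<Longrightarrow> coef f g \<in> comp A (\<pi> g) \<and> pure (coef f g) g = f"
  by (auto simp: comp_loop)

text \<open>The operator that sends a \<otimes> u_g to T a \<otimes> u_e u_g; the sign comes from
  rewriting u_e u_g in terms of u_{e+g}. It has degree \<open>e\<close> when \<open>T\<close> has
  degree \<open>\<pi> e\<close>.\<close>

definition lift :: "('v \<Rightarrow> 'v) \<Rightarrow> 'g \<Rightarrow> ('g \<Rightarrow> 'v \<times> 'v) \<Rightarrow> 'g \<Rightarrow> 'v \<times> 'v" where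
  "lift T e = graded_ext LA (\<lambda>g f. eps e g *\<^sub>R pure (T (coef f g)) (e + g))"

lemma
  assumes T: "T \<in> comp (centroid A) (\<pi> e)"
  shows lift_centroid: "lift T e \<in> comp (centroid LA) e"
    and lift_pure: "a \<in> comp A (\<pi> g) \<Longrightarrow> lift T e (pure a g) = eps e g *\<^sub>R pure (T a) (e + g)"
proof -
  let ?t = "\<lambda>g f. eps e g *\<^sub>R pure (T (coef f g)) (e + g)"
  note Tc = centroid_comp_carrier[OF T]
  note lin = centroid_linear[OF Tc]
  have Ta: "T a \<in> comp A (\<pi> (e + g))" if "a \<in> comp A (\<pi> g)" for a g
    using centroid_compD[OF T that] by simp
  have tl: "linear_on (comp LA g) (comp LA (e + g)) (?t g)" for g
    unfolding linear_on_def
  proof (intro conjI ballI allI)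
    show "?t g ` comp LA g \<subseteq> comp LA (e + g)"
      using Ta L.scaleR_comp by (auto simp: coef_comp pure_comp)
    show "?t g (x + y) = ?t g x + ?t g y" if "x \<in> comp LA g" "y \<in> comp LA g" for x y
      using comp_carrier[OF conjunct1[OF coef_comp[OF that(1)]]]
        comp_carrier[OF conjunct1[OF coef_comp[OF that(2)]]]
      by (simp add: coef_add linear_on_add[OF lin] pure_add scaleR_add_right)
    show "?t g (r *\<^sub>R x) = r *\<^sub>R ?t g x" if "x \<in> comp LA g" for r x
      using comp_carrier[OF conjunct1[OF coef_comp[OF that]]]
      by (simp add: coef_scaleR linear_on_scaleR[OF lin] pure_scaleR mult.commute)
  qed
  have tm: "?t (g + h) (mult LA x y) = mult LA x (?t h y) \<and> ?t (g + h) (mult LA x y) = mult LA (?t g x) y"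
    if xy: "x \<in> comp LA g" "y \<in> comp LA h" for g h x y
  proof -
    obtain a b where a: "a \<in> comp A (\<pi> g)" "x = pure a g" and b: "b \<in> comp A (\<pi> h)" "y = pure b h"
      using xy by (elim comp_loopE) blast
    have T1: "T (mult A a b) = mult A a (T b)" and T2: "T (mult A a b) = mult A (T a) b"
      using Tc comp_carrier[OF a(1)] comp_carrier[OF b(1)] unfolding centroid_carrier_iff by blast+
    have s: "linear_on (comp A g) (carrier A) T" for g
      by (rule linear_on_subset[OF lin]) (use comp_carrier linear_on_mem[OF lin] in auto)
    have ab: "mult A a b \<in> comp A (\<pi> (g + h))" using mult_comp[OF a(1) b(1)] by simp
    have lhs: "?t (g + h) (mult LA x y) = (eps g h * eps e (g + h)) *\<^sub>R pure (T (mult A a b)) (e + (g + h))"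
      using ab by (simp add: a b mult_pure coef_scaleR linear_on_scaleR[OF s] pure_scaleR mult.commute)
    have r1: "mult LA x (?t h y) = (eps e h * eps g (e + h)) *\<^sub>R pure (mult A a (T b)) (g + (e + h))"
      using mult_pure[OF a(1) Ta[OF b(1)]] L.comp_carrier[OF pure_comp[OF a(1)]]
        L.comp_carrier[OF pure_comp[OF Ta[OF b(1)]]] by (simp add: a b L.mult_scaleR_right)
    have r2: "mult LA (?t g x) y = (eps e g * eps (e + g) h) *\<^sub>R pure (mult A (T a) b) (e + g + h)"
      using mult_pure[OF Ta[OF a(1)] b(1)] L.comp_carrier[OF pure_comp[OF b(1)]]
        L.comp_carrier[OF pure_comp[OF Ta[OF a(1)]]] by (simp add: a b L.mult_scaleR_left)
    have i: "g + (e + h) = e + (g + h)" "e + g + h = e + (g + h)" by (simp_all add: algebra_simps)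
    \<comment> \<open>The identity \<open>s1\<close> moves u_e past u_g for the right factor and
      \<open>s2\<close> is associativity for the left one; the rest is that \<open>T\<close> lies in
      the centroid.\<close>
    have s1: "eps e h * eps g (e + h) = eps g h * eps e (g + h)" by (rule eps_left_commute)
    have s2: "eps e g * eps (e + g) h = eps g h * eps e (g + h)" by (rule eps_cocycle)
    show ?thesis
      unfolding lhs r1 r2 i s1 s2 T1[symmetric] T2[symmetric] by (rule conjI refl)+
  qed
  show "lift T e \<in> comp (centroid LA) e"
    unfolding lift_def by (rule L.centroid_family(1)[OF tl tm])
  show "lift T e (pure a g) = eps e g *\<^sub>R pure (T a) (e + g)" if "a \<in> comp A (\<pi> g)"
  proof -
    have "graded_ext LA ?t (pure a g) = ?t g (pure a g)"
      by (rule L.centroid_family(2)[OF tl tm pure_comp[OF that]])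
    then show ?thesis by (simp only: lift_def coef_pure)
  qed
qed

text \<open>The action of u_h. For \<open>h\<close> in the kernel the identity has the degree
  \<open>\<pi> h = 0\<close> that lifting along \<open>h\<close> requires.\<close>

definition unit :: "'g \<Rightarrow> ('g \<Rightarrow> 'v \<times> 'v) \<Rightarrow> 'g \<Rightarrow> 'v \<times> 'v" where
  "unit h = lift (scalar_op (carrier A) 1) h"

lemma unit_centroid: "h \<in> ker \<pi> \<Longrightarrow> unit h \<in> comp (centroid LA) h"
  unfolding unit_def using lift_centroid[of "scalar_op (carrier A) 1" h] scalar_op_centroid
  by (simp add: ker_iff)

lemma unit_pure:
  "h \<in> ker \<pi> \<Longrightarrow> a \<in> comp A (\<pi> g) \<Longrightarrow> unit h (pure a g) = eps h g *\<^sub>R pure a (h + g)"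
  unfolding unit_def using lift_pure[of "scalar_op (carrier A) 1" h a g] scalar_op_centroid
  by (simp add: ker_iff scalar_op_def comp_carrier)

lemma centroid_eqI:
  assumes "S \<in> carrier (centroid LA)" "T \<in> carrier (centroid LA)"
    and "\<And>g a. a \<in> comp A (\<pi> g) \<Longrightarrow> S (pure a g) = T (pure a g)"
  shows "S = T"
proof
  fix f
  show "S f = T f"
  proof (cases "f \<in> carrier LA")
    case True
    then show ?thesis
      using L.linear_on_eqI[OF centroid_linear[OF assms(1)] centroid_linear[OF assms(2)]]
      by (metis assms(3) comp_loopE)
  qed (simp add: centroid_outside[OF assms(1)] centroid_outside[OF assms(2)])
qed

end

section \<open>The centroid as a graded algebra\<close>

context graded
begin

lemma centroid_mult:
  "T \<in> carrier (centroid A) \<Longrightarrow> x \<in> carrier A \<Longrightarrow> y \<in> carrier A \<Longrightarrow>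
     T (mult A x y) = mult A x (T y)"
  "T \<in> carrier (centroid A) \<Longrightarrow> x \<in> carrier A \<Longrightarrow> y \<in> carrier A \<Longrightarrow>
     T (mult A x y) = mult A (T x) y"
  unfolding centroid_carrier_iff by blast+

lemma centroid_mem: "T \<in> carrier (centroid A) \<Longrightarrow> x \<in> carrier A \<Longrightarrow> T x \<in> carrier A"
  using linear_on_mem centroid_linear by blast

lemma centroid_zero: "T \<in> carrier (centroid A) \<Longrightarrow> T 0 = 0"
  using linear_on_zero[OF centroid_linear zero_carrier] .

lemma subspace_centroid: "subspace (carrier (centroid A))"
  unfolding subspace_def
proof (intro conjI ballI allI)
  show "0 \<in> carrier (centroid A)"
    by (simp add: centroid_carrier_iff vanishes_outside_def linear_on_def image_subset_iff)
  fix S assume S: "S \<in> carrier (centroid A)"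
  show "r *\<^sub>R S \<in> carrier (centroid A)" for r
    unfolding centroid_carrier_iff
    using centroid_outside[OF S] centroid_mem[OF S] linear_on_add[OF centroid_linear[OF S]]
      linear_on_scaleR[OF centroid_linear[OF S]]
    by (auto simp: vanishes_outside_def linear_on_def scaleR_carrier scaleR_add_right
        mult_scaleR_left mult_scaleR_right simp flip: centroid_mult[OF S])
  fix T assume T: "T \<in> carrier (centroid A)"
  show "S + T \<in> carrier (centroid A)"
    unfolding centroid_carrier_iff
    using centroid_outside[OF S] centroid_mem[OF S] linear_on_add[OF centroid_linear[OF S]]
      linear_on_scaleR[OF centroid_linear[OF S]] centroid_outside[OF T] centroid_mem[OF T]
      linear_on_add[OF centroid_linear[OF T]] linear_on_scaleR[OF centroid_linear[OF T]]
    by (auto simp: vanishes_outside_def linear_on_def add_carrier scaleR_add_right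
        mult_add_left mult_add_right simp flip: centroid_mult[OF S] centroid_mult[OF T])
qed

lemma subspace_centroid_comp: "subspace (comp (centroid A) g)"
  unfolding subspace_def
proof (intro conjI ballI allI)
  show "0 \<in> comp (centroid A) g"
    using subspace_0[OF subspace_centroid] by (simp add: centroid_comp_iff)
  fix S assume S: "S \<in> comp (centroid A) g"
  note Sc = centroid_comp_carrier[OF S]
  show "r *\<^sub>R S \<in> comp (centroid A) g" for r
    unfolding centroid_comp_iff
    using subspace_scale[OF subspace_centroid Sc] scaleR_comp[OF centroid_compD[OF S]] by simp
  fix T assume T: "T \<in> comp (centroid A) g"
  show "S + T \<in> comp (centroid A) g"
    unfolding centroid_comp_iff
    using subspace_add[OF subspace_centroid Sc centroid_comp_carrier[OF T]]
      add_comp[OF centroid_compD[OF S] centroid_compD[OF T]] by simp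
qed

lemma centroid_compose:
  assumes S: "S \<in> carrier (centroid A)" and T: "T \<in> carrier (centroid A)"
  shows "S \<circ> T \<in> carrier (centroid A)"
proof -
  have "(S \<circ> T) (mult A x y) = mult A x ((S \<circ> T) y)" "(S \<circ> T) (mult A x y) = mult A ((S \<circ> T) x) y"
    if "x \<in> carrier A" "y \<in> carrier A" for x y
    using centroid_mult[OF T that] centroid_mult(1)[OF S that(1) centroid_mem[OF T that(2)]]
      centroid_mult(2)[OF S centroid_mem[OF T that(1)] that(2)] by simp_all
  then show ?thesis
    unfolding centroid_carrier_iff
    using centroid_outside[OF T] centroid_zero[OF S]
      linear_on_compose[OF centroid_linear[OF T] centroid_linear[OF S]]
    by (auto simp: vanishes_outside_def)
qed

lemma centroid_compose_comp:
  assumes S: "S \<in> comp (centroid A) g" and T: "T \<in> comp (centroid A) h"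
  shows "S \<circ> T \<in> comp (centroid A) (g + h)"
  using centroid_compose[OF centroid_comp_carrier[OF S] centroid_comp_carrier[OF T]]
    centroid_compD[OF S] centroid_compD[OF T]
  by (auto simp: centroid_comp_iff[of "S \<circ> T"] add.assoc)

lemma real_algebra_centroid: "real_algebra (centroid A)"
  unfolding real_algebra_def
proof (intro conjI ballI)
  show "subspace (carrier (centroid A))" by (rule subspace_centroid)
  show "linear_on (carrier (centroid A)) (carrier (centroid A)) (\<lambda>T. mult (centroid A) S T)"
    if S: "S \<in> carrier (centroid A)" for S
    unfolding linear_on_def
  proof (intro conjI ballI allI)
    show "(\<lambda>T. mult (centroid A) S T) ` carrier (centroid A) \<subseteq> carrier (centroid A)"
      using centroid_compose[OF S] by auto
    fix T assume T: "T \<in> carrier (centroid A)"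
    show "mult (centroid A) S (r *\<^sub>R T) = r *\<^sub>R mult (centroid A) S T" for r
    proof
      show "mult (centroid A) S (r *\<^sub>R T) x = (r *\<^sub>R mult (centroid A) S T) x" for x
        using linear_on_scaleR[OF centroid_linear[OF S] centroid_mem[OF T]] centroid_outside[OF T]
          centroid_zero[OF S] by (cases "x \<in> carrier A") simp_all
    qed
    fix T' assume T': "T' \<in> carrier (centroid A)"
    show "mult (centroid A) S (T + T') = mult (centroid A) S T + mult (centroid A) S T'"
    proof
      show "mult (centroid A) S (T + T') x = (mult (centroid A) S T + mult (centroid A) S T') x" for x
        using linear_on_add[OF centroid_linear[OF S] centroid_mem[OF T] centroid_mem[OF T']]
          centroid_outside[OF T] centroid_outside[OF T'] centroid_zero[OF S]
        by (cases "x \<in> carrier A") simp_all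
    qed
  qed
  show "linear_on (carrier (centroid A)) (carrier (centroid A)) (\<lambda>T. mult (centroid A) T S)"
    if "S \<in> carrier (centroid A)" for S
    using that centroid_compose by (auto simp: linear_on_def fun_eq_iff)
qed

text \<open>Evaluated at an element of degree \<open>h\<close>, the operators \<open>T g\<close>
  take values in the distinct degrees \<open>g + h\<close>, so independence is inherited from the
  components of \<open>A\<close>.\<close>

lemma centroid_comp_independent:
  assumes f: "\<forall>g. T g \<in> comp (centroid A) g" "finite {g. T g \<noteq> 0}" "(\<Sum>g | T g \<noteq> 0. T g) = 0"
  shows "\<forall>g. T g = 0"
proof
  fix g
  have "T g x = 0" if x: "x \<in> comp A h" for x h
  proof -
    let ?f = "\<lambda>k. T (k - h) x"
    have "?f k \<in> comp A k" for k
      using centroid_compD[of "T (k - h)" A "k - h" x h] f(1) x by simp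
    moreover have "finite ((\<lambda>g. g + h) ` {g. T g \<noteq> 0})" using f(2) by simp
    moreover have "?f k = 0" if "k \<notin> (\<lambda>g. g + h) ` {g. T g \<noteq> 0}" for k
    proof (rule ccontr)
      assume "?f k \<noteq> 0"
      then have "T (k - h) \<noteq> 0" by auto
      then have "k \<in> (\<lambda>g. g + h) ` {g. T g \<noteq> 0}" by (intro image_eqI[of _ _ "k - h"]) auto
      then show False using that by simp
    qed
    moreover have "0 = (\<Sum>k\<in>(\<lambda>g. g + h) ` {g. T g \<noteq> 0}. ?f k)"
    proof -
      have "(\<Sum>k\<in>(\<lambda>g. g + h) ` {g. T g \<noteq> 0}. ?f k) = (\<Sum>g | T g \<noteq> 0. T g x)"
        by (subst sum.reindex) (auto simp: inj_on_def)
      also have "\<dots> = (\<Sum>g | T g \<noteq> 0. T g) x" by (rule sum_fun_apply[symmetric])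
      also have "\<dots> = 0" by (simp only: f(3) zero_fun_apply)
      finally show ?thesis by simp
    qed
    ultimately have "hcomp A 0 = ?f"
      using hcomp_eqI[of "(\<lambda>g. g + h) ` {g. T g \<noteq> 0}" ?f 0] by blast
    then have "?f (g + h) = 0" by (metis hcomp_zero)
    then show ?thesis by simp
  qed
  moreover have c: "T g \<in> carrier (centroid A)" using f(1) centroid_comp_carrier by blast
  ultimately have "T g x = 0" for x
  proof (cases "x \<in> carrier A")
    case True
    then show ?thesis
      by (induction rule: carrier_induct)
        (simp_all add: linear_on_add[OF centroid_linear[OF c]] \<open>\<And>x h. x \<in> comp A h \<Longrightarrow> T g x = 0\<close>)
  qed (use centroid_outside[OF c] in simp)
  then show "T g = 0" by (simp add: fun_eq_iff)
qed

text \<open>Spanning is an assumption, since in general a centroid element may have infinitely many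
  nonzero parts; \<open>frame_span\<close> verifies it in the presence of a frame.\<close>

lemma graded_algebra_centroid:
  assumes "carrier (centroid A) = span (\<Union>g. comp (centroid A) g)"
  shows "graded_algebra (centroid A)"
  by (rule graded_algebraI[OF real_algebra_centroid subspace_centroid_comp assms centroid_comp_independent])
    (use centroid_compose_comp in auto)

end

section \<open>Frames of the centroid\<close>

context loop_setup
begin

text \<open>The images of the elements \<open>u\<^sub>h\<close> under the graded isomorphisms from the loop algebra of the
  reals to the centroid.\<close>

definition centroid_frame :: "('g, 'v::real_vector) galg \<Rightarrow> ('g \<Rightarrow> 'v \<Rightarrow> 'v) \<Rightarrow> bool" where
  "centroid_frame B c \<longleftrightarrow>
     (\<forall>h\<in>ker \<pi>. c h \<in> comp (centroid B) h) \<and>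
     (\<forall>h\<in>ker \<pi>. \<forall>k\<in>ker \<pi>. c h \<circ> c k = eps h k *\<^sub>R c (h + k)) \<and>
     (\<forall>g T. T \<in> comp (centroid B) g \<longrightarrow> T \<noteq> 0 \<longrightarrow> g \<in> ker \<pi> \<and> (\<exists>r. T = r *\<^sub>R c g))"

lemma frame_comp: "centroid_frame B c \<Longrightarrow> h \<in> ker \<pi> \<Longrightarrow> c h \<in> comp (centroid B) h"
  by (simp add: centroid_frame_def)

lemma frame_mult:
  "centroid_frame B c \<Longrightarrow> h \<in> ker \<pi> \<Longrightarrow> k \<in> ker \<pi> \<Longrightarrow> c h (c k x) = eps h k *\<^sub>R c (h + k) x"
  unfolding centroid_frame_def by (metis comp_apply scaleR_fun_apply)

lemma frame_multiple:
  assumes "centroid_frame B c" "T \<in> comp (centroid B) g" "T \<noteq> 0"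
  obtains r where "g \<in> ker \<pi>" "r \<noteq> 0" "T = r *\<^sub>R c g"
  using assms unfolding centroid_frame_def by (metis scaleR_zero_left)

lemma ker_closed [simp]:
  "0 \<in> ker \<pi>" "h \<in> ker \<pi> \<Longrightarrow> k \<in> ker \<pi> \<Longrightarrow> h + k \<in> ker \<pi>" "h \<in> ker \<pi> \<Longrightarrow> - h \<in> ker \<pi>"
  "g - \<xi> (\<pi> g) \<in> ker \<pi>" "cocycle \<xi> p q \<in> ker \<pi>"
  by (simp_all add: ker_iff cocycle_def)

text \<open>\<open>c h \<circ> c (- h)\<close> is a nonzero multiple of \<open>c 0\<close>. The
  identity is a homogeneous operator of degree 0, so if it is nonzero, it is a nonzero multiple of
  \<open>c 0\<close> by the last clause of the definition of a frame.\<close>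

lemma frame_inverse:
  fixes B :: "('g, 'v::real_vector) galg"
  assumes B: "graded_algebra B" and c: "centroid_frame B c" and h: "h \<in> ker \<pi>"
  shows "\<exists>d\<in>comp (centroid B) (- h). \<forall>x\<in>carrier B. d (c h x) = x \<and> c h (d x) = x"
proof -
  interpret B: graded B using B by unfold_locales
  show ?thesis
  \<comment> \<open>On the zero algebra the identity is the zero operator, so the frame says nothing
    about it; there the zero operator serves as inverse.\<close>
  proof (cases "carrier B = {0}")
    case True
    have "0 \<in> comp (centroid B) (- h)" using subspace_0[OF B.subspace_centroid_comp] .
    then show ?thesis
      using True B.centroid_zero[OF centroid_comp_carrier[OF frame_comp[OF c h]]]
      by (intro bexI[of _ 0]) auto
  next
    case False
    then obtain y where y: "y \<in> carrier B" "y \<noteq> 0" using B.zero_carrier by blast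
    have "scalar_op (carrier B) 1 y \<noteq> 0" using y by (simp add: scalar_op_def)
    then have "scalar_op (carrier B) 1 \<noteq> 0" by auto
    from frame_multiple[OF c B.scalar_op_centroid this]
    obtain r where r: "r \<noteq> 0" "scalar_op (carrier B) 1 = r *\<^sub>R c 0" by metis
    have c0: "c 0 x = inverse r *\<^sub>R x" if "x \<in> carrier B" for x
    proof -
      have "r *\<^sub>R c 0 x = x" using fun_cong[OF r(2), of x] that by (simp add: scalar_op_def)
      then show ?thesis using r(1) by (metis scaleR_one scaleR_scaleR left_inverse)
    qed
    \<comment> \<open>\<open>c h \<circ> c (- h)\<close> is \<open>eps h (- h) / r\<close> times the
      identity, and \<open>eps h (- h)\<close> is its own inverse.\<close>
    let ?s = "r * eps h (- h)"
    have ch: "c h \<in> carrier (centroid B)" using centroid_comp_carrier[OF frame_comp[OF c h]] .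
    have cm: "c (- h) \<in> comp (centroid B) (- h)" using frame_comp[OF c] h by simp
    have cm': "c (- h) x \<in> carrier B" if "x \<in> carrier B" for x
      using B.centroid_mem[OF centroid_comp_carrier[OF cm] that] .
    have "c h (c (- h) x) = (eps h (- h) * inverse r) *\<^sub>R x"
      "c (- h) (c h x) = (eps h (- h) * inverse r) *\<^sub>R x" if "x \<in> carrier B" for x
      using frame_mult[OF c, of h "- h" x] frame_mult[OF c, of "- h" h x] c0[OF that] h
        eps_commute[of h "- h"] by simp_all
    moreover have "?s * (eps h (- h) * inverse r) = 1" using r(1) by (simp add: field_simps)
    ultimately have "(?s *\<^sub>R c (- h)) (c h x) = x" "c h ((?s *\<^sub>R c (- h)) x) = x" if "x \<in> carrier B" for x
      using that linear_on_scaleR[OF centroid_linear[OF ch] cm'[OF that], of ?s] by simp_all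
    moreover have "?s *\<^sub>R c (- h) \<in> comp (centroid B) (- h)"
      using subspace_scale[OF B.subspace_centroid_comp cm] .
    ultimately show ?thesis by blast
  qed
qed

lemma frame_nonzero:
  fixes B :: "('g, 'v::real_vector) galg"
  assumes B: "graded_algebra B" and c: "centroid_frame B c" and h: "h \<in> ker \<pi>"
    and x: "x \<in> carrier B" "x \<noteq> 0"
  shows "c h x \<noteq> 0"
proof
  interpret B: graded B using B by unfold_locales
  assume 0: "c h x = 0"
  obtain d where d: "d \<in> comp (centroid B) (- h)" "d (c h x) = x"
    using frame_inverse[OF B c h] x by blast
  then show False using B.centroid_zero[OF centroid_comp_carrier[OF d(1)]] x 0 by simp
qed

text \<open>Each nonzero part \<open>S d\<close> is a nonzero multiple of the injective
  \<open>c d\<close>, so it does not vanish at a fixed nonzero homogeneous \<open>y\<close>. As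
  \<open>T y\<close> has finitely many components, \<open>T\<close> has finitely many nonzero
  parts.\<close>

lemma frame_span:
  fixes B :: "('g, 'v::real_vector) galg"
  assumes B: "graded_algebra B" and c: "centroid_frame B c" and nz: "carrier B \<noteq> {0}"
  shows "carrier (centroid B) = span (\<Union>g. comp (centroid B) g)"
proof
  interpret B: graded B using B by unfold_locales
  show "span (\<Union>g. comp (centroid B) g) \<subseteq> carrier (centroid B)"
    by (rule span_minimal[OF _ B.subspace_centroid]) (auto intro: centroid_comp_carrier)
  show "carrier (centroid B) \<subseteq> span (\<Union>g. comp (centroid B) g)"
  proof
    fix T assume T: "T \<in> carrier (centroid B)"
    define S where "S d = graded_ext B (\<lambda>g x. hcomp B (T x) (d + g))" for d
    have S: "S d \<in> comp (centroid B) d" for d using B.centroid_component(1)[OF T] by (simp add: S_def)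
    have Sx: "S d x = hcomp B (T x) (d + g)" if "x \<in> comp B g" for d g x
      using B.centroid_component(2)[OF T that] by (simp add: S_def)
    obtain k y where y: "y \<in> comp B k" "y \<noteq> 0" using B.nonzero_homogeneous[OF nz] .
    have "S d y \<noteq> 0" if Sd: "S d \<noteq> 0" for d
    proof -
      obtain r where "d \<in> ker \<pi>" "r \<noteq> 0" "S d = r *\<^sub>R c d" using frame_multiple[OF c S Sd] .
      then show ?thesis using frame_nonzero[OF B c _ B.comp_carrier[OF y(1)] y(2)] by simp
    qed
    then have "(\<lambda>d. d + k) ` {d. S d \<noteq> 0} \<subseteq> {g. hcomp B (T y) g \<noteq> 0}" using Sx[OF y(1)] by auto
    then have "finite ((\<lambda>d. d + k) ` {d. S d \<noteq> 0})"
      using B.finite_hcomp[OF B.centroid_mem[OF T B.comp_carrier[OF y(1)]]] finite_subset by blast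
    then have fin: "finite {d. S d \<noteq> 0}" by (rule finite_imageD) (auto simp: inj_on_def)
    let ?S = "\<Sum>d | S d \<noteq> 0. S d"
    have Sc: "?S \<in> carrier (centroid B)"
      using S centroid_comp_carrier by (intro subspace_sum[OF B.subspace_centroid]) blast
    have "T x = ?S x" if "x \<in> carrier B" for x
    proof (rule B.linear_on_eqI[OF centroid_linear[OF T] centroid_linear[OF Sc] _ that])
      fix g x assume x: "x \<in> comp B g"
      have Tx: "T x \<in> carrier B" using B.centroid_mem[OF T B.comp_carrier[OF x]] .
      let ?I = "(\<lambda>d. d + g) ` {d. S d \<noteq> 0}"
      have "{k. hcomp B (T x) k \<noteq> 0} \<subseteq> ?I"
      proof
        fix k assume "k \<in> {k. hcomp B (T x) k \<noteq> 0}"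
        then have "S (k - g) x \<noteq> 0" using Sx[OF x, of "k - g"] by simp
        then have "S (k - g) \<noteq> 0" by auto
        then show "k \<in> ?I" by (intro image_eqI[of _ _ "k - g"]) auto
      qed
      then have "T x = (\<Sum>k\<in>?I. hcomp B (T x) k)" using B.sum_hcomp_superset[OF Tx] fin by simp
      also have "\<dots> = (\<Sum>d | S d \<noteq> 0. hcomp B (T x) (d + g))"
        by (subst sum.reindex) (auto simp: inj_on_def)
      also have "\<dots> = (\<Sum>d | S d \<noteq> 0. S d x)" by (simp only: Sx[OF x])
      finally show "T x = ?S x" by (simp only: sum_fun_apply)
    qed
    moreover have "T x = ?S x" if "x \<notin> carrier B" for x
      using centroid_outside[OF T that] centroid_outside[OF Sc that] by (simp only:)
    ultimately have "T = ?S" by blast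
    also have "?S \<in> span (\<Union>g. comp (centroid B) g)" using S by (intro span_sum span_base) blast
    finally show "T \<in> span (\<Union>g. comp (centroid B) g)" .
  qed
qed

lemma frame_iso:
  fixes B :: "('g, 'v::real_vector) galg" and B' :: "('g, 'w::real_vector) galg"
  assumes B: "graded_algebra B" and B': "graded_algebra B'"
    and c: "centroid_frame B c" and \<phi>: "graded_iso B B' \<phi>"
  shows "centroid_frame B' (\<lambda>h. \<phi> \<circ> c h \<circ> iso_inv B B' \<phi>)"
proof -
  let ?i = "iso_inv B B' \<phi>"
  interpret B: graded B using B by unfold_locales
  interpret B': graded B' using B' by unfold_locales
  have i: "graded_iso B' B ?i" using graded_iso_inv[OF B \<phi>] .
  note lin = graded_iso_linear[OF \<phi>]
  have \<phi>0: "\<phi> 0 = 0" using linear_on_zero[OF lin B.zero_carrier] .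
  have cc: "c h \<in> carrier (centroid B)" if "h \<in> ker \<pi>" for h
    using frame_comp[OF c that] centroid_comp_carrier by blast
  have mem: "c h (?i x) \<in> carrier B" if "h \<in> ker \<pi>" "x \<in> carrier B'" for h x
    using B.centroid_mem[OF cc[OF that(1)] graded_iso_mem[OF i that(2)]] .
  show ?thesis
    unfolding centroid_frame_def
  proof (intro conjI ballI allI impI)
    show "\<phi> \<circ> c h \<circ> ?i \<in> comp (centroid B') h" if "h \<in> ker \<pi>" for h
      using centroid_conjugate[OF B \<phi> frame_comp[OF c that]] .
    show "\<phi> \<circ> c h \<circ> ?i \<circ> (\<phi> \<circ> c k \<circ> ?i) = eps h k *\<^sub>R (\<phi> \<circ> c (h + k) \<circ> ?i)"
      if hk: "h \<in> ker \<pi>" "k \<in> ker \<pi>" for h k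
    proof
      fix x
      show "(\<phi> \<circ> c h \<circ> ?i \<circ> (\<phi> \<circ> c k \<circ> ?i)) x = (eps h k *\<^sub>R (\<phi> \<circ> c (h + k) \<circ> ?i)) x"
      proof (cases "x \<in> carrier B'")
        case True
        have "c (h + k) (?i x) \<in> carrier B" using mem[OF ker_closed(2)[OF hk] True] .
        then show ?thesis
          using iso_inv_left[OF \<phi> mem[OF hk(2) True]] frame_mult[OF c hk, of "?i x"]
          by (simp add: linear_on_scaleR[OF lin])
      next
        case False
        have "c l 0 = 0" if "l \<in> ker \<pi>" for l using B.centroid_zero[OF cc[OF that]] .
        moreover have "?i 0 = 0" using iso_inv_left[OF \<phi> B.zero_carrier] \<phi>0 by simp
        ultimately show ?thesis using False hk \<phi>0 by (simp add: iso_inv_def)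
      qed
    qed
    fix g T assume T: "T \<in> comp (centroid B') g" "T \<noteq> 0"
    \<comment> \<open>Conjugating back to \<open>B\<close> makes the frame of \<open>B\<close>
      available; \<open>rec\<close> recovers \<open>T\<close> from the result.\<close>
    let ?T = "?i \<circ> T \<circ> iso_inv B' B ?i"
    note Tc = centroid_comp_carrier[OF T(1)]
    have ii: "iso_inv B' B ?i x = \<phi> x" if "x \<in> carrier B" for x
      using iso_inv_left[OF i graded_iso_mem[OF \<phi> that]] iso_inv_left[OF \<phi> that] by simp
    have rec: "T x = \<phi> (?T (?i x))" if "x \<in> carrier B'" for x
      using ii[OF graded_iso_mem[OF i that]] iso_inv_right[OF \<phi> that]
        iso_inv_right[OF \<phi> B'.centroid_mem[OF Tc that]] by simp
    have "?T \<noteq> 0"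
    proof
      assume "?T = 0"
      then have "?T y = 0" for y by (simp only: zero_fun_apply)
      then have "T x = 0" for x using rec[of x] \<phi>0 centroid_outside[OF Tc, of x] by metis
      then show False using T(2) by (simp add: fun_eq_iff)
    qed
    from frame_multiple[OF c centroid_conjugate[OF B' i T(1)] this]
    obtain r where r: "g \<in> ker \<pi>" "?T = r *\<^sub>R c g" by metis
    show "g \<in> ker \<pi>" using r(1) .
    have "T x = (r *\<^sub>R (\<phi> \<circ> c g \<circ> ?i)) x" for x
    proof (cases "x \<in> carrier B'")
      case True
      have "T x = \<phi> ((r *\<^sub>R c g) (?i x))" using rec[OF True] by (simp only: r(2))
      then show ?thesis using linear_on_scaleR[OF lin mem[OF r(1) True]] by simp
    next
      case False
      then show ?thesis using centroid_outside[OF Tc] B.centroid_zero[OF cc[OF r(1)]] \<phi>0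
        by (simp add: iso_inv_def)
    qed
    then show "\<exists>r. T = r *\<^sub>R (\<phi> \<circ> c g \<circ> ?i)" by blast
  qed
qed

end

section \<open>Frames and isomorphisms with the loop algebra of the reals\<close>

lemma graded_algebra_reals: "graded_algebra (trivially_graded_reals :: ('h::ab_group_add, real) galg)"
proof (rule graded_algebraI)
  let ?R = "trivially_graded_reals :: ('h, real) galg"
  have c: "comp ?R g = (if g = 0 then UNIV else {0})" for g by (simp add: trivially_graded_reals_def)
  show "real_algebra ?R"
    by (auto simp: trivially_graded_reals_def real_algebra_def linear_on_def algebra_simps)
  show "subspace (comp ?R g)" for g by (simp add: c)
  show "carrier ?R = span (\<Union>g. comp ?R g)"
  proof -
    have "x \<in> span (\<Union>g. comp ?R g)" for x by (rule span_base) (auto simp: c intro!: exI[of _ 0])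
    then show ?thesis by (auto simp: trivially_graded_reals_def)
  qed
  show "mult ?R x y \<in> comp ?R (g + h)" if "x \<in> comp ?R g" "y \<in> comp ?R h" for x y g h
    using that by (auto simp: c trivially_graded_reals_def split: if_splits)
  fix f :: "'h \<Rightarrow> real"
  assume f: "\<forall>g. f g \<in> comp ?R g" "finite {g. f g \<noteq> 0}" "(\<Sum>g | f g \<noteq> 0. f g) = 0"
  have n: "f g = 0" if "g \<noteq> 0" for g using f(1) that by (auto simp: c dest!: spec[of _ g])
  have "(\<Sum>g | f g \<noteq> 0. f g) = (\<Sum>g\<in>{0}. f g)" using n by (intro sum.mono_neutral_left) auto
  then show "\<forall>g. f g = 0" using n f(3) by (metis (no_types) sum.insert_remove finite.emptyI sum.empty empty_Diff add_0_right)
qed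

context loop_setup
begin

text \<open>The object condition of \<open>N_groupoid\<close> is exploited in this form: the frame
  consists of the preimages of the u_h, which appear as \<open>pure 1 h\<close>.\<close>

lemma frame_from_iso:
  fixes B :: "('g, 'v::real_vector) galg"
  assumes B: "graded_algebra B"
    and \<phi>: "graded_iso (centroid B) (loop \<pi> z trivially_graded_reals) \<phi>"
  shows "\<exists>c. centroid_frame B c"
proof -
  interpret B: graded B using B by unfold_locales
  interpret R: loop_algebra \<pi> \<chi> z \<xi> trivially_graded_reals
    by unfold_locales (rule graded_algebra_reals)
  let ?C = "centroid B" and ?L = "loop \<pi> z trivially_graded_reals"
  have R: "r \<in> comp trivially_graded_reals (\<pi> h)" if "h \<in> ker \<pi>" for h r
    using that by (simp add: trivially_graded_reals_def ker_iff)
  define c where "c h = iso_inv ?C ?L \<phi> (pure 1 h)" for h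
  have c: "c h \<in> comp ?C h" "\<phi> (c h) = pure 1 h" if h: "h \<in> ker \<pi>" for h
  proof -
    have p: "pure 1 h \<in> comp ?L h" using pure_comp[OF R[OF h]] .
    then show "\<phi> (c h) = pure 1 h" using iso_inv_right[OF \<phi> R.L.comp_carrier] by (simp add: c_def)
    have "pure 1 h \<in> \<phi> ` comp ?C h" using p \<phi> by (simp add: graded_iso_def)
    then show "c h \<in> comp ?C h"
      using iso_inv_left[OF \<phi> centroid_comp_carrier] by (auto simp: c_def)
  qed
  have cc: "c h \<in> carrier ?C" if "h \<in> ker \<pi>" for h using c(1)[OF that] centroid_comp_carrier by blast
  note lin = graded_iso_linear[OF \<phi>]
  have "centroid_frame B c"
    unfolding centroid_frame_def
  proof (intro conjI ballI allI impI)
    show "c h \<in> comp ?C h" if "h \<in> ker \<pi>" for h using c(1)[OF that] .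
    show "c h \<circ> c k = eps h k *\<^sub>R c (h + k)" if hk: "h \<in> ker \<pi>" "k \<in> ker \<pi>" for h k
    proof -
      have "\<phi> (c h \<circ> c k) = mult ?L (pure 1 h) (pure 1 k)"
        using graded_iso_mult[OF \<phi> cc[OF hk(1)] cc[OF hk(2)]] c(2) hk by simp
      also have "\<dots> = eps h k *\<^sub>R pure 1 (h + k)"
        using R.mult_pure[OF R[OF hk(1)] R[OF hk(2)]] by (simp add: trivially_graded_reals_def)
      also have "\<dots> = \<phi> (eps h k *\<^sub>R c (h + k))"
        using c(2)[OF ker_closed(2)[OF hk]] linear_on_scaleR[OF lin cc[OF ker_closed(2)[OF hk]]] by simp
      finally show ?thesis
        using graded_iso_inj[OF \<phi> B.centroid_compose[OF cc[OF hk(1)] cc[OF hk(2)]]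
            subspace_scale[OF B.subspace_centroid cc[OF ker_closed(2)[OF hk]]]] by simp
    qed
    fix g T assume T: "T \<in> comp ?C g" "T \<noteq> 0"
    note Tc = centroid_comp_carrier[OF T(1)]
    obtain r where r: "r \<in> comp trivially_graded_reals (\<pi> g)" "\<phi> T = pure r g"
      using graded_iso_comp[OF \<phi> T(1)] by (rule comp_loopE)
    have zero: "0 \<in> carrier ?C" using subspace_0[OF B.subspace_centroid] .
    have "\<phi> T \<noteq> \<phi> 0" using graded_iso_inj[OF \<phi> Tc zero] T(2) by simp
    then have "r \<noteq> 0" using linear_on_zero[OF lin zero] r(2) by simp
    \<comment> \<open>The reals are trivially graded, so a nonzero coefficient occurs only in
      degrees of the kernel.\<close>
    then show g: "g \<in> ker \<pi>" using r(1) by (auto simp: trivially_graded_reals_def ker_iff split: if_splits)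
    have "\<phi> T = \<phi> (r *\<^sub>R c g)"
      using r(2) c(2)[OF g] linear_on_scaleR[OF lin cc[OF g]] by (simp flip: pure_scaleR)
    then have "T = r *\<^sub>R c g"
      using graded_iso_inj[OF \<phi> Tc subspace_scale[OF B.subspace_centroid cc[OF g]]] by simp
    then show "\<exists>r. T = r *\<^sub>R c g" by blast
  qed
  then show ?thesis by blast
qed

text \<open>The map is constructed in the opposite direction, from r u_h to r times
  \<open>c h\<close>, where the source is explicit, and inverted at the end. It is injective because
  the \<open>c h\<close> are nonzero on a nonzero algebra.\<close>

lemma iso_from_frame:
  fixes B :: "('g, 'v::real_vector) galg"
  assumes B: "graded_algebra B" and nz: "carrier B \<noteq> {0}" and c: "centroid_frame B c"
  shows "\<exists>\<phi>. graded_iso (centroid B) (loop \<pi> z trivially_graded_reals) \<phi>"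
proof -
  interpret B: graded B using B by unfold_locales
  interpret R: loop_algebra \<pi> \<chi> z \<xi> trivially_graded_reals
    by unfold_locales (rule graded_algebra_reals)
  let ?C = "centroid B" and ?L = "loop \<pi> z trivially_graded_reals"
  have gC: "graded_algebra ?C" by (rule B.graded_algebra_centroid[OF frame_span[OF B c nz]])
  interpret C: graded ?C using gC by unfold_locales
  have cc: "c h \<in> carrier ?C" if "h \<in> ker \<pi>" for h
    using frame_comp[OF c that] centroid_comp_carrier by blast
  have R: "comp ?L g = (if g \<in> ker \<pi> then range (\<lambda>r. pure r g) else {0})" for g
    by (auto simp: comp_loop trivially_graded_reals_def ker_iff)
  define t where "t g f = (if g \<in> ker \<pi> then coef f g *\<^sub>R c g else 0)" for g f
  have tl: "linear_on (comp ?L g) (carrier ?C) (t g)" for g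
    using C.scaleR_carrier[OF cc] by (auto simp: linear_on_def t_def coef_add coef_scaleR scaleR_add_left)
  define \<psi> where "\<psi> = graded_ext ?L t"
  have \<psi>: "\<psi> (pure r g) = r *\<^sub>R c g" if "g \<in> ker \<pi>" for r g
    using R.L.graded_ext_hom[OF tl, of "pure r g" g] that by (simp add: \<psi>_def R t_def)
  have cnz: "c h \<noteq> 0" if h: "h \<in> ker \<pi>" for h
  proof -
    obtain x where "x \<in> carrier B" "x \<noteq> 0" using nz B.zero_carrier by blast
    then show ?thesis using frame_nonzero[OF B c h] by auto
  qed
  have "graded_iso ?L ?C \<psi>"
  proof (rule graded_isoI[OF R.graded_algebra_loop gC])
    show "vanishes_outside (carrier ?L) \<psi>" unfolding \<psi>_def by (rule R.L.vanishes_graded_ext)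
    show lin: "linear_on (carrier ?L) (carrier ?C) \<psi>"
      unfolding \<psi>_def by (rule R.L.linear_graded_ext[OF tl C.subspace_carrier])
    have \<psi>0: "\<psi> 0 = 0" using linear_on_zero[OF lin R.L.zero_carrier] .
    show "bij_betw \<psi> (comp ?L g) (comp ?C g)" for g
    proof (cases "g \<in> ker \<pi>")
      case True
      have "comp ?C g \<subseteq> range (\<lambda>r. r *\<^sub>R c g)"
      proof
        fix T assume "T \<in> comp ?C g"
        then show "T \<in> range (\<lambda>r. r *\<^sub>R c g)"
          by (cases "T = 0") (auto intro: range_eqI[of _ _ 0] elim: frame_multiple[OF c])
      qed
      moreover have "range (\<lambda>r. r *\<^sub>R c g) \<subseteq> comp ?C g"
        using C.scaleR_comp[OF frame_comp[OF c True]] by auto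
      moreover have "inj_on \<psi> (comp ?L g)"
        using cnz[OF True] by (auto simp: inj_on_def R True \<psi>)
      moreover have "\<psi> ` comp ?L g = range (\<lambda>r. r *\<^sub>R c g)"
        by (auto simp: R True \<psi> image_image)
      ultimately show ?thesis by (auto simp: bij_betw_def)
    next
      case False
      have "comp ?C g = {0}"
        using False frame_multiple[OF c, of _ g] C.zero_comp by blast
      then show ?thesis using False \<psi>0 by (simp add: R bij_betw_def)
    qed
    show "\<psi> (mult ?L x y) = mult ?C (\<psi> x) (\<psi> y)" if xy: "x \<in> comp ?L g" "y \<in> comp ?L h" for g h x y
    proof (cases "g \<in> ker \<pi> \<and> h \<in> ker \<pi>")
      case True
      then obtain r s where rs: "x = pure r g" "y = pure s h" using xy by (auto simp: R)
      have m: "r \<in> comp trivially_graded_reals (\<pi> g)" "s \<in> comp trivially_graded_reals (\<pi> h)"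
        using True by (simp_all add: trivially_graded_reals_def ker_iff)
      have "mult ?L x y = pure (eps g h * (r * s)) (g + h)"
        unfolding rs R.mult_pure[OF m] by (simp add: trivially_graded_reals_def pure_scaleR[symmetric])
      then have "\<psi> (mult ?L x y) = (r * s) *\<^sub>R (c g \<circ> c h)"
        using True c by (simp add: \<psi> centroid_frame_def mult_ac)
      also have "\<dots> = mult ?C (\<psi> x) (\<psi> y)"
        unfolding rs using True C.mult_scaleR_left[of "s *\<^sub>R c h" "c g" r] C.mult_scaleR_right[of "c g" "c h" s]
          cc C.scaleR_carrier by (simp add: \<psi>)
      finally show ?thesis .
    next
      case False
      then have "x = 0 \<or> y = 0" using xy by (auto simp: R split: if_splits)
      then show ?thesis
        using R.L.comp_carrier[OF xy(1)] R.L.comp_carrier[OF xy(2)] \<psi>0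
          C.mult_zero_left[OF linear_on_mem[OF lin]] C.mult_zero_right[OF linear_on_mem[OF lin]]
        by (auto simp del: mult_centroid)
    qed
  qed
  from graded_iso_inv[OF R.graded_algebra_loop this] show ?thesis by blast
qed

end

section \<open>Central simple algebras and their loop algebras\<close>

context loop_algebra
begin

lemma nontrivial_loop:
  assumes "nontrivial_product A"
  shows "nontrivial_product LA"
proof -
  obtain p q a b where ab: "a \<in> comp A p" "b \<in> comp A q" "mult A a b \<noteq> 0"
    using nonzero_product_homogeneous[OF assms] by blast
  then have m: "a \<in> comp A (\<pi> (\<xi> p))" "b \<in> comp A (\<pi> (\<xi> q))" by simp_all
  have "mult LA (pure a (\<xi> p)) (pure b (\<xi> q)) \<noteq> 0" using mult_pure[OF m] ab by simp
  then show ?thesis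
    unfolding nontrivial_product_def using L.comp_carrier[OF pure_comp[OF m(1)]]
      L.comp_carrier[OF pure_comp[OF m(2)]] by blast
qed

text \<open>The ideal \<open>J\<close> is only known to contain one nonzero a \<otimes> u_k.
  Multiplying by b \<otimes> u_m for all \<open>m\<close> over one degree reaches every degree over
  that of the product, so products of \<open>a\<close> with homogeneous elements spread over whole
  fibres of \<open>\<pi>\<close>. They cannot all vanish, as \<open>A\<close> has no
  annihilator.\<close>

lemma graded_simple_loop:
  assumes simple: "graded_simple A"
  shows "graded_simple LA"
proof (rule L.graded_simpleI)
  show "nontrivial_product LA" using nontrivial_loop simple by (simp add: graded_simple_def)
  fix J k y g x
  assume J: "alg_ideal LA J" and y: "y \<in> J" "y \<in> comp LA k" "y \<noteq> 0" and x: "x \<in> comp LA g"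
  have subJ: "subspace J"
    and id: "\<And>x y. x \<in> carrier LA \<Longrightarrow> y \<in> J \<Longrightarrow> mult LA x y \<in> J \<and> mult LA y x \<in> J"
    using J by (auto simp: alg_ideal_def)
  have scale: "u \<in> J" if "r *\<^sub>R u \<in> J" "r \<noteq> 0" for r u
    using subspace_scale[OF subJ that(1), of "inverse r"] that(2) by simp
  \<comment> \<open>Quantifying over the whole fibre makes \<open>I\<close> a family indexed by the
    quotient group; once each \<open>I p\<close> is all of \<open>comp A p\<close>, every
    homogeneous element of the loop algebra is in \<open>J\<close>.\<close>
  define I where "I p = {b \<in> comp A p. \<forall>g. \<pi> g = p \<longrightarrow> pure b g \<in> J}" for p
  have subI: "subspace (I p)" for p
    unfolding subspace_def I_def
    using subspace_0[OF subJ] subspace_add[OF subJ] subspace_scale[OF subJ]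
    by (auto simp: pure_add pure_scaleR add_comp scaleR_comp)
  have left: "pure (mult A a b) l \<in> J"
    if "a \<in> comp A (\<pi> m)" "b \<in> comp A (\<pi> (l - m))" "pure b (l - m) \<in> J" for a b l m
    using id[OF L.comp_carrier[OF pure_comp[OF that(1)]] that(3)] mult_pure[OF that(1,2)]
    by (auto intro: scale[OF _ eps_nonzero])
  have right: "pure (mult A b a) l \<in> J"
    if "a \<in> comp A (\<pi> m)" "b \<in> comp A (\<pi> (l - m))" "pure b (l - m) \<in> J" for a b l m
    using id[OF L.comp_carrier[OF pure_comp[OF that(1)]] that(3)] mult_pure[OF that(2,1)]
    by (auto intro: scale[OF _ eps_nonzero])
  have ideal: "mult A a b \<in> I (s + p) \<and> mult A b a \<in> I (s + p)"
    if a: "a \<in> comp A s" and b: "b \<in> I p" for s p a b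
  proof -
    have bp: "b \<in> comp A p" using b by (simp add: I_def)
    have "pure (mult A a b) l \<in> J" "pure (mult A b a) l \<in> J" if l: "\<pi> l = s + p" for l
    proof -
      have m: "a \<in> comp A (\<pi> (\<xi> s))" "b \<in> comp A (\<pi> (l - \<xi> s))" "pure b (l - \<xi> s) \<in> J"
        using a b l bp by (auto simp: I_def)
      show "pure (mult A a b) l \<in> J" "pure (mult A b a) l \<in> J" using left[OF m] right[OF m] .
    qed
    then show ?thesis using mult_comp[OF a bp] mult_comp[OF bp a] by (simp add: I_def add.commute)
  qed
  obtain a where a: "a \<in> comp A (\<pi> k)" "y = pure a k" using y(2) by (rule comp_loopE)
  have "\<exists>p b. b \<in> I p \<and> b \<noteq> 0"
  proof (rule ccontr)
    assume "\<not> ?thesis"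
    then have none: "b = 0" if "b \<in> I p" for b p using that by blast
    have "mult A a b = 0 \<and> mult A b a = 0" if b: "b \<in> comp A q" for q b
    proof -
      have "pure (mult A a b) l \<in> J" "pure (mult A b a) l \<in> J" if l: "\<pi> l = \<pi> k + q" for l
      proof -
        \<comment> \<open>\<open>l - k\<close> lies over \<open>q\<close>, so the factor of degree
          \<open>l - k\<close> carries degree \<open>k\<close> to the prescribed
          \<open>l\<close>.\<close>
        have m: "b \<in> comp A (\<pi> (l - k))" "a \<in> comp A (\<pi> (l - (l - k)))" "pure a (l - (l - k)) \<in> J"
          using a b l y(1) by auto
        show "pure (mult A a b) l \<in> J" "pure (mult A b a) l \<in> J" using left[OF m] right[OF m] by auto
      qed
      then have "mult A a b \<in> I (\<pi> k + q)" "mult A b a \<in> I (\<pi> k + q)"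
        using mult_comp[OF a(1) b] mult_comp[OF b a(1)] by (simp_all add: I_def add.commute)
      then show ?thesis using none by blast
    qed
    then have "a = 0" by (rule annihilator_zero[OF simple a(1)])
    then show False using a(2) y(3) by simp
  qed
  then obtain p b where b: "b \<in> I p" "b \<noteq> 0" by blast
  have I: "I q = comp A q" for q
    by (rule graded_simple_family[OF simple subI _ ideal b]) (auto simp: I_def)
  obtain c where c: "c \<in> comp A (\<pi> g)" "x = pure c g" using x by (rule comp_loopE)
  have "c \<in> I (\<pi> g)" unfolding I by (rule c(1))
  then show "x \<in> J" by (simp add: I_def c(2))
qed

lemma centroid_frame_unit:
  assumes simple: "graded_simple A" and central: "carrier (centroid A) = range (scalar_op (carrier A))"
  shows "centroid_frame LA unit"
  unfolding centroid_frame_def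
proof (intro conjI ballI allI impI)
  show "unit h \<in> comp (centroid LA) h" if "h \<in> ker \<pi>" for h using unit_centroid[OF that] .
  note uc = centroid_comp_carrier[OF unit_centroid]
  show "unit h \<circ> unit k = eps h k *\<^sub>R unit (h + k)" if hk: "h \<in> ker \<pi>" "k \<in> ker \<pi>" for h k
  proof (rule centroid_eqI)
    show "unit h \<circ> unit k \<in> carrier (centroid LA)"
      by (rule L.centroid_compose[OF uc[OF hk(1)] uc[OF hk(2)]])
    show "eps h k *\<^sub>R unit (h + k) \<in> carrier (centroid LA)"
      by (rule subspace_scale[OF L.subspace_centroid uc[OF ker_closed(2)[OF hk]]])
    fix g a assume a: "a \<in> comp A (\<pi> g)"
    have a': "a \<in> comp A (\<pi> (k + g))" using a hk by (simp add: ker_iff)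
    have s: "eps k g * eps h (k + g) = eps h k * eps (h + k) g" by (rule eps_cocycle[symmetric])
    show "(unit h \<circ> unit k) (pure a g) = (eps h k *\<^sub>R unit (h + k)) (pure a g)"
      using unit_pure[OF hk(2) a] unit_pure[OF hk(1) a'] unit_pure[OF ker_closed(2)[OF hk] a]
        linear_on_scaleR[OF centroid_linear[OF uc[OF hk(1)]] L.comp_carrier[OF pure_comp[OF a']]] s
      by (simp add: add.assoc)
  qed
  fix e T assume T: "T \<in> comp (centroid LA) e" and T0: "T \<noteq> 0"
  note Tc = centroid_comp_carrier[OF T]
  note lin = centroid_linear[OF Tc]
  \<comment> \<open>The factor \<open>eps e g\<close>, its own inverse, makes \<open>T\<close> send
    a \<otimes> u_g to \<open>t g a\<close> \<otimes> u_e u_g; the signs then cancel in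
    \<open>tmult\<close>.\<close>
  define t where "t g a = eps e g *\<^sub>R coef (T (pure a g)) (e + g)" for g a
  have t: "t g a \<in> comp A (\<pi> (e + g))" "T (pure a g) = eps e g *\<^sub>R pure (t g a) (e + g)"
    if a: "a \<in> comp A (\<pi> g)" for g a
  proof -
    note c = coef_comp[OF centroid_compD[OF T pure_comp[OF a]]]
    show "t g a \<in> comp A (\<pi> (e + g))" using c scaleR_comp by (simp add: t_def)
    show "T (pure a g) = eps e g *\<^sub>R pure (t g a) (e + g)" using c by (simp add: t_def pure_scaleR)
  qed
  have tmult: "t (k + g) (mult A b a) = mult A b (t g a) \<and> t (k + g) (mult A b a) = mult A (t k b) a"
    if a: "a \<in> comp A (\<pi> g)" and b: "b \<in> comp A (\<pi> k)" for a b g k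
  proof -
    note pa = L.comp_carrier[OF pure_comp[OF a]] and pb = L.comp_carrier[OF pure_comp[OF b]]
    have ba: "mult A b a \<in> comp A (\<pi> (k + g))" using mult_comp[OF b a] by simp
    have lhs: "T (mult LA (pure b k) (pure a g)) =
        (eps k g * eps e (k + g)) *\<^sub>R pure (t (k + g) (mult A b a)) (e + (k + g))"
      unfolding mult_pure[OF b a] linear_on_scaleR[OF lin L.comp_carrier[OF pure_comp[OF ba]]] t(2)[OF ba]
      by simp
    have r1: "mult LA (pure b k) (T (pure a g)) =
        (eps e g * eps k (e + g)) *\<^sub>R pure (mult A b (t g a)) (k + (e + g))"
      unfolding t(2)[OF a] L.mult_scaleR_right[OF pb L.comp_carrier[OF pure_comp[OF t(1)[OF a]]]]
        mult_pure[OF b t(1)[OF a]] by simp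
    have r2: "mult LA (T (pure b k)) (pure a g) =
        (eps e k * eps (e + k) g) *\<^sub>R pure (mult A (t k b) a) (e + k + g)"
      unfolding t(2)[OF b] L.mult_scaleR_left[OF pa L.comp_carrier[OF pure_comp[OF t(1)[OF b]]]]
        mult_pure[OF t(1)[OF b] a] by simp
    have i: "k + (e + g) = e + (k + g)" "e + k + g = e + (k + g)" by (simp_all add: algebra_simps)
    have s1: "eps e g * eps k (e + g) = eps k g * eps e (k + g)" by (rule eps_left_commute)
    have s2: "eps e k * eps (e + k) g = eps k g * eps e (k + g)" by (rule eps_cocycle)
    have "eps k g * eps e (k + g) \<noteq> 0" by simp
    then show ?thesis
      using L.centroid_mult[OF Tc pb pa] unfolding lhs r1 r2 i s1 s2 by (simp del: eps_nonzero)
  qed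
  \<comment> \<open>By \<open>tmult\<close> the products of \<open>t g a\<close> with
    \<open>b\<close> can be rewritten with the operator applied to \<open>b\<close> instead, which
    no longer mentions \<open>g\<close>; so the difference annihilates \<open>A\<close>.\<close>
  have indep: "t g a = t g' a" if a: "a \<in> comp A (\<pi> g)" and g: "\<pi> g = \<pi> g'" for a g g'
  proof -
    have a': "a \<in> comp A (\<pi> g')" using a g by simp
    have m: "t g a \<in> comp A (\<pi> (e + g))" "t g' a \<in> comp A (\<pi> (e + g))"
      using t(1)[OF a] t(1)[OF a'] g by auto
    have "t g a - t g' a = 0"
    proof (rule annihilator_zero[OF simple subspace_diff[OF subspace_comp m]])
      fix q b assume "b \<in> comp A q"
      then have b: "b \<in> comp A (\<pi> (\<xi> q))" by simp
      note bc = comp_carrier[OF b]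
      have "mult A b (t g a) = mult A b (t g' a)" "mult A (t g a) b = mult A (t g' a) b"
        using tmult[OF a b] tmult[OF a' b] tmult[OF b a] tmult[OF b a'] by metis+
      then show "mult A (t g a - t g' a) b = 0 \<and> mult A b (t g a - t g' a) = 0"
        using linear_on_diff[OF linear_mult_left[OF bc] subspace_carrier comp_carrier[OF m(1)] comp_carrier[OF m(2)]]
          linear_on_diff[OF linear_mult_right[OF bc] subspace_carrier comp_carrier[OF m(1)] comp_carrier[OF m(2)]]
        by simp
    qed
    then show ?thesis by simp
  qed
  have tlin: "linear_on (comp A p) (comp A (\<pi> e + p)) (t (\<xi> p))" for p
    unfolding linear_on_def
  proof (intro conjI ballI allI)
    show "t (\<xi> p) ` comp A p \<subseteq> comp A (\<pi> e + p)" using t(1)[of _ "\<xi> p"] by auto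
    have c: "pure a (\<xi> p) \<in> carrier LA" if "a \<in> comp A p" for a
      using L.comp_carrier[OF pure_comp] that by simp
    show "t (\<xi> p) (x + y) = t (\<xi> p) x + t (\<xi> p) y" if "x \<in> comp A p" "y \<in> comp A p" for x y
      using c[OF that(1)] c[OF that(2)]
      by (simp add: t_def pure_add linear_on_add[OF lin] coef_add scaleR_add_right)
    show "t (\<xi> p) (r *\<^sub>R x) = r *\<^sub>R t (\<xi> p) x" if "x \<in> comp A p" for r x
      using c[OF that] by (simp add: t_def pure_scaleR linear_on_scaleR[OF lin] coef_scaleR mult.commute)
  qed
  have tm: "t (\<xi> (p + q)) (mult A x y) = mult A x (t (\<xi> q) y) \<and>
      t (\<xi> (p + q)) (mult A x y) = mult A (t (\<xi> p) x) y"
    if "x \<in> comp A p" "y \<in> comp A q" for p q x y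
  proof -
    have xy: "x \<in> comp A (\<pi> (\<xi> p))" "y \<in> comp A (\<pi> (\<xi> q))" using that by simp_all
    have "mult A x y \<in> comp A (\<pi> (\<xi> (p + q)))" using mult_comp[OF that] by simp
    \<comment> \<open>\<open>\<xi> (p + q)\<close> and \<open>\<xi> p + \<xi> q\<close> lie in the
      same fibre.\<close>
    then have "t (\<xi> (p + q)) (mult A x y) = t (\<xi> p + \<xi> q) (mult A x y)" by (rule indep) simp
    then show ?thesis using tmult[OF xy(2,1)] by metis
  qed
  have "graded_ext A (\<lambda>p. t (\<xi> p)) \<in> comp (centroid A) (\<pi> e)"
    by (rule centroid_family(1)[OF tlin tm])
  then have "graded_ext A (\<lambda>p. t (\<xi> p)) \<in> range (scalar_op (carrier A))"
    using central centroid_comp_carrier by blast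
  then obtain r where r: "graded_ext A (\<lambda>p. t (\<xi> p)) = scalar_op (carrier A) r" by blast
  have txi: "t (\<xi> p) a = r *\<^sub>R a" if a: "a \<in> comp A p" for p a
  proof -
    have "graded_ext A (\<lambda>p. t (\<xi> p)) a = t (\<xi> p) a"
      by (rule centroid_family(2)[OF tlin tm a])
    then show ?thesis using r comp_carrier[OF a] by (simp add: scalar_op_def)
  qed
  have tr: "t g a = r *\<^sub>R a" if a: "a \<in> comp A (\<pi> g)" for g a
    using indep[OF a, of "\<xi> (\<pi> g)"] txi[OF a] by simp
  have r0: "r \<noteq> 0"
  proof
    assume "r = 0"
    have "T = 0"
    proof (rule centroid_eqI[OF Tc subspace_0[OF L.subspace_centroid]])
      show "T (pure a g) = 0 (pure a g)" if a: "a \<in> comp A (\<pi> g)" for g a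
        using t(2)[OF a] tr[OF a] \<open>r = 0\<close> by simp
    qed
    then show False using T0 by simp
  qed
  obtain q a where a: "a \<in> comp A q" "a \<noteq> 0"
  proof (rule nonzero_homogeneous)
    show "carrier A \<noteq> {0}" using simple by (auto simp: graded_simple_def nontrivial_product_def)
  qed (rule that)
  have aq: "a \<in> comp A (\<pi> (\<xi> q))" using a by simp
  \<comment> \<open>A scalar preserves degrees, while \<open>t\<close> raises them by
    \<open>\<pi> e\<close>; as \<open>r\<close> is nonzero, \<open>\<pi> e = 0\<close>.\<close>
  have "r *\<^sub>R a \<in> comp A (\<pi> e + q)" using t(1)[OF aq] tr[OF aq] by simp
  moreover have "r *\<^sub>R a \<in> comp A q" using scaleR_comp[OF a(1)] .
  ultimately have "\<pi> e + q = q" using a(2) r0 by (intro comp_disjoint[of "r *\<^sub>R a"]) simp_all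
  then show e: "e \<in> ker \<pi>" by (simp add: ker_iff)
  have "T = r *\<^sub>R unit e"
  proof (rule centroid_eqI[OF Tc subspace_scale[OF L.subspace_centroid uc[OF e]]])
    show "T (pure a g) = (r *\<^sub>R unit e) (pure a g)" if a: "a \<in> comp A (\<pi> g)" for g a
      using t(2)[OF a] tr[OF a] unit_pure[OF e a] by (simp add: pure_scaleR mult.commute)
  qed
  then show "\<exists>r. T = r *\<^sub>R unit e" by blast
qed

text \<open>An ideal of \<open>A\<close> induces an ideal of the loop algebra by a condition on
  coefficients. A homogeneous centroid element of \<open>A\<close> is compared with the identity
  through their lifts, which the frame makes proportional.\<close>

lemma central_simple_from_loop:
  assumes simple: "graded_simple LA" and c: "centroid_frame LA c"
  shows "central_simple A"
proof (rule central_simpleI)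
  show "graded_simple A"
  proof (rule graded_simpleI)
    have "nontrivial_product LA" using simple by (simp add: graded_simple_def)
    from L.nonzero_product_homogeneous[OF this]
    obtain g h x y where xy: "x \<in> comp LA g" "y \<in> comp LA h" "mult LA x y \<noteq> 0" by auto
    obtain a where a: "a \<in> comp A (\<pi> g)" "x = pure a g" using xy(1) by (rule comp_loopE)
    obtain b where b: "b \<in> comp A (\<pi> h)" "y = pure b h" using xy(2) by (rule comp_loopE)
    have ab: "a \<in> comp A (\<pi> g)" "b \<in> comp A (\<pi> h)" "mult LA (pure a g) (pure b h) \<noteq> 0"
      using a b xy(3) by auto
    then have "mult A a b \<noteq> 0" by (auto simp: mult_pure)
    then show "nontrivial_product A"
      using comp_carrier[OF ab(1)] comp_carrier[OF ab(2)] unfolding nontrivial_product_def by blast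
    fix J k y g x
    assume J: "alg_ideal A J" and y: "y \<in> J" "y \<in> comp A k" "y \<noteq> 0" and x: "x \<in> comp A g"
    have subJ: "subspace J"
      and id: "\<And>x y. x \<in> carrier A \<Longrightarrow> y \<in> J \<Longrightarrow> mult A x y \<in> J \<and> mult A y x \<in> J"
      using J by (auto simp: alg_ideal_def)
    define I where "I g = {f \<in> comp LA g. coef f g \<in> J}" for g
    have coef0: "coef 0 g = (0::'v)" for g by (simp add: coef_def)
    have subI: "subspace (I g)" for g
      unfolding subspace_def I_def
      using subspace_0[OF subJ] subspace_add[OF subJ] subspace_scale[OF subJ]
      by (auto simp: coef0 coef_add coef_scaleR L.add_comp L.scaleR_comp)
    have ideal: "mult LA u v \<in> I (s + g) \<and> mult LA v u \<in> I (s + g)"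
      if u: "u \<in> comp LA s" and v: "v \<in> I g" for s g u v
    proof -
      have vg: "v \<in> comp LA g" "coef v g \<in> J" using v by (auto simp: I_def)
      note ua = coef_comp[OF u, THEN conjunct1] and vb = coef_comp[OF vg(1), THEN conjunct1]
      have m: "mult LA u v = eps s g *\<^sub>R pure (mult A (coef u s) (coef v g)) (s + g)"
        "mult LA v u = eps s g *\<^sub>R pure (mult A (coef v g) (coef u s)) (s + g)"
        using mult_pure[OF ua vb] mult_pure[OF vb ua] coef_comp[OF u] coef_comp[OF vg(1)]
        by (simp_all add: eps_commute add.commute)
      show ?thesis
        using L.mult_comp[OF u vg(1)] L.mult_comp[OF vg(1) u] id[OF comp_carrier[OF ua] vg(2)]
          subspace_scale[OF subJ]
        by (simp add: I_def m coef_scaleR add.commute)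
    qed
    have "I (\<xi> g) = comp LA (\<xi> g)"
    proof (rule L.graded_simple_family[where I = I, OF simple subI _ ideal])
      show "I g \<subseteq> comp LA g" for g by (auto simp: I_def)
      show "pure y (\<xi> k) \<in> I (\<xi> k)" using y by (simp add: I_def pure_comp)
      show "pure y (\<xi> k) \<noteq> 0" using y by simp
    qed
    then have "pure x (\<xi> g) \<in> I (\<xi> g)" using x by (simp add: pure_comp)
    then show "x \<in> J" by (simp add: I_def)
  qed
  then have nz: "carrier A \<noteq> {0}" by (auto simp: graded_simple_def nontrivial_product_def)
  then obtain q b where b: "b \<in> comp A q" "b \<noteq> 0" using nonzero_homogeneous by blast
  fix d T assume T: "T \<in> comp (centroid A) d" and T0: "T \<noteq> 0"
  let ?id = "scalar_op (carrier A) 1"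
  note Tc = centroid_comp_carrier[OF T]
  have T': "T \<in> comp (centroid A) (\<pi> (\<xi> d))" using T by simp
  have lift0: "lift S e \<noteq> 0"
    if S: "S \<in> comp (centroid A) (\<pi> e)" and a: "a \<in> comp A p" "S a \<noteq> 0" for S a p e
  proof -
    have a': "a \<in> comp A (\<pi> (\<xi> p))" using a by simp
    have "lift S e (pure a (\<xi> p)) \<noteq> 0" using lift_pure[OF S a'] a(2) by simp
    then show ?thesis by auto
  qed
  have "\<exists>p a. a \<in> comp A p \<and> T a \<noteq> 0"
  proof (rule ccontr)
    assume "\<not> ?thesis"
    then have h: "T a = 0" if "a \<in> comp A p" for a p using that by blast
    have "T x = 0" for x
    proof (cases "x \<in> carrier A")
      case True
      then show ?thesis
        by (induction rule: carrier_induct) (simp_all add: h linear_on_add[OF centroid_linear[OF Tc]])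
    qed (use centroid_outside[OF Tc] in simp)
    then show False using T0 by (simp add: fun_eq_iff)
  qed
  then obtain p a where a: "a \<in> comp A p" "T a \<noteq> 0" by blast
  from frame_multiple[OF c lift_centroid[OF T'] lift0[OF T' a]]
  obtain r where r: "\<xi> d \<in> ker \<pi>" "r \<noteq> 0" "lift T (\<xi> d) = r *\<^sub>R c (\<xi> d)" .
  show "d = 0 \<and> (\<exists>r. T = scalar_op (carrier A) r)"
  proof -
    have d: "d = 0" using r(1) by (simp add: ker_iff)
    \<comment> \<open>\<open>\<xi> d\<close> lies in the kernel but may be nonzero even though
      \<open>d = 0\<close>. The identity is therefore lifted along the same \<open>\<xi> d\<close>,
      so that both lifts are multiples of \<open>c (\<xi> d)\<close>.\<close>
    have id: "?id \<in> comp (centroid A) (\<pi> (\<xi> d))" using scalar_op_centroid d by simp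
    have "?id b \<noteq> 0" using b comp_carrier by (simp add: scalar_op_def)
    from frame_multiple[OF c lift_centroid[OF id] lift0[OF id b(1) this]]
    obtain s where s: "s \<noteq> 0" "lift ?id (\<xi> d) = s *\<^sub>R c (\<xi> d)" by metis
    have "T x = scalar_op (carrier A) (r / s) x" if "x \<in> carrier A" for x
    proof (rule linear_on_eqI[OF centroid_linear[OF Tc] _ _ that])
      show "linear_on (carrier A) (carrier A) (scalar_op (carrier A) (r / s))"
        using scalar_op_centroid centroid_comp_carrier centroid_linear by blast
      fix p x assume x: "x \<in> comp A p"
      then have x': "x \<in> comp A (\<pi> (\<xi> p))" by simp
      let ?x = "pure x (\<xi> p)"
      have "s *\<^sub>R lift T (\<xi> d) ?x = r *\<^sub>R lift ?id (\<xi> d) ?x"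
        by (simp add: r(3) s(2) mult.commute)
      then have "eps (\<xi> d) (\<xi> p) *\<^sub>R pure (s *\<^sub>R T x) (\<xi> d + \<xi> p) = eps (\<xi> d) (\<xi> p) *\<^sub>R pure (r *\<^sub>R x) (\<xi> d + \<xi> p)"
        unfolding lift_pure[OF T' x'] lift_pure[OF id x'] using comp_carrier[OF x]
        by (simp add: scalar_op_def pure_scaleR mult.commute)
      then have "s *\<^sub>R T x = r *\<^sub>R x" by simp
      then have "T x = (r / s) *\<^sub>R x" using s(1)
        by (metis divide_inverse_commute left_inverse scaleR_one scaleR_scaleR)
      then show "T x = scalar_op (carrier A) (r / s) x" using comp_carrier[OF x] by (simp add: scalar_op_def)
    qed
    then have "T = scalar_op (carrier A) (r / s)"
      using centroid_outside[OF Tc] by (auto simp: fun_eq_iff scalar_op_def)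
    then show ?thesis using d by blast
  qed
qed

end

section \<open>The two groupoids\<close>

lemma graded_iso_vanishes: "graded_iso A B \<phi> \<Longrightarrow> x \<notin> carrier A \<Longrightarrow> \<phi> x = 0"
  by (simp add: graded_iso_def vanishes_outside_def)

lemma graded_iso_zero: "graded_algebra A \<Longrightarrow> graded_iso A B \<phi> \<Longrightarrow> \<phi> 0 = 0"
  using linear_on_zero[OF graded_iso_linear graded.zero_carrier] by (blast intro: graded.intro)

lemma graded_iso_bij_comp:
  assumes A: "graded_algebra A" and \<phi>: "graded_iso A B \<phi>"
  shows "bij_betw \<phi> (comp A g) (comp B g)"
proof -
  have "inj_on \<phi> (comp A g)"
    using graded_iso_inj[OF \<phi>] graded.comp_carrier[OF graded.intro[OF A]] by (auto simp: inj_on_def)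
  then show ?thesis using \<phi> by (simp add: bij_betw_def graded_iso_def)
qed

lemma graded_iso_scalar_op_left:
  "graded_algebra A \<Longrightarrow> graded_iso A B \<phi> \<Longrightarrow> \<phi> \<circ> scalar_op (carrier A) 1 = \<phi>"
  by (auto simp: fun_eq_iff scalar_op_def graded_iso_zero graded_iso_vanishes)

lemma graded_iso_scalar_op_right:
  "graded_iso A B \<phi> \<Longrightarrow> scalar_op (carrier B) 1 \<circ> \<phi> = \<phi>"
  using graded_iso_vanishes graded_iso_mem by (fastforce simp: fun_eq_iff scalar_op_def)

lemma iso_inv_comp_left:
  "graded_algebra A \<Longrightarrow> graded_iso A B \<phi> \<Longrightarrow> iso_inv A B \<phi> \<circ> \<phi> = scalar_op (carrier A) 1"
proof
  fix x assume A: "graded_algebra A" and \<phi>: "graded_iso A B \<phi>"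
  show "(iso_inv A B \<phi> \<circ> \<phi>) x = scalar_op (carrier A) 1 x"
  proof (cases "x \<in> carrier A")
    case False
    have "iso_inv A B \<phi> (\<phi> 0) = 0"
      using iso_inv_left[OF \<phi> graded.zero_carrier[OF graded.intro[OF A]]] .
    then show ?thesis
      using False graded_iso_zero[OF A \<phi>] graded_iso_vanishes[OF \<phi>] by (simp add: scalar_op_def)
  qed (simp add: scalar_op_def iso_inv_left[OF \<phi>])
qed

lemma iso_inv_comp_right:
  "graded_algebra A \<Longrightarrow> graded_iso A B \<phi> \<Longrightarrow> \<phi> \<circ> iso_inv A B \<phi> = scalar_op (carrier B) 1"
  using iso_inv_right[of A B \<phi>] graded_iso_zero[of A B \<phi>]
  by (auto simp: fun_eq_iff scalar_op_def iso_inv_def)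

lemma groupoid_N: "is_groupoid (N_groupoid \<pi> z)"
proof -
  let ?N = "N_groupoid \<pi> z"
  have gr: "graded_algebra B" if "B \<in> Ob ?N" for B
    using that by (simp add: N_groupoid_def graded_simple_def)
  have hom: "\<phi> \<in> Hom ?N B B' \<longleftrightarrow> graded_iso B B' \<phi>" for \<phi> B B' by (simp add: N_groupoid_def)
  have id: "Ident ?N B = scalar_op (carrier B) 1" and comp: "Comp ?N f g = f \<circ> g" for B f g
    by (simp_all add: N_groupoid_def)
  have "is_category ?N"
    unfolding is_category_def hom id comp
  proof (intro conjI ballI allI impI)
    show "graded_iso B B (scalar_op (carrier B) 1)" if "B \<in> Ob ?N" for B
      using graded_iso_ident[OF gr[OF that]] .
    show "graded_iso B D (g \<circ> f)"
      if "B \<in> Ob ?N" "f \<in> Hom ?N B E" "g \<in> Hom ?N E D" for B E D f g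
      using that graded_iso_compose[OF graded.zero_carrier[OF graded.intro[OF gr]]]
      unfolding hom by blast
    show "f \<circ> scalar_op (carrier B) 1 = f" if "B \<in> Ob ?N" "f \<in> Hom ?N B E" for B E f
      using that graded_iso_scalar_op_left gr unfolding hom by blast
    show "scalar_op (carrier E) 1 \<circ> f = f" if "f \<in> Hom ?N B E" for B E f
      using that graded_iso_scalar_op_right unfolding hom by blast
  qed (simp add: comp_assoc)
  moreover have "is_iso ?N B B' \<phi>" if "B \<in> Ob ?N" "\<phi> \<in> Hom ?N B B'" for B B' \<phi>
  proof -
    have \<phi>: "graded_iso B B' \<phi>" using that(2) by (simp only: hom)
    note B = gr[OF that(1)]
    show ?thesis
      unfolding is_iso_def id comp
      using \<phi> graded_iso_inv[OF B \<phi>] iso_inv_comp_left[OF B \<phi>] iso_inv_comp_right[OF B \<phi>]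
      by (intro conjI bexI[of _ "iso_inv B B' \<phi>"]) (simp_all only: hom)
  qed
  ultimately show ?thesis unfolding is_groupoid_def by blast
qed

lemma carrier_twist [simp]: "carrier (twist \<xi> \<mu> A) = carrier A"
  and comp_twist [simp]: "comp (twist \<xi> \<mu> A) = comp A"
  by (simp_all add: twist_def)

lemma graded_algebra_twist:
  fixes A :: "('h::ab_group_add, 'v::real_vector) galg"
  assumes "graded_algebra A"
  shows "graded_algebra (twist \<xi> \<mu> A)"
proof -
  interpret graded A using assms by unfold_locales
  let ?m = "\<lambda>p q x y. \<mu> (cocycle \<xi> p q) *\<^sub>R mult A x y"
  have "graded_algebra (A\<lparr>mult := graded_bilinear A ?m\<rparr>)"
    by (rule graded_algebra_graded_bilinear)
      (auto simp: linear_on_def mult_comp scaleR_comp comp_carrier mult_add_left mult_add_right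
        mult_scaleR_left mult_scaleR_right scaleR_add_right)
  moreover have "A\<lparr>mult := graded_bilinear A ?m\<rparr> = twist \<xi> \<mu> A"
    by (simp add: twist_def graded_bilinear_def[abs_def])
  ultimately show ?thesis by simp
qed

lemma twist_iso_mult:
  fixes A :: "('h::ab_group_add, 'v::real_vector) galg"
  assumes A: "graded_algebra A" and \<psi>: "graded_iso (twist \<xi> \<mu> A) A' \<psi>"
    and x: "x \<in> comp A p" and y: "y \<in> comp A q"
  shows "mult A' (\<psi> x) (\<psi> y) = \<mu> (cocycle \<xi> p q) *\<^sub>R \<psi> (mult A x y)"
proof -
  interpret graded A using A by unfold_locales
  note c = comp_carrier[OF x] comp_carrier[OF y]
  have "mult A' (\<psi> x) (\<psi> y) = \<psi> (\<mu> (cocycle \<xi> p q) *\<^sub>R mult A x y)"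
    using graded_iso_mult[OF \<psi>, of x y] c unfolding twist_mult_homogeneous[OF A x y] by simp
  then show ?thesis
    using linear_on_scaleR[OF graded_iso_linear[OF \<psi>], of "mult A x y"] mult_carrier[OF c] by simp
qed

text \<open>The twist is expressed as a scalar defect in the multiplicativity of
  \<open>\<psi>\<close> on the untwisted \<open>A\<close>; \<open>hcomp\<close> disappears, and
  composing maps multiplies their defects.\<close>

lemma twist_isoI:
  fixes A :: "('h::ab_group_add, 'v::real_vector) galg" and A' :: "('h, 'w::real_vector) galg"
  assumes A: "graded_algebra A" and A': "graded_algebra A'"
    and v: "vanishes_outside (carrier A) \<psi>" and lin: "linear_on (carrier A) (carrier A') \<psi>"
    and bij: "\<And>p. bij_betw \<psi> (comp A p) (comp A' p)"
    and mul: "\<And>p q x y. x \<in> comp A p \<Longrightarrow> y \<in> comp A q \<Longrightarrow>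
      mult A' (\<psi> x) (\<psi> y) = \<mu> (cocycle \<xi> p q) *\<^sub>R \<psi> (mult A x y)"
  shows "graded_iso (twist \<xi> \<mu> A) A' \<psi>"
proof (rule graded_isoI[OF graded_algebra_twist[OF A] A'])
  interpret graded A using A by unfold_locales
  fix p q x y assume "x \<in> comp (twist \<xi> \<mu> A) p" "y \<in> comp (twist \<xi> \<mu> A) q"
  then have xy: "x \<in> comp A p" "y \<in> comp A q" by simp_all
  show "\<psi> (mult (twist \<xi> \<mu> A) x y) = mult A' (\<psi> x) (\<psi> y)"
    unfolding twist_mult_homogeneous[OF A xy] mul[OF xy]
    using linear_on_scaleR[OF lin mult_carrier[OF comp_carrier[OF xy(1)] comp_carrier[OF xy(2)]]] .
qed (use v lin bij in simp_all)

section \<open>Characters of the kernel and composition of twisted isomorphisms\<close>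

context loop_setup
begin

lemma characterD:
  assumes "\<mu> \<in> real_characters (ker \<pi>)"
  shows "h \<notin> ker \<pi> \<Longrightarrow> \<mu> h = 0" "h \<in> ker \<pi> \<Longrightarrow> \<mu> h \<noteq> 0"
    "h \<in> ker \<pi> \<Longrightarrow> k \<in> ker \<pi> \<Longrightarrow> \<mu> (h + k) = \<mu> h * \<mu> k" "\<mu> 0 = 1"
proof -
  show "h \<notin> ker \<pi> \<Longrightarrow> \<mu> h = 0" "h \<in> ker \<pi> \<Longrightarrow> \<mu> h \<noteq> 0"
    and m: "h \<in> ker \<pi> \<Longrightarrow> k \<in> ker \<pi> \<Longrightarrow> \<mu> (h + k) = \<mu> h * \<mu> k" for h k
    using assms by (auto simp: real_characters_def vanishes_outside_def)
  show "\<mu> 0 = 1" using m[of 0 0] assms by (auto simp: real_characters_def)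
qed

lemma character_one: "indicator (ker \<pi>) \<in> real_characters (ker \<pi>)"
  by (simp add: real_characters_def vanishes_outside_def)

lemma character_mult:
  "\<mu> \<in> real_characters (ker \<pi>) \<Longrightarrow> \<nu> \<in> real_characters (ker \<pi>) \<Longrightarrow> \<mu> * \<nu> \<in> real_characters (ker \<pi>)"
  by (simp add: real_characters_def vanishes_outside_def)

lemma character_inverse:
  "\<mu> \<in> real_characters (ker \<pi>) \<Longrightarrow> (\<lambda>h. inverse (\<mu> h)) \<in> real_characters (ker \<pi>)"
  by (simp add: real_characters_def vanishes_outside_def)

lemma character_inverse_mult:
  assumes "\<mu> \<in> real_characters (ker \<pi>)"
  shows "(\<lambda>h. inverse (\<mu> h)) * \<mu> = indicator (ker \<pi>)" "\<mu> * (\<lambda>h. inverse (\<mu> h)) = indicator (ker \<pi>)"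
    "\<mu> * indicator (ker \<pi>) = \<mu>" "indicator (ker \<pi>) * \<mu> = \<mu>"
  using characterD(1,2)[OF assms] by (auto simp: fun_eq_iff indicator_def)

lemma twist_iso_ident:
  fixes A :: "('h, 'v::real_vector) galg"
  assumes A: "graded_algebra A"
  shows "graded_iso (twist \<xi> (indicator (ker \<pi>)) A) A (scalar_op (carrier A) 1)"
proof -
  interpret graded A using A by unfold_locales
  note i = graded_iso_ident[OF A]
  show ?thesis
  proof (rule twist_isoI[OF A A _ graded_iso_linear[OF i] graded_iso_bij_comp[OF A i]])
    show "vanishes_outside (carrier A) (scalar_op (carrier A) 1)"
      using i by (simp add: graded_iso_def)
  qed (simp add: scalar_op_def comp_carrier mult_carrier)
qed

lemma twist_iso_compose:
  fixes A B D :: "('h, 'v::real_vector) galg"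
  assumes A: "graded_algebra A" and B: "graded_algebra B" and D: "graded_algebra D"
    and \<psi>: "graded_iso (twist \<xi> \<mu> A) B \<psi>" and \<psi>': "graded_iso (twist \<xi> \<mu>' B) D \<psi>'"
  shows "graded_iso (twist \<xi> (\<mu>' * \<mu>) A) D (\<psi>' \<circ> \<psi>)"
proof -
  interpret A: graded A using A by unfold_locales
  interpret B: graded B using B by unfold_locales
  note lin = graded_iso_linear[OF \<psi>, simplified] and lin' = graded_iso_linear[OF \<psi>', simplified]
  note bij = graded_iso_bij_comp[OF graded_algebra_twist[OF A] \<psi>, simplified]
    and bij' = graded_iso_bij_comp[OF graded_algebra_twist[OF B] \<psi>', simplified]
  show ?thesis
  proof (rule twist_isoI[OF A D _ linear_on_compose[OF lin lin'] bij_betw_trans[OF bij bij']])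
    show "vanishes_outside (carrier A) (\<psi>' \<circ> \<psi>)"
      using graded_iso_vanishes[OF \<psi>] graded_iso_zero[OF graded_algebra_twist[OF B] \<psi>']
      by (simp add: vanishes_outside_def)
    fix p q x y assume x: "x \<in> comp A p" and y: "y \<in> comp A q"
    have m: "\<psi> x \<in> comp B p" "\<psi> y \<in> comp B q" using graded_iso_comp[OF \<psi>] x y by simp_all
    have c: "\<psi> (mult A x y) \<in> carrier B"
      using linear_on_mem[OF lin] A.mult_carrier A.comp_carrier x y by blast
    show "mult D ((\<psi>' \<circ> \<psi>) x) ((\<psi>' \<circ> \<psi>) y) = (\<mu>' * \<mu>) (cocycle \<xi> p q) *\<^sub>R (\<psi>' \<circ> \<psi>) (mult A x y)"
      using twist_iso_mult[OF B \<psi>' m] twist_iso_mult[OF A \<psi> x y] linear_on_scaleR[OF lin' c]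
      by simp
  qed
qed

lemma twist_iso_inv:
  fixes A B :: "('h, 'v::real_vector) galg"
  assumes A: "graded_algebra A" and B: "graded_algebra B" and \<mu>: "\<mu> \<in> real_characters (ker \<pi>)"
    and \<psi>: "graded_iso (twist \<xi> \<mu> A) B \<psi>"
  shows "graded_iso (twist \<xi> (\<lambda>h. inverse (\<mu> h)) B) A (iso_inv (twist \<xi> \<mu> A) B \<psi>)"
proof -
  interpret A: graded A using A by unfold_locales
  interpret B: graded B using B by unfold_locales
  let ?i = "iso_inv (twist \<xi> \<mu> A) B \<psi>"
  have i: "graded_iso B (twist \<xi> \<mu> A) ?i" using graded_iso_inv[OF graded_algebra_twist[OF A] \<psi>] .
  show ?thesis
  proof (rule twist_isoI[OF B A _ graded_iso_linear[OF i, simplified] graded_iso_bij_comp[OF B i, simplified]])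
    show "vanishes_outside (carrier B) ?i" using i by (simp add: graded_iso_def)
    fix p q x y assume x: "x \<in> comp B p" and y: "y \<in> comp B q"
    have m: "?i x \<in> comp A p" "?i y \<in> comp A q" using graded_iso_comp[OF i] x y by simp_all
    have "?i (mult B x y) = \<mu> (cocycle \<xi> p q) *\<^sub>R mult A (?i x) (?i y)"
      using graded_iso_mult[OF i B.comp_carrier[OF x] B.comp_carrier[OF y]]
        twist_mult_homogeneous[OF A m] by simp
    then show "mult A (?i x) (?i y) = inverse (\<mu> (cocycle \<xi> p q)) *\<^sub>R ?i (mult B x y)"
      using characterD(2)[OF \<mu> ker_closed(5)] by simp
  qed
qed

lemma groupoid_M: "is_groupoid (M_groupoid \<pi> \<xi> :: (('h, 'v::real_vector) galg, _) category)"
proof -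
  let ?M = "M_groupoid \<pi> \<xi> :: (('h, 'v) galg, ('v \<Rightarrow> 'v) \<times> ('g \<Rightarrow> real)) category"
  have gr: "graded_algebra A" if "A \<in> Ob ?M" for A using that by (simp add: M_groupoid_def)
  have hom: "(\<psi>, \<mu>) \<in> Hom ?M A B \<longleftrightarrow> \<mu> \<in> real_characters (ker \<pi>) \<and> graded_iso (twist \<xi> \<mu> A) B \<psi>"
    for \<psi> \<mu> A B by (simp add: M_groupoid_def)
  have id: "Ident ?M A = (scalar_op (carrier A) 1, indicator (ker \<pi>))" for A
    by (simp add: M_groupoid_def)
  have comp: "Comp ?M (\<psi>', \<mu>') (\<psi>, \<mu>) = (\<psi>' \<circ> \<psi>, \<mu>' * \<mu>)" for \<psi> \<psi>' \<mu> \<mu>'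
    by (simp add: M_groupoid_def)
  have "is_category ?M"
    unfolding is_category_def
  proof (intro conjI ballI)
    show "Ident ?M A \<in> Hom ?M A A" if "A \<in> Ob ?M" for A
      using character_one twist_iso_ident[OF gr[OF that]] by (simp add: id hom)
    show "Comp ?M g f \<in> Hom ?M A D"
      if "A \<in> Ob ?M" "B \<in> Ob ?M" "D \<in> Ob ?M" "f \<in> Hom ?M A B" "g \<in> Hom ?M B D" for A B D f g
      using that(4,5) twist_iso_compose[OF gr[OF that(1)] gr[OF that(2)] gr[OF that(3)]]
      by (cases f; cases g) (auto simp: comp hom character_mult)
    show "Comp ?M f (Ident ?M A) = f" if "A \<in> Ob ?M" "f \<in> Hom ?M A B" for A B f
      using that(2) graded_iso_scalar_op_left[OF graded_algebra_twist[OF gr[OF that(1)]]]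
      by (cases f) (auto simp: comp id hom character_inverse_mult)
    show "Comp ?M (Ident ?M B) f = f" if "f \<in> Hom ?M A B" for A B f
      using that graded_iso_scalar_op_right
      by (cases f) (auto simp: comp id hom character_inverse_mult)
    show "Comp ?M h (Comp ?M g f) = Comp ?M (Comp ?M h g) f" for f g h
      by (cases f; cases g; cases h) (simp add: comp comp_assoc mult.assoc)
  qed
  moreover have "is_iso ?M A B f" if AB: "A \<in> Ob ?M" "B \<in> Ob ?M" and f: "f \<in> Hom ?M A B" for A B f
  proof -
    obtain \<psi> \<mu> where f_eq: "f = (\<psi>, \<mu>)" by (cases f)
    have \<mu>: "\<mu> \<in> real_characters (ker \<pi>)" and \<psi>: "graded_iso (twist \<xi> \<mu> A) B \<psi>"
      using f by (auto simp: f_eq hom)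
    let ?g = "(iso_inv (twist \<xi> \<mu> A) B \<psi>, \<lambda>h. inverse (\<mu> h))"
    have "?g \<in> Hom ?M B A"
      using twist_iso_inv[OF gr[OF AB(1)] gr[OF AB(2)] \<mu> \<psi>] character_inverse[OF \<mu>] by (simp add: hom)
    moreover have "Comp ?M ?g f = Ident ?M A" "Comp ?M f ?g = Ident ?M B"
      using iso_inv_comp_left[OF graded_algebra_twist[OF gr[OF AB(1)]] \<psi>]
        iso_inv_comp_right[OF graded_algebra_twist[OF gr[OF AB(1)]] \<psi>] character_inverse_mult[OF \<mu>]
      by (simp_all add: f_eq comp id)
    ultimately show ?thesis using f unfolding is_iso_def by blast
  qed
  ultimately show ?thesis unfolding is_groupoid_def by blast
qed

section \<open>The loop functor on morphisms\<close>

lemma loop_algebraI: "graded_algebra A \<Longrightarrow> loop_algebra \<pi> \<chi> z \<xi> A"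
  by (simp add: loop_algebra_def loop_setup_axioms graded.intro)

lemma loop_iso_eqI:
  fixes A :: "('h, 'v::real_vector) galg" and B :: "('g, 'w::real_vector) galg"
  assumes A: "graded_algebra A"
    and \<phi>: "graded_iso (loop \<pi> z A) B \<phi>" and \<phi>': "graded_iso (loop \<pi> z A) B \<phi>'"
    and eq: "\<And>g a. a \<in> comp A (\<pi> g) \<Longrightarrow> \<phi> (pure a g) = \<phi>' (pure a g)"
  shows "\<phi> = \<phi>'"
proof
  interpret loop_algebra \<pi> \<chi> z \<xi> A using loop_algebraI[OF A] .
  fix f
  show "\<phi> f = \<phi>' f"
  proof (cases "f \<in> carrier LA")
    case True
    show ?thesis
      by (rule L.linear_on_eqI[OF graded_iso_linear[OF \<phi>] graded_iso_linear[OF \<phi>'] _ True])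
        (use eq in \<open>auto elim: comp_loopE\<close>)
  qed (simp add: graded_iso_vanishes[OF \<phi>] graded_iso_vanishes[OF \<phi>'])
qed

lemma loop_mor_pure:
  assumes A: "graded_algebra A" and \<psi>: "linear_on (carrier A) W \<psi>" and a: "a \<in> comp A (\<pi> g)"
  shows "loop_mor \<pi> z \<xi> A (\<psi>, \<mu>) (pure a g) = \<mu> (g - \<xi> (\<pi> g)) *\<^sub>R pure (\<psi> a) g"
  using loop_mor_tensor[where \<pi> = \<pi> and g = g and z = z and \<xi> = \<xi> and \<mu> = \<mu>, OF A \<psi> a] by (simp add: pure_def[symmetric] pure_scaleR)

text \<open>The character is evaluated at the kernel parts \<open>g - \<xi> (\<pi> g)\<close>. These
  are additive up to \<open>cocycle\<close>, and the resulting factor matches the one by which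
  \<open>\<psi>\<close> fails to be multiplicative on the untwisted \<open>A\<close>.\<close>

lemma loop_mor_iso:
  fixes A A' :: "('h, 'v::real_vector) galg"
  assumes A: "graded_algebra A" and A': "graded_algebra A'"
    and \<mu>: "\<mu> \<in> real_characters (ker \<pi>)" and \<psi>: "graded_iso (twist \<xi> \<mu> A) A' \<psi>"
  shows "graded_iso (loop \<pi> z A) (loop \<pi> z A') (loop_mor \<pi> z \<xi> A (\<psi>, \<mu>))"
proof -
  interpret A: loop_algebra \<pi> \<chi> z \<xi> A using loop_algebraI[OF A] .
  interpret A': loop_algebra \<pi> \<chi> z \<xi> A' using loop_algebraI[OF A'] .
  let ?f = "loop_mor \<pi> z \<xi> A (\<psi>, \<mu>)"
  note lin = graded_iso_linear[OF \<psi>, simplified]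
  note bij = graded_iso_bij_comp[OF graded_algebra_twist[OF A] \<psi>, simplified]
  have hom: "?f (pure a g) = \<mu> (g - \<xi> (\<pi> g)) *\<^sub>R pure (\<psi> a) g" if "a \<in> comp A (\<pi> g)" for a g
    using loop_mor_pure[OF A lin that] .
  have \<psi>c: "\<psi> a \<in> comp A' p" if "a \<in> comp A p" for a p using bij that by (auto simp: bij_betw_def)
  have homc: "?f x \<in> comp (loop \<pi> z A') g" if "x \<in> comp (loop \<pi> z A) g" for x g
    using that by (elim comp_loopE) (simp add: hom A'.L.scaleR_comp pure_comp \<psi>c)
  have f_add: "?f (x + y) = ?f x + ?f y" and f_scale: "?f (r *\<^sub>R x) = r *\<^sub>R ?f x"
    if "x \<in> carrier (loop \<pi> z A)" "y \<in> carrier (loop \<pi> z A)" for x y r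
  proof -
    \<comment> \<open>\<open>loop_mor\<close> applies \<open>\<psi>\<close> to the two real
      coordinates at each point, and linearity of \<open>\<psi>\<close> is available on
      \<open>carrier A\<close> only.\<close>
    have "x g \<in> carrier A \<times> carrier A" "y g \<in> carrier A \<times> carrier A" for g
      using A.carrier_loop_finite_functions that by (auto simp: A.finite_functions_def)
    then show "?f (x + y) = ?f x + ?f y" "?f (r *\<^sub>R x) = r *\<^sub>R ?f x"
      using that A.L.add_carrier A.L.scaleR_carrier
      by (auto simp: loop_mor_def fun_eq_iff mem_Times_iff linear_on_add[OF lin]
          linear_on_scaleR[OF lin] scaleR_add_right mult.commute)
  qed
  have mem: "?f x \<in> carrier (loop \<pi> z A')" if "x \<in> carrier (loop \<pi> z A)" for x
    using that
  proof (induction rule: A.L.carrier_induct)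
    case (homogeneous g x)
    then show ?case by (rule A'.L.comp_carrier[OF homc])
  next
    case (add x y)
    then show ?case by (simp only: f_add A'.L.add_carrier)
  qed
  show ?thesis
  proof (rule graded_isoI[OF A.graded_algebra_loop A'.graded_algebra_loop])
    show "vanishes_outside (carrier (loop \<pi> z A)) ?f" by (simp add: vanishes_outside_def loop_mor_def)
    show "linear_on (carrier (loop \<pi> z A)) (carrier (loop \<pi> z A')) ?f"
      using mem f_add f_scale by (auto simp: linear_on_def)
    fix g
    have m0: "\<mu> (g - \<xi> (\<pi> g)) \<noteq> 0" using characterD(2)[OF \<mu>] by simp
    show "bij_betw ?f (comp (loop \<pi> z A) g) (comp (loop \<pi> z A') g)"
      unfolding bij_betw_def
    proof (intro conjI subset_antisym)
      show "inj_on ?f (comp (loop \<pi> z A) g)"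
        using bij[of "\<pi> g"] m0 by (auto simp: inj_on_def bij_betw_def comp_loop hom)
      show "?f ` comp (loop \<pi> z A) g \<subseteq> comp (loop \<pi> z A') g" using homc by blast
      show "comp (loop \<pi> z A') g \<subseteq> ?f ` comp (loop \<pi> z A) g"
      proof
        fix y assume "y \<in> comp (loop \<pi> z A') g"
        then obtain b where b: "b \<in> comp A' (\<pi> g)" "y = pure b g" by (rule comp_loopE)
        then obtain a where a: "a \<in> comp A (\<pi> g)" "b = \<psi> a" using bij[of "\<pi> g"] by (auto simp: bij_betw_def)
        let ?a = "inverse (\<mu> (g - \<xi> (\<pi> g))) *\<^sub>R a"
        have ac: "?a \<in> comp A (\<pi> g)" using A.scaleR_comp[OF a(1)] .
        have "?f (pure ?a g) = y"
          using hom[OF ac] m0 linear_on_scaleR[OF lin A.comp_carrier[OF a(1)]] a(2) b(2)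
          by (simp add: pure_scaleR)
        then show "y \<in> ?f ` comp (loop \<pi> z A) g" using pure_comp[OF ac] by blast
      qed
    qed
    fix k x y assume x: "x \<in> comp (loop \<pi> z A) g" and y: "y \<in> comp (loop \<pi> z A) k"
    obtain a where a: "a \<in> comp A (\<pi> g)" "x = pure a g" using x by (rule comp_loopE)
    obtain b where b: "b \<in> comp A (\<pi> k)" "y = pure b k" using y by (rule comp_loopE)
    note pa = A'.L.comp_carrier[OF pure_comp[OF \<psi>c[OF a(1)]]]
      and pb = A'.L.comp_carrier[OF pure_comp[OF \<psi>c[OF b(1)]]]
    have ab: "mult A a b \<in> comp A (\<pi> (g + k))" using A.mult_comp[OF a(1) b(1)] by simp
    have "g + k - \<xi> (\<pi> (g + k)) = (g - \<xi> (\<pi> g)) + (k - \<xi> (\<pi> k)) + cocycle \<xi> (\<pi> g) (\<pi> k)"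
      by (simp add: cocycle_def algebra_simps)
    then have m: "\<mu> (g + k - \<xi> (\<pi> (g + k))) =
        \<mu> (g - \<xi> (\<pi> g)) * \<mu> (k - \<xi> (\<pi> k)) * \<mu> (cocycle \<xi> (\<pi> g) (\<pi> k))"
      by (simp only: characterD(3)[OF \<mu>] ker_closed)
    have "?f (mult (loop \<pi> z A) x y) = (eps g k * \<mu> (g + k - \<xi> (\<pi> (g + k)))) *\<^sub>R pure (\<psi> (mult A a b)) (g + k)"
      using f_scale[OF A.L.comp_carrier[OF pure_comp[OF ab]] A.L.zero_carrier] hom[OF ab]
      by (simp add: a b A.mult_pure)
    moreover have "mult (loop \<pi> z A') (?f x) (?f y) =
        (\<mu> (g - \<xi> (\<pi> g)) * \<mu> (k - \<xi> (\<pi> k)) * eps g k * \<mu> (cocycle \<xi> (\<pi> g) (\<pi> k))) *\<^sub>R pure (\<psi> (mult A a b)) (g + k)"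
      unfolding a(2) b(2) hom[OF a(1)] hom[OF b(1)]
      using A'.L.mult_scaleR_left[OF A'.L.scaleR_carrier[OF pb] pa] A'.L.mult_scaleR_right[OF pa pb]
        A'.mult_pure[OF \<psi>c[OF a(1)] \<psi>c[OF b(1)]] twist_iso_mult[OF A \<psi> a(1) b(1)]
      by (simp add: pure_scaleR)
    ultimately show "?f (mult (loop \<pi> z A) x y) = mult (loop \<pi> z A') (?f x) (?f y)"
      unfolding m by (simp add: mult_ac)
  qed
qed

text \<open>Both frames have the same structure constants \<open>eps\<close>, which cancel when
  products are compared; what remains is multiplicativity of the ratio.\<close>

lemma frames_character:
  fixes B :: "('g, 'v::real_vector) galg"
  assumes B: "graded_algebra B" and nz: "carrier B \<noteq> {0}"
    and c: "centroid_frame B c" and c': "centroid_frame B c'"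
  shows "\<exists>\<mu>\<in>real_characters (ker \<pi>). \<forall>h\<in>ker \<pi>. c' h = \<mu> h *\<^sub>R c h"
proof -
  interpret graded B using B by unfold_locales
  obtain x where x: "x \<in> carrier B" "x \<noteq> 0" using nz zero_carrier by blast
  have "\<exists>r. r \<noteq> 0 \<and> c' h = r *\<^sub>R c h" if h: "h \<in> ker \<pi>" for h
  proof -
    have "c' h \<noteq> 0" using frame_nonzero[OF B c' h x] by auto
    from frame_multiple[OF c frame_comp[OF c' h] this] show ?thesis by blast
  qed
  then obtain r where r: "\<forall>h\<in>ker \<pi>. r h \<noteq> 0 \<and> c' h = r h *\<^sub>R c h" by metis
  have mult: "r (h + k) = r h * r k" if hk: "h \<in> ker \<pi>" "k \<in> ker \<pi>" for h k
  proof -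
    note hk' = ker_closed(2)[OF hk]
    have cc: "c h \<in> carrier (centroid B)" "c k \<in> carrier (centroid B)"
      using frame_comp[OF c] hk centroid_comp_carrier by blast+
    have "c' h (c' k x) = (r h * r k) *\<^sub>R c h (c k x)"
      using r hk linear_on_scaleR[OF centroid_linear[OF cc(1)] centroid_mem[OF cc(2) x(1)]] by simp
    then have "eps h k *\<^sub>R (r (h + k) *\<^sub>R c (h + k) x) = eps h k *\<^sub>R ((r h * r k) *\<^sub>R c (h + k) x)"
      unfolding frame_mult[OF c' hk] frame_mult[OF c hk] using r hk' by (simp add: mult.commute)
    then show ?thesis using frame_nonzero[OF B c hk' x] by simp
  qed
  \<comment> \<open>Zero outside the kernel, as \<open>real_characters\<close> prescribes.\<close>
  let ?\<mu> = "\<lambda>h. if h \<in> ker \<pi> then r h else 0"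
  have "?\<mu> \<in> real_characters (ker \<pi>)"
    using r mult by (simp add: real_characters_def vanishes_outside_def)
  then show ?thesis using r by (intro bexI[of _ ?\<mu>]) auto
qed

text \<open>In degree \<open>\<xi> p\<close> the character is evaluated at 0, which isolates
  \<open>\<psi>\<close>. In degree \<open>h + \<xi> p\<close> it is evaluated at \<open>h\<close>,
  which isolates \<open>\<mu> h\<close> because \<open>\<psi> a\<close> is nonzero.\<close>

lemma loop_mor_faithful:
  fixes A A' :: "('h, 'v::real_vector) galg"
  assumes A: "graded_algebra A" and nz: "carrier A \<noteq> {0}"
    and \<mu>: "\<mu> \<in> real_characters (ker \<pi>)" "graded_iso (twist \<xi> \<mu> A) A' \<psi>"
    and \<nu>: "\<nu> \<in> real_characters (ker \<pi>)" "graded_iso (twist \<xi> \<nu> A) A' \<theta>"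
    and eq: "loop_mor \<pi> z \<xi> A (\<psi>, \<mu>) = loop_mor \<pi> z \<xi> A (\<theta>, \<nu>)"
  shows "\<psi> = \<theta> \<and> \<mu> = \<nu>"
proof -
  interpret A: loop_algebra \<pi> \<chi> z \<xi> A using loop_algebraI[OF A] .
  note lin = graded_iso_linear[OF \<mu>(2), simplified] and lin' = graded_iso_linear[OF \<nu>(2), simplified]
  have eqs: "\<mu> (g - \<xi> (\<pi> g)) *\<^sub>R \<psi> a = \<nu> (g - \<xi> (\<pi> g)) *\<^sub>R \<theta> a" if a: "a \<in> comp A (\<pi> g)" for a g
    using loop_mor_pure[OF A lin a, of \<mu>] loop_mor_pure[OF A lin' a, of \<nu>] eq
    by (simp flip: pure_scaleR)
  have hom: "\<psi> a = \<theta> a" if "a \<in> comp A p" for a p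
    using eqs[of a "\<xi> p"] that characterD(4)[OF \<mu>(1)] characterD(4)[OF \<nu>(1)] by simp
  have "\<psi> x = \<theta> x" for x
  proof (cases "x \<in> carrier A")
    case True
    then show ?thesis by (rule A.linear_on_eqI[OF lin lin' hom, rotated])
  next
    case False
    then show ?thesis using graded_iso_vanishes[OF \<mu>(2)] graded_iso_vanishes[OF \<nu>(2)] by simp
  qed
  then have \<psi>: "\<psi> = \<theta>" by blast
  obtain p a where a: "a \<in> comp A p" "a \<noteq> 0" using A.nonzero_homogeneous[OF nz] .
  have \<psi>a: "\<psi> a \<noteq> 0"
    using graded_iso_inj[OF \<mu>(2), of a 0] A.comp_carrier[OF a(1)] a(2) linear_on_zero[OF lin A.zero_carrier]
    by simp
  have "\<mu> h = \<nu> h" for h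
  proof (cases "h \<in> ker \<pi>")
    case True
    then have "\<pi> (h + \<xi> p) = p" by (simp add: ker_iff)
    then show ?thesis using eqs[of a "h + \<xi> p"] a(1) \<psi>a \<psi> by simp
  qed (simp add: characterD(1)[OF \<mu>(1)] characterD(1)[OF \<nu>(1)])
  then show ?thesis using \<psi> by blast
qed

lemma loop_mor_full:
  fixes A A' :: "('h, 'v::real_vector) galg"
  assumes A: "graded_algebra A" "central_simple A" and A': "graded_algebra A'" "central_simple A'"
    and \<phi>: "graded_iso (loop \<pi> z A) (loop \<pi> z A') \<phi>"
  shows "\<exists>\<psi> \<mu>. \<mu> \<in> real_characters (ker \<pi>) \<and> graded_iso (twist \<xi> \<mu> A) A' \<psi> \<and>
    \<phi> = loop_mor \<pi> z \<xi> A (\<psi>, \<mu>)"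
proof -
  interpret A: loop_algebra \<pi> \<chi> z \<xi> A using loop_algebraI[OF A(1)] .
  interpret A': loop_algebra \<pi> \<chi> z \<xi> A' using loop_algebraI[OF A'(1)] .
  let ?L = "loop \<pi> z A" and ?L' = "loop \<pi> z A'"
  have sA: "graded_simple A" and sA': "graded_simple A'"
    using A A' A.simple_imp_graded_simple A'.simple_imp_graded_simple by (auto simp: central_simple_def)
  have fr: "centroid_frame ?L A.unit" and fr': "centroid_frame ?L' A'.unit"
    using A.centroid_frame_unit[OF sA] A'.centroid_frame_unit[OF sA'] A(2) A'(2)
    by (simp_all add: central_simple_def)
  have nz: "carrier ?L' \<noteq> {0}"
    using A'.graded_simple_loop[OF sA'] A'.L.mult_zero_left[of 0]
    unfolding graded_simple_def nontrivial_product_def by auto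
  \<comment> \<open>Conjugation by \<open>\<phi>\<close> turns the frame of the first loop algebra
    into a second frame of the other one; the character compares the two.\<close>
  obtain \<mu> where \<mu>: "\<mu> \<in> real_characters (ker \<pi>)"
    and \<mu>u: "\<forall>h\<in>ker \<pi>. \<phi> \<circ> A.unit h \<circ> iso_inv ?L ?L' \<phi> = \<mu> h *\<^sub>R A'.unit h"
    using frames_character[OF A'.graded_algebra_loop nz fr'
        frame_iso[OF A.graded_algebra_loop A'.graded_algebra_loop fr \<phi>]] by blast
  have u: "\<phi> (A.unit h x) = \<mu> h *\<^sub>R A'.unit h (\<phi> x)" if h: "h \<in> ker \<pi>" and x: "x \<in> carrier ?L" for h x
  proof -
    have "(\<phi> \<circ> A.unit h \<circ> iso_inv ?L ?L' \<phi>) (\<phi> x) = (\<mu> h *\<^sub>R A'.unit h) (\<phi> x)" using \<mu>u h by simp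
    then show ?thesis using iso_inv_left[OF \<phi> x] by simp
  qed
  note lin = graded_iso_linear[OF \<phi>]
  define s where "s p a = coef (\<phi> (pure a (\<xi> p))) (\<xi> p)" for p a
  have s: "s p a \<in> comp A' p" "\<phi> (pure a (\<xi> p)) = pure (s p a) (\<xi> p)" if a: "a \<in> comp A p" for a p
  proof -
    have "pure a (\<xi> p) \<in> comp ?L (\<xi> p)" using a by (simp add: pure_comp)
    then have "\<phi> (pure a (\<xi> p)) \<in> comp ?L' (\<xi> p)" by (rule graded_iso_comp[OF \<phi>])
    from A'.coef_comp[OF this]
    show "s p a \<in> comp A' p" "\<phi> (pure a (\<xi> p)) = pure (s p a) (\<xi> p)"
      by (simp_all add: s_def)
  qed
  have pc: "pure a (\<xi> p) \<in> carrier ?L" if "a \<in> comp A p" for a p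
    using A.L.comp_carrier[OF pure_comp, of a "\<xi> p"] that by simp
  have sl: "linear_on (comp A p) (carrier A') (s p)" for p
    using s(1) A'.comp_carrier pc
    by (auto simp: linear_on_def s_def pure_add pure_scaleR linear_on_add[OF lin]
        linear_on_scaleR[OF lin] coef_add coef_scaleR)
  define \<psi> where "\<psi> = graded_ext A s"
  have \<psi>: "\<psi> a = s p a" if "a \<in> comp A p" for a p
    unfolding \<psi>_def by (rule A.graded_ext_hom[OF sl that])
  have \<phi>p: "\<phi> (pure a g) = \<mu> (g - \<xi> (\<pi> g)) *\<^sub>R pure (\<psi> a) g" if a: "a \<in> comp A (\<pi> g)" for a g
  proof -
    let ?h = "g - \<xi> (\<pi> g)" and ?p = "\<pi> g"
    have a': "a \<in> comp A (\<pi> (\<xi> ?p))" "s ?p a \<in> comp A' (\<pi> (\<xi> ?p))" using a s(1)[OF a] by simp_all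
    \<comment> \<open>Degrees \<open>\<xi> (\<pi> g)\<close> and \<open>g\<close> are linked by the
      unit of their difference, so the values of \<open>\<phi>\<close> in the degrees
      \<open>\<xi> p\<close> determine all others.\<close>
    have "\<phi> (A.unit ?h (pure a (\<xi> ?p))) = \<mu> ?h *\<^sub>R A'.unit ?h (pure (s ?p a) (\<xi> ?p))"
      using u[OF ker_closed(4) pc[OF a]] s(2)[OF a] by simp
    then have "eps ?h (\<xi> ?p) *\<^sub>R \<phi> (pure a g) = eps ?h (\<xi> ?p) *\<^sub>R (\<mu> ?h *\<^sub>R pure (s ?p a) g)"
      unfolding A.unit_pure[OF ker_closed(4) a'(1)] A'.unit_pure[OF ker_closed(4) a'(2)]
      using linear_on_scaleR[OF lin A.L.comp_carrier[OF pure_comp[OF a]]] by (simp add: mult.commute)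
    then show ?thesis using \<psi>[OF a] by (simp del: scaleR_scaleR)
  qed
  have tw: "graded_iso (twist \<xi> \<mu> A) A' \<psi>"
  proof (rule twist_isoI[OF A(1) A'(1)])
    show "vanishes_outside (carrier A) \<psi>" unfolding \<psi>_def by (rule A.vanishes_graded_ext)
    show \<psi>l: "linear_on (carrier A) (carrier A') \<psi>"
      unfolding \<psi>_def by (rule A.linear_graded_ext[OF sl A'.subspace_carrier])
    fix p
    show "bij_betw \<psi> (comp A p) (comp A' p)"
      unfolding bij_betw_def
    proof (intro conjI subset_antisym)
      show "inj_on \<psi> (comp A p)"
      proof (rule inj_onI)
        fix x y assume xy: "x \<in> comp A p" "y \<in> comp A p" "\<psi> x = \<psi> y"
        then have "\<phi> (pure x (\<xi> p)) = \<phi> (pure y (\<xi> p))" using s(2) \<psi> by simp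
        then show "x = y" using graded_iso_inj[OF \<phi> pc[OF xy(1)] pc[OF xy(2)]] by simp
      qed
      show "\<psi> ` comp A p \<subseteq> comp A' p" using s(1) \<psi> by auto
      show "comp A' p \<subseteq> \<psi> ` comp A p"
      proof
        fix b assume "b \<in> comp A' p"
        then have "pure b (\<xi> p) \<in> comp ?L' (\<xi> p)" by (simp add: pure_comp)
        then have "pure b (\<xi> p) \<in> \<phi> ` comp ?L (\<xi> p)" using \<phi> by (simp add: graded_iso_def)
        then obtain x where x: "x \<in> comp ?L (\<xi> p)" "pure b (\<xi> p) = \<phi> x" by blast
        obtain a where a: "a \<in> comp A (\<pi> (\<xi> p))" "x = pure a (\<xi> p)" using x(1) by (rule comp_loopE)
        have "a \<in> comp A p" "b = \<psi> a" using a x(2) s(2)[of a p] \<psi>[of a p] by auto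
        then show "b \<in> \<psi> ` comp A p" by blast
      qed
    qed
    fix q x y assume x: "x \<in> comp A p" and y: "y \<in> comp A q"
    have xy: "x \<in> comp A (\<pi> (\<xi> p))" "y \<in> comp A (\<pi> (\<xi> q))" using x y by simp_all
    have sxy: "s p x \<in> comp A' (\<pi> (\<xi> p))" "s q y \<in> comp A' (\<pi> (\<xi> q))" using s(1) x y by simp_all
    have m: "mult A x y \<in> comp A (\<pi> (\<xi> p + \<xi> q))" using A.mult_comp[OF x y] by simp
    \<comment> \<open>The product lands in degree \<open>\<xi> p + \<xi> q\<close>, whose kernel
      part is \<open>cocycle \<xi> p q\<close>; this is where the twist appears.\<close>
    have "eps (\<xi> p) (\<xi> q) *\<^sub>R pure (mult A' (\<psi> x) (\<psi> y)) (\<xi> p + \<xi> q) =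
        mult ?L' (\<phi> (pure x (\<xi> p))) (\<phi> (pure y (\<xi> q)))"
      using A'.mult_pure[OF sxy] s(2)[OF x] s(2)[OF y] \<psi>[OF x] \<psi>[OF y] by simp
    also have "\<dots> = \<phi> (eps (\<xi> p) (\<xi> q) *\<^sub>R pure (mult A x y) (\<xi> p + \<xi> q))"
      using graded_iso_mult[OF \<phi> pc[OF x] pc[OF y]] A.mult_pure[OF xy] by simp
    also have "\<dots> = eps (\<xi> p) (\<xi> q) *\<^sub>R (\<mu> (cocycle \<xi> p q) *\<^sub>R pure (\<psi> (mult A x y)) (\<xi> p + \<xi> q))"
      using linear_on_scaleR[OF lin A.L.comp_carrier[OF pure_comp[OF m]]] \<phi>p[OF m] by (simp add: cocycle_def)
    finally show "mult A' (\<psi> x) (\<psi> y) = \<mu> (cocycle \<xi> p q) *\<^sub>R \<psi> (mult A x y)"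
      by (simp del: scaleR_scaleR flip: pure_scaleR)
  qed
  have "\<phi> = loop_mor \<pi> z \<xi> A (\<psi>, \<mu>)"
    by (rule loop_iso_eqI[OF A(1) \<phi> loop_mor_iso[OF A(1) A'(1) \<mu> tw]])
      (simp add: \<phi>p loop_mor_pure[OF A(1) graded_iso_linear[OF tw, simplified]])
  then show ?thesis using \<mu> tw by blast
qed

end

section \<open>Essential surjectivity\<close>

context loop_setup
begin

text \<open>Written in terms of \<open>z\<close>, both sides telescope to the product of
  \<open>z\<close> over \<open>h\<close>, \<open>a\<close>, \<open>l\<close>, \<open>b\<close>,
  \<open>c\<close>, \<open>r\<close>, divided by \<open>z (g + k) * z (a + b)\<close>. This is the
  sign balance behind the multiplicativity of the isomorphism in
  \<open>loop_representative\<close>.\<close>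

lemma eps_section_identity:
  fixes h l c r g k :: 'g
  assumes "g = h + a" "k = l + b" "a + b = c + r"
  shows "eps g k * eps h a * eps l b * eps c r = eps h l * eps (h + l) c * eps (h + l + c) r * eps a b"
proof -
  have i: "h + l + c + r = g + k" "h + a = g" "l + b = k"
    using assms by (metis add.assoc add.left_commute)+
  have "complex_of_real (eps g k * eps h a * eps l b * eps c r) =
      of_real (eps h l * eps (h + l) c * eps (h + l + c) r * eps a b)"
    unfolding of_real_mult of_real_eps i assms(3) by (simp add: field_simps)
  then show ?thesis using of_real_eq_iff by blast
qed

text \<open>The algebra \<open>A\<close> is the image under \<open>e\<close> of the sum of the components of \<open>B\<close> of degrees \<open>\<xi> p\<close>,
  with products brought back from degree \<open>\<xi> p + \<xi> q\<close> to degree \<open>\<xi> (p + q)\<close> by the inverse of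
  \<open>c (cocycle \<xi> p q)\<close> and corrected by the sign \<open>?s p q\<close>.\<close>

lemma loop_representative:
  fixes B :: "('g, 'v::real_vector) galg" and e :: "'v \<Rightarrow> 'u::real_vector"
  assumes e: "linear e" "inj e" and B: "graded_algebra B" and c: "centroid_frame B c"
  shows "\<exists>(A :: ('h, 'u) galg) \<theta>. graded_algebra A \<and> graded_iso (loop \<pi> z A) B \<theta>"
proof -
  interpret B: graded B using B by unfold_locales
  define i where "i = inv e"
  have ie [simp]: "i (e x) = x" for x using e(2) by (simp add: i_def)
  have e_add: "e (x + y) = e x + e y" and e_scale: "e (r *\<^sub>R x) = r *\<^sub>R e x" and e_0: "e 0 = 0" for x y r
    using e(1) by (simp_all add: linear_add linear_scale linear_0)
  have e_eq: "e x = e y \<longleftrightarrow> x = y" for x y using e(2) by (simp add: inj_eq)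
  obtain d where d: "\<forall>h\<in>ker \<pi>. d h \<in> comp (centroid B) (- h) \<and>
      (\<forall>x\<in>carrier B. d h (c h x) = x \<and> c h (d h x) = x)"
    using frame_inverse[OF B c] by metis
  have dc: "d h \<in> comp (centroid B) (- h)" if "h \<in> ker \<pi>" for h using d that by blast
  have dcar: "d h \<in> carrier (centroid B)" if "h \<in> ker \<pi>" for h using centroid_comp_carrier[OF dc[OF that]] .
  have ccar: "c h \<in> carrier (centroid B)" if "h \<in> ker \<pi>" for h using centroid_comp_carrier[OF frame_comp[OF c that]] .
  have cd: "c h (d h x) = x" if "h \<in> ker \<pi>" "x \<in> carrier B" for h x using d that by blast
  have dcx: "d h (c h x) = x" if "h \<in> ker \<pi>" "x \<in> carrier B" for h x using d that by blast
  define C where "C p = e ` comp B (\<xi> p)" for p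
  have i_add: "i (x + y) = i x + i y" and i_scale: "i (r *\<^sub>R x) = r *\<^sub>R i x" and iC: "i x \<in> comp B (\<xi> p)" "e (i x) = x"
    if "x \<in> C p" "y \<in> C p" for x y r p
    using that by (auto simp: C_def simp flip: e_add e_scale)
  have subC: "subspace (C p)" for p
    using B.subspace_comp e(1) unfolding C_def by (rule linear_subspace_image[rotated])
  \<comment> \<open>Zero multiplication for the moment: the actual product is given on homogeneous
    elements, and \<open>graded_bilinear\<close> needs a graded algebra from which to take
    components.\<close>
  define A0 :: "('h, 'u) galg" where
    "A0 = \<lparr>carrier = span (\<Union>p. C p), mult = (\<lambda>x y. 0), comp = C\<rparr>"
  have A0: "graded_algebra A0"
  proof (rule graded_algebraI)
    show "real_algebra A0"
      by (auto simp: A0_def real_algebra_def linear_on_def span_zero)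
    show "subspace (comp A0 p)" for p using subC by (simp add: A0_def)
    show "carrier A0 = span (\<Union>p. comp A0 p)" by (simp add: A0_def)
    show "mult A0 x y \<in> comp A0 (p + q)" for p q x y using subspace_0[OF subC] by (simp add: A0_def)
    fix f assume f: "\<forall>p. f p \<in> comp A0 p" "finite {p. f p \<noteq> 0}" "(\<Sum>p | f p \<noteq> 0. f p) = 0"
    have fC: "f p \<in> C p" for p using f(1) by (simp add: A0_def)
    note fi = iC(1)[OF fC fC] and ef = iC(2)[OF fC fC]
    \<comment> \<open>As \<open>\<xi>\<close> is injective, the \<open>C p\<close> come from
      distinct degrees of \<open>B\<close>, and independence is inherited. The test
      \<open>\<xi> (\<pi> k) = k\<close> decides whether \<open>k\<close> is a value of
      \<open>\<xi>\<close>.\<close>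
    let ?h = "\<lambda>k. if \<xi> (\<pi> k) = k then i (f (\<pi> k)) else 0"
    have "e (\<Sum>p | f p \<noteq> 0. i (f p)) = 0" using f(3) by (simp add: linear_sum[OF e(1)] ef)
    then have s: "(\<Sum>p | f p \<noteq> 0. i (f p)) = 0" using e_eq e_0 by metis
    have "hcomp B 0 = ?h"
    proof (rule B.hcomp_eqI)
      show "finite (\<xi> ` {p. f p \<noteq> 0})" using f(2) by simp
      show "?h k \<in> comp B k" for k using fi[of "\<pi> k"] by auto
      show "?h k = 0" if k: "k \<notin> \<xi> ` {p. f p \<noteq> 0}" for k
      proof -
        have "f (\<pi> k) = 0" if "\<xi> (\<pi> k) = k" using k that by (metis (mono_tags) image_eqI mem_Collect_eq)
        moreover have "i 0 = 0" using ie[of 0] e_0 by simp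
        ultimately show ?thesis by simp
      qed
      have "inj_on \<xi> {p. f p \<noteq> 0}" by (metis inj_onI pi_xi)
      then show "0 = (\<Sum>k\<in>\<xi> ` {p. f p \<noteq> 0}. ?h k)" using s by (simp add: sum.reindex)
    qed
    then have "?h (\<xi> p) = 0" for p by (metis B.hcomp_zero)
    then have "i (f p) = 0" for p by (metis pi_xi)
    then show "\<forall>p. f p = 0" using ef e_0 by metis
  qed
  interpret A0: graded A0 using A0 by unfold_locales
  let ?\<sigma> = "\<lambda>p q. cocycle \<xi> p q"
  \<comment> \<open>The sign needed for an isomorphism with the loop algebra: u_{\<xi> p} u_{\<xi>
    q} is \<open>eps (\<xi> p) (\<xi> q)\<close> times u_{\<xi> p + \<xi> q}, while the product of
    the u in degrees \<open>?\<sigma> p q\<close> and \<open>\<xi> (p + q)\<close> is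
    \<open>eps (?\<sigma> p q) (\<xi> (p + q))\<close> times the same element.\<close>
  let ?s = "\<lambda>p q. eps (?\<sigma> p q) (\<xi> (p + q)) / eps (\<xi> p) (\<xi> q)"
  define m where "m p q x y = e (?s p q *\<^sub>R d (?\<sigma> p q) (mult B (i x) (i y)))" for p q x y
  have dB: "d (?\<sigma> p q) (mult B x y) \<in> comp B (\<xi> (p + q))"
    if "x \<in> comp B (\<xi> p)" "y \<in> comp B (\<xi> q)" for p q x y
  proof -
    have "- ?\<sigma> p q + (\<xi> p + \<xi> q) = \<xi> (p + q)" by (simp add: cocycle_def)
    then show ?thesis using centroid_compD[OF dc[OF ker_closed(5)] B.mult_comp[OF that]] by metis
  qed
  have mC: "m p q x y \<in> C (p + q)" if "x \<in> C p" "y \<in> C q" for p q x y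
    unfolding C_def m_def using B.scaleR_comp[OF dB[OF iC(1)[OF that(1,1)] iC(1)[OF that(2,2)]]] by blast
  note dl = centroid_linear[OF dcar[OF ker_closed(5)]]
  have Bi: "i x \<in> carrier B" if "x \<in> C p" for x p using B.comp_carrier[OF iC(1)[OF that that]] .
  have right: "linear_on (comp A0 q) (comp A0 (p + q)) (\<lambda>y. m p q x y)" if "x \<in> comp A0 p" for p q x
  proof -
    have x: "x \<in> C p" using that by (simp add: A0_def)
    have "linear_on (C q) (C (p + q)) (\<lambda>y. m p q x y)"
      unfolding linear_on_def
    proof (intro conjI ballI allI)
      show "(\<lambda>y. m p q x y) ` C q \<subseteq> C (p + q)" using mC[OF x] by blast
      fix y assume y: "y \<in> C q"
      show "m p q x (r *\<^sub>R y) = r *\<^sub>R m p q x y" for r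
        by (simp add: m_def i_scale[OF y y] B.mult_scaleR_right[OF Bi[OF x] Bi[OF y]]
            linear_on_scaleR[OF dl B.mult_carrier[OF Bi[OF x] Bi[OF y]]] e_scale mult.commute)
      fix y' assume y': "y' \<in> C q"
      show "m p q x (y + y') = m p q x y + m p q x y'"
        by (simp add: m_def i_add[OF y y'] B.mult_add_right[OF Bi[OF x] Bi[OF y] Bi[OF y']]
            linear_on_add[OF dl B.mult_carrier[OF Bi[OF x] Bi[OF y]] B.mult_carrier[OF Bi[OF x] Bi[OF y']]]
            scaleR_add_right e_add)
    qed
    then show ?thesis by (simp add: A0_def)
  qed
  have left: "linear_on (comp A0 p) (comp A0 (p + q)) (\<lambda>x. m p q x y)" if "y \<in> comp A0 q" for p q y
  proof -
    have y: "y \<in> C q" using that by (simp add: A0_def)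
    have "linear_on (C p) (C (p + q)) (\<lambda>x. m p q x y)"
      unfolding linear_on_def
    proof (intro conjI ballI allI)
      show "(\<lambda>x. m p q x y) ` C p \<subseteq> C (p + q)" using mC[OF _ y] by blast
      fix x assume x: "x \<in> C p"
      show "m p q (r *\<^sub>R x) y = r *\<^sub>R m p q x y" for r
        by (simp add: m_def i_scale[OF x x] B.mult_scaleR_left[OF Bi[OF y] Bi[OF x]]
            linear_on_scaleR[OF dl B.mult_carrier[OF Bi[OF x] Bi[OF y]]] e_scale mult.commute)
      fix x' assume x': "x' \<in> C p"
      show "m p q (x + x') y = m p q x y + m p q x' y"
        by (simp add: m_def i_add[OF x x'] B.mult_add_left[OF Bi[OF y] Bi[OF x] Bi[OF x']]
            linear_on_add[OF dl B.mult_carrier[OF Bi[OF x] Bi[OF y]] B.mult_carrier[OF Bi[OF x'] Bi[OF y]]]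
            scaleR_add_right e_add)
    qed
    then show ?thesis by (simp add: A0_def)
  qed
  define A where "A = A0\<lparr>mult := graded_bilinear A0 m\<rparr>"
  have A: "graded_algebra A"
    unfolding A_def by (rule A0.graded_algebra_graded_bilinear(1)[OF right left])
  have Acomp: "comp A p = C p" for p by (simp add: A_def A0_def)
  have Amult: "mult A x y = m p q x y" if "x \<in> C p" "y \<in> C q" for x y p q
  proof -
    have "graded_bilinear A0 m x y = m p q x y"
      by (rule A0.graded_algebra_graded_bilinear(2)[OF right left]) (use that in \<open>simp_all add: A0_def\<close>)
    then show ?thesis by (simp add: A_def)
  qed
  interpret A: loop_algebra \<pi> \<chi> z \<xi> A using loop_algebraI[OF A] .
  let ?h = "\<lambda>g. g - \<xi> (\<pi> g)"
  \<comment> \<open>In the loop algebra a \<otimes> u_g arises, up to the sign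
    \<open>eps (?h g) (\<xi> (\<pi> g))\<close>, from the element with coefficient \<open>a\<close>
    in degree \<open>\<xi> (\<pi> g)\<close> by the action of u in degree \<open>?h g\<close>.
    Replacing this action by \<open>c (?h g)\<close> prescribes the map.\<close>
  define t where "t g f = inverse (eps (?h g) (\<xi> (\<pi> g))) *\<^sub>R c (?h g) (i (coef f g))" for g f
  have tl: "linear_on (comp A.LA g) (carrier B) (t g)" for g
  proof -
    note cl = centroid_linear[OF ccar[OF ker_closed(4)[of g]]]
    have cf: "coef f g \<in> C (\<pi> g)" if "f \<in> comp A.LA g" for f
      using A.coef_comp[OF that] by (simp add: Acomp)
    show ?thesis
      unfolding linear_on_def
    proof (intro conjI ballI allI)
      show "t g ` comp A.LA g \<subseteq> carrier B"
        using B.scaleR_carrier[OF linear_on_mem[OF cl Bi[OF cf]]] by (auto simp: t_def)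
      fix x assume x: "x \<in> comp A.LA g"
      show "t g (r *\<^sub>R x) = r *\<^sub>R t g x" for r
        by (simp add: t_def coef_scaleR i_scale[OF cf[OF x] cf[OF x]] linear_on_scaleR[OF cl Bi[OF cf[OF x]]]
            mult.commute)
      fix y assume y: "y \<in> comp A.LA g"
      show "t g (x + y) = t g x + t g y"
        by (simp add: t_def coef_add i_add[OF cf[OF x] cf[OF y]]
            linear_on_add[OF cl Bi[OF cf[OF x]] Bi[OF cf[OF y]]] scaleR_add_right)
    qed
  qed
  define \<theta> where "\<theta> = graded_ext A.LA t"
  have \<theta>: "\<theta> (pure a g) = inverse (eps (?h g) (\<xi> (\<pi> g))) *\<^sub>R c (?h g) (i a)" if "a \<in> C (\<pi> g)" for a g
  proof -
    have "graded_ext A.LA t (pure a g) = t g (pure a g)"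
      by (rule A.L.graded_ext_hom[OF tl]) (use that in \<open>simp add: pure_comp Acomp\<close>)
    then show ?thesis by (simp add: \<theta>_def t_def)
  qed
  have \<theta>l: "linear_on (carrier A.LA) (carrier B) \<theta>"
    unfolding \<theta>_def by (rule A.L.linear_graded_ext[OF tl B.subspace_carrier])
  have "graded_iso A.LA B \<theta>"
  proof (rule graded_isoI[OF A.graded_algebra_loop B _ \<theta>l])
    show "vanishes_outside (carrier A.LA) \<theta>" unfolding \<theta>_def by (rule A.L.vanishes_graded_ext)
    fix g
    let ?e = "eps (?h g) (\<xi> (\<pi> g))"
    show "bij_betw \<theta> (comp A.LA g) (comp B g)"
      unfolding bij_betw_def
    proof (intro conjI subset_antisym)
      show "inj_on \<theta> (comp A.LA g)"
      proof (rule inj_onI)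
        fix x y assume xy: "x \<in> comp A.LA g" "y \<in> comp A.LA g" "\<theta> x = \<theta> y"
        obtain a where a: "a \<in> C (\<pi> g)" "x = pure a g" using xy(1) unfolding Acomp[symmetric] by (rule comp_loopE)
        obtain b where b: "b \<in> C (\<pi> g)" "y = pure b g" using xy(2) unfolding Acomp[symmetric] by (rule comp_loopE)
        have "c (?h g) (i a) = c (?h g) (i b)" using xy(3) \<theta>[OF a(1)] \<theta>[OF b(1)] a(2) b(2) by simp
        then have "i a = i b" using dcx[OF ker_closed(4) Bi[OF a(1)]] dcx[OF ker_closed(4) Bi[OF b(1)]] by metis
        then show "x = y" using iC(2)[OF a(1) a(1)] iC(2)[OF b(1) b(1)] a(2) b(2) by metis
      qed
      show "\<theta> ` comp A.LA g \<subseteq> comp B g"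
      proof clarify
        fix x assume "x \<in> comp A.LA g"
        then obtain a where a: "a \<in> C (\<pi> g)" "x = pure a g" unfolding Acomp[symmetric] by (rule comp_loopE)
        have "c (?h g) (i a) \<in> comp B (?h g + \<xi> (\<pi> g))"
          using centroid_compD[OF frame_comp[OF c ker_closed(4)] iC(1)[OF a(1) a(1)]] .
        then show "\<theta> x \<in> comp B g" unfolding a(2) \<theta>[OF a(1)] using B.scaleR_comp by simp
      qed
      show "comp B g \<subseteq> \<theta> ` comp A.LA g"
      proof
        fix b assume b: "b \<in> comp B g"
        have "d (?h g) b \<in> comp B (- ?h g + g)" using centroid_compD[OF dc[OF ker_closed(4)] b] .
        then have db: "d (?h g) b \<in> comp B (\<xi> (\<pi> g))" by simp
        let ?x = "?e *\<^sub>R d (?h g) b"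
        have ex: "e ?x \<in> C (\<pi> g)" using B.scaleR_comp[OF db] by (auto simp: C_def)
        have "\<theta> (pure (e ?x) g) = b"
          using \<theta>[OF ex] linear_on_scaleR[OF centroid_linear[OF ccar[OF ker_closed(4)]] B.comp_carrier[OF db]]
            cd[OF ker_closed(4) B.comp_carrier[OF b]] by simp
        then show "b \<in> \<theta> ` comp A.LA g" using pure_comp[of "e ?x" A g] ex by (metis Acomp image_eqI)
      qed
    qed
    fix k x y assume x: "x \<in> comp A.LA g" and y: "y \<in> comp A.LA k"
    obtain a where a: "a \<in> C (\<pi> g)" "x = pure a g" using x unfolding Acomp[symmetric] by (rule comp_loopE)
    obtain b where b: "b \<in> C (\<pi> k)" "y = pure b k" using y unfolding Acomp[symmetric] by (rule comp_loopE)
    let ?p = "\<pi> g" and ?q = "\<pi> k"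
    let ?c = "?\<sigma> ?p ?q" and ?r = "\<xi> (?p + ?q)" and ?l = "?h k" and ?w = "mult B (i a) (i b)"
    let ?a = "\<xi> ?p" and ?b = "\<xi> ?q"
    have w: "?w \<in> carrier B" using B.mult_carrier[OF Bi[OF a(1)] Bi[OF b(1)]] .
    have dw: "d ?c ?w \<in> carrier B" using B.centroid_mem[OF dcar[OF ker_closed(5)] w] .
    have mab: "m ?p ?q a b \<in> C (\<pi> (g + k))" using mC[OF a(1) b(1)] by simp
    \<comment> \<open>The kernel part of a sum is the sum of the kernel parts plus the
      cocycle.\<close>
    have hs: "?h (g + k) = ?h g + ?l + ?c" by (simp add: cocycle_def algebra_simps)
    have lhs: "\<theta> (mult A.LA x y) =
        (eps g k * inverse (eps (?h g + ?l + ?c) ?r) * (eps ?c ?r / eps ?a ?b)) *\<^sub>R c (?h g + ?l + ?c) (d ?c ?w)"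
    proof -
      have "mult A.LA x y = eps g k *\<^sub>R pure (m ?p ?q a b) (g + k)"
        unfolding a(2) b(2) using A.mult_pure[of a g b k] a(1) b(1) Amult[OF a(1) b(1)] by (simp add: Acomp)
      then have "\<theta> (mult A.LA x y) = eps g k *\<^sub>R \<theta> (pure (m ?p ?q a b) (g + k))"
        using linear_on_scaleR[OF \<theta>l A.L.comp_carrier[OF pure_comp]] mab by (simp add: Acomp)
      also have "\<theta> (pure (m ?p ?q a b) (g + k)) =
          inverse (eps (?h g + ?l + ?c) ?r) *\<^sub>R c (?h g + ?l + ?c) (?s ?p ?q *\<^sub>R d ?c ?w)"
        unfolding \<theta>[OF mab] hs by (simp add: m_def)
      also have "c (?h g + ?l + ?c) (?s ?p ?q *\<^sub>R d ?c ?w) = ?s ?p ?q *\<^sub>R c (?h g + ?l + ?c) (d ?c ?w)"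
        by (rule linear_on_scaleR[OF centroid_linear[OF ccar] dw]) (intro ker_closed)
      finally show ?thesis by (simp only: scaleR_scaleR mult.assoc)
    qed
    have rhs: "mult B (\<theta> x) (\<theta> y) = (inverse (eps (?h g) ?a) * inverse (eps ?l ?b) * eps (?h g) ?l * eps (?h g + ?l) ?c)
        *\<^sub>R c (?h g + ?l + ?c) (d ?c ?w)"
    proof -
      have ca: "c (?h g) (i a) \<in> carrier B" and cb: "c ?l (i b) \<in> carrier B"
        using B.centroid_mem[OF ccar[OF ker_closed(4)]] Bi a(1) b(1) by blast+
      have "mult B (c (?h g) (i a)) (c ?l (i b)) = c (?h g) (c ?l ?w)"
        using B.centroid_mult(2)[OF ccar[OF ker_closed(4)] Bi[OF a(1)] cb]
          B.centroid_mult(1)[OF ccar[OF ker_closed(4)] Bi[OF a(1)] Bi[OF b(1)]] by simp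
      also have "\<dots> = eps (?h g) ?l *\<^sub>R c (?h g + ?l) (c ?c (d ?c ?w))"
        unfolding frame_mult[OF c ker_closed(4) ker_closed(4)] cd[OF ker_closed(5) w] ..
      also have "\<dots> = (eps (?h g) ?l * eps (?h g + ?l) ?c) *\<^sub>R c (?h g + ?l + ?c) (d ?c ?w)"
        unfolding frame_mult[OF c ker_closed(2)[OF ker_closed(4) ker_closed(4)] ker_closed(5)] by simp
      finally show ?thesis
        unfolding a(2) b(2) \<theta>[OF a(1)] \<theta>[OF b(1)]
          B.mult_scaleR_left[OF B.scaleR_carrier[OF cb] ca] B.mult_scaleR_right[OF ca cb] by (simp only: scaleR_scaleR mult.assoc)
    qed
    have id: "eps g k * eps (?h g) ?a * eps ?l ?b * eps ?c ?r =
        eps (?h g) ?l * eps (?h g + ?l) ?c * eps (?h g + ?l + ?c) ?r * eps ?a ?b"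
      by (rule eps_section_identity) (simp_all add: cocycle_def)
    have "eps g k * inverse (eps (?h g + ?l + ?c) ?r) * (eps ?c ?r / eps ?a ?b) =
        inverse (eps (?h g) ?a) * inverse (eps ?l ?b) * eps (?h g) ?l * eps (?h g + ?l) ?c"
    proof -
      have "X * inverse Y * (Z / W) = inverse U * inverse V * S * T"
        if "X * U * V * Z = S * T * Y * W" "Y \<noteq> 0" "W \<noteq> 0" "U \<noteq> 0" "V \<noteq> 0" for X Y Z W U V S T :: real
        using that by (simp add: field_simps)
      from this[OF id] show ?thesis by simp
    qed
    then show "\<theta> (mult A.LA x y) = mult B (\<theta> x) (\<theta> y)" unfolding lhs rhs by (simp only:)
  qed
  then show ?thesis using A by blast
qed

section \<open>The properties that make the functor an equivalence\<close>

lemma loop_functor_ob: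
  fixes A :: "('h, 'v::real_vector) galg"
  assumes "graded_algebra A" "central_simple A"
  shows "graded_simple (loop \<pi> z A) \<and>
    (\<exists>\<phi>. graded_iso (centroid (loop \<pi> z A)) (loop \<pi> z trivially_graded_reals) \<phi>)"
proof -
  interpret loop_algebra \<pi> \<chi> z \<xi> A using loop_algebraI[OF assms(1)] .
  have s: "graded_simple A" using assms simple_imp_graded_simple by (simp add: central_simple_def)
  note sL = graded_simple_loop[OF s]
  have "carrier LA \<noteq> {0}"
    using sL L.mult_zero_left[of 0] unfolding graded_simple_def nontrivial_product_def by auto
  then show ?thesis
    using sL iso_from_frame[OF graded_algebra_loop _ centroid_frame_unit[OF s]] assms(2)
    by (simp add: central_simple_def)
qed

text \<open>Graded simplicity and a frame pass from \<open>B\<close> to the loop algebra of its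
  representative \<open>A\<close> along the inverse isomorphism, and central simplicity of
  \<open>A\<close> is recovered from them. The map \<open>e\<close> provides the ambient space in
  which \<open>A\<close> lives.\<close>

lemma loop_functor_essentially_surjective:
  fixes B :: "('g, 'v::real_vector) galg" and e :: "'v \<Rightarrow> 'u::real_vector"
  assumes e: "linear e" "inj e" and B: "graded_simple B"
    and \<phi>: "graded_iso (centroid B) (loop \<pi> z trivially_graded_reals) \<phi>"
  shows "\<exists>A :: ('h, 'u) galg. graded_algebra A \<and> central_simple A \<and> (\<exists>\<theta>. graded_iso (loop \<pi> z A) B \<theta>)"
proof -
  have gB: "graded_algebra B" using B by (simp add: graded_simple_def)
  obtain c where c: "centroid_frame B c" using frame_from_iso[OF gB \<phi>] by blast
  obtain A :: "('h, 'u) galg" and \<theta> where A: "graded_algebra A" and \<theta>: "graded_iso (loop \<pi> z A) B \<theta>"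
    using loop_representative[OF e gB c] by blast
  interpret loop_algebra \<pi> \<chi> z \<xi> A using loop_algebraI[OF A] .
  have i: "graded_iso B LA (iso_inv LA B \<theta>)" using graded_iso_inv[OF graded_algebra_loop \<theta>] .
  have "central_simple A"
    by (rule central_simple_from_loop[OF graded_simple_iso[OF B graded_algebra_loop i]
          frame_iso[OF gB graded_algebra_loop c i]])
  then show ?thesis using A \<theta> by blast
qed

text \<open>Loop morphisms are compared on pure tensors by \<open>loop_iso_eqI\<close>; there
  composition composes the maps on coefficients and multiplies the values of the characters.\<close>

lemma loop_functor_functor:
  "is_functor (M_groupoid \<pi> \<xi> :: (('h, 'v::real_vector) galg, _) category) (N_groupoid \<pi> z) (loop_functor \<pi> z \<xi>)"
proof -
  let ?M = "M_groupoid \<pi> \<xi> :: (('h, 'v) galg, ('v \<Rightarrow> 'v) \<times> ('g \<Rightarrow> real)) category"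
  have gr: "graded_algebra A" "central_simple A" if "A \<in> Ob ?M" for A
    using that by (simp_all add: M_groupoid_def)
  have hom: "(\<psi>, \<mu>) \<in> Hom ?M A B \<longleftrightarrow> \<mu> \<in> real_characters (ker \<pi>) \<and> graded_iso (twist \<xi> \<mu> A) B \<psi>"
    for \<psi> \<mu> A B by (simp add: M_groupoid_def)
  have id: "Ident ?M A = (scalar_op (carrier A) 1, indicator (ker \<pi>))" for A
    by (simp add: M_groupoid_def)
  have comp: "Comp ?M (\<psi>', \<mu>') (\<psi>, \<mu>) = (\<psi>' \<circ> \<psi>, \<mu>' * \<mu>)" for \<psi> \<psi>' \<mu> \<mu>'
    by (simp add: M_groupoid_def)
  show ?thesis
    unfolding is_functor_def
  proof (intro conjI ballI)
    show "on_ob (loop_functor \<pi> z \<xi>) A \<in> Ob (N_groupoid \<pi> z)" if "A \<in> Ob ?M" for A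
      using loop_functor_ob[OF gr[OF that]] by (simp add: loop_functor_def N_groupoid_def)
    show "on_mor (loop_functor \<pi> z \<xi>) A B f \<in>
        Hom (N_groupoid \<pi> z) (on_ob (loop_functor \<pi> z \<xi>) A) (on_ob (loop_functor \<pi> z \<xi>) B)"
      if "A \<in> Ob ?M" "B \<in> Ob ?M" "f \<in> Hom ?M A B" for A B f
      using that(3) loop_mor_iso[OF gr(1)[OF that(1)] gr(1)[OF that(2)]]
      by (cases f) (simp add: loop_functor_def N_groupoid_def hom)
    show "on_mor (loop_functor \<pi> z \<xi>) A A (Ident ?M A) =
        Ident (N_groupoid \<pi> z) (on_ob (loop_functor \<pi> z \<xi>) A)" if "A \<in> Ob ?M" for A
    proof -
      note A = gr(1)[OF that]
      interpret loop_algebra \<pi> \<chi> z \<xi> A using loop_algebraI[OF A] .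
      note i = twist_iso_ident[OF A]
      have "loop_mor \<pi> z \<xi> A (scalar_op (carrier A) 1, indicator (ker \<pi>)) = scalar_op (carrier LA) 1"
      proof (rule loop_iso_eqI[OF A loop_mor_iso[OF A A character_one i] graded_iso_ident[OF graded_algebra_loop]])
        fix g a assume a: "a \<in> comp A (\<pi> g)"
        show "loop_mor \<pi> z \<xi> A (scalar_op (carrier A) 1, indicator (ker \<pi>)) (pure a g) =
            scalar_op (carrier LA) 1 (pure a g)"
          using loop_mor_pure[OF A graded_iso_linear[OF i, simplified] a] comp_carrier[OF a]
            L.comp_carrier[OF pure_comp[OF a]] by (simp add: scalar_op_def)
      qed
      then show ?thesis by (simp add: id loop_functor_def N_groupoid_def)
    qed
    show "on_mor (loop_functor \<pi> z \<xi>) A D (Comp ?M g f) =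
        Comp (N_groupoid \<pi> z) (on_mor (loop_functor \<pi> z \<xi>) B D g) (on_mor (loop_functor \<pi> z \<xi>) A B f)"
      if ob: "A \<in> Ob ?M" "B \<in> Ob ?M" "D \<in> Ob ?M" and f: "f \<in> Hom ?M A B" and g: "g \<in> Hom ?M B D" for A B D f g
    proof -
      note A = gr(1)[OF ob(1)] and B = gr(1)[OF ob(2)] and D = gr(1)[OF ob(3)]
      interpret A: loop_algebra \<pi> \<chi> z \<xi> A using loop_algebraI[OF A] .
      interpret B: loop_algebra \<pi> \<chi> z \<xi> B using loop_algebraI[OF B] .
      obtain \<psi> \<mu> \<psi>' \<mu>' where fg: "f = (\<psi>, \<mu>)" "g = (\<psi>', \<mu>')" by (cases f; cases g)
      have \<mu>: "\<mu> \<in> real_characters (ker \<pi>)" and \<psi>: "graded_iso (twist \<xi> \<mu> A) B \<psi>"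
        and \<mu>': "\<mu>' \<in> real_characters (ker \<pi>)" and \<psi>': "graded_iso (twist \<xi> \<mu>' B) D \<psi>'"
        using f g by (auto simp: fg hom)
      note \<psi>\<psi> = twist_iso_compose[OF A B D \<psi> \<psi>'] and \<mu>\<mu> = character_mult[OF \<mu>' \<mu>]
      note F = loop_mor_iso[OF A B \<mu> \<psi>] and G = loop_mor_iso[OF B D \<mu>' \<psi>']
      have "loop_mor \<pi> z \<xi> A (\<psi>' \<circ> \<psi>, \<mu>' * \<mu>) = loop_mor \<pi> z \<xi> B (\<psi>', \<mu>') \<circ> loop_mor \<pi> z \<xi> A (\<psi>, \<mu>)"
      proof (rule loop_iso_eqI[OF A loop_mor_iso[OF A D \<mu>\<mu> \<psi>\<psi>] graded_iso_compose[OF A.L.zero_carrier F G]])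
        fix k a assume a: "a \<in> comp A (\<pi> k)"
        have b: "\<psi> a \<in> comp B (\<pi> k)" using graded_iso_comp[OF \<psi>] a by simp
        show "loop_mor \<pi> z \<xi> A (\<psi>' \<circ> \<psi>, \<mu>' * \<mu>) (pure a k) =
            (loop_mor \<pi> z \<xi> B (\<psi>', \<mu>') \<circ> loop_mor \<pi> z \<xi> A (\<psi>, \<mu>)) (pure a k)"
          using loop_mor_pure[OF A graded_iso_linear[OF \<psi>\<psi>, simplified] a]
            loop_mor_pure[OF A graded_iso_linear[OF \<psi>, simplified] a]
            loop_mor_pure[OF B graded_iso_linear[OF \<psi>', simplified] b]
            linear_on_scaleR[OF graded_iso_linear[OF G] B.L.comp_carrier[OF pure_comp[OF b]]]
          by (simp add: mult.commute)
      qed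
      then show ?thesis by (simp add: fg comp loop_functor_def N_groupoid_def)
    qed
  qed
qed

lemma loop_functor_fully_faithful:
  fixes A A' :: "('h, 'v::real_vector) galg"
  assumes A: "graded_algebra A" "central_simple A" and A': "graded_algebra A'" "central_simple A'"
  shows "bij_betw (loop_mor \<pi> z \<xi> A)
    {(\<psi>, \<mu>). \<mu> \<in> real_characters (ker \<pi>) \<and> graded_iso (twist \<xi> \<mu> A) A' \<psi>}
    {\<phi>. graded_iso (loop \<pi> z A) (loop \<pi> z A') \<phi>}"
  unfolding bij_betw_def
proof (intro conjI subset_antisym)
  have nz: "carrier A \<noteq> {0}"
    using A graded.mult_zero_left[OF graded.intro[OF A(1)], of 0]
      graded.zero_carrier[OF graded.intro[OF A(1)]]
    unfolding central_simple_def simple_algebra_def nontrivial_product_def by auto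
  show "inj_on (loop_mor \<pi> z \<xi> A) {(\<psi>, \<mu>). \<mu> \<in> real_characters (ker \<pi>) \<and> graded_iso (twist \<xi> \<mu> A) A' \<psi>}"
    using loop_mor_faithful[OF A(1) nz, of _ A'] by (auto simp: inj_on_def)
  show "loop_mor \<pi> z \<xi> A ` {(\<psi>, \<mu>). \<mu> \<in> real_characters (ker \<pi>) \<and> graded_iso (twist \<xi> \<mu> A) A' \<psi>}
      \<subseteq> {\<phi>. graded_iso (loop \<pi> z A) (loop \<pi> z A') \<phi>}"
    using loop_mor_iso[OF A(1) A'(1)] by auto
  show "{\<phi>. graded_iso (loop \<pi> z A) (loop \<pi> z A') \<phi>}
      \<subseteq> loop_mor \<pi> z \<xi> A ` {(\<psi>, \<mu>). \<mu> \<in> real_characters (ker \<pi>) \<and> graded_iso (twist \<xi> \<mu> A) A' \<psi>}"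
    using loop_mor_full[OF A A'] by fast
qed

end

section \<open>Embedding the space of the loop construction into the universe\<close>

lemma infinite_square_injection:
  obtains j :: "'g \<times> bool \<times> ('g \<times> nat) \<Rightarrow> 'g \<times> nat" where "inj j"
proof -
  have "infinite (UNIV :: ('g \<times> nat) set)"
    using finite_prod[where 'a = 'g and 'b = nat] by (metis finite_cartesian_productD2 UNIV_Times_UNIV UNIV_not_empty infinite_UNIV_nat)
  from card_of_Times_same_infinite[OF this]
  obtain k where k: "bij_betw k ((UNIV :: ('g \<times> nat) set) \<times> (UNIV :: ('g \<times> nat) set)) (UNIV :: ('g \<times> nat) set)"
    using card_of_ordIso by blast
  have "inj k" using k by (simp add: bij_betw_def)
  \<comment> \<open>A pair \<open>(g, b)\<close> becomes the element \<open>(g, of_bool b)\<close>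
    of \<open>'g \<times> nat\<close>, so the triple is a point of the square.\<close>
  then have "inj (\<lambda>(g, b, m). k ((g, of_bool b), m))"
    by (auto intro!: injI simp: inj_eq of_bool_def split: if_splits)
  then show thesis by (rule that)
qed

text \<open>A coordinate of a function into pairs is a triple: the argument \<open>g\<close>, the
  half of the pair, and the coordinate \<open>m\<close> in the universe. Renaming the triples by the
  injection \<open>j\<close> and filling the remaining coordinates with 0 is linear and
  injective.\<close>

lemma universe_embedding:
  obtains e :: "('g \<Rightarrow> ('g, 'w::real_vector) universe \<times> ('g, 'w) universe) \<Rightarrow> ('g, 'w) universe"
  where "linear e" "inj e"
proof -
  obtain j :: "'g \<times> bool \<times> ('g \<times> nat) \<Rightarrow> 'g \<times> nat" where j: "inj j"
    by (rule infinite_square_injection)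
  define e :: "('g \<Rightarrow> ('g, 'w) universe \<times> ('g, 'w) universe) \<Rightarrow> ('g, 'w) universe"
    where "e F n = (if n \<in> range j then
      case inv j n of (g, b, m) \<Rightarrow> (if b then fst (F g) m else snd (F g) m) else 0)" for F n
  have ej: "e F (j (g, b, m)) = (if b then fst (F g) m else snd (F g) m)" for F g b m
    using j by (simp add: e_def)
  have "linear e"
    by (rule linearI) (auto simp: e_def fun_eq_iff split: prod.splits)
  moreover have "inj e"
  proof (rule injI)
    fix F F' assume "e F = e F'"
    then have "e F (j (g, b, m)) = e F' (j (g, b, m))" for g b m by simp
    note q = this[unfolded ej]
    have "fst (F g) m = fst (F' g) m" "snd (F g) m = snd (F' g) m" for g m
      using q[where b = True] q[where b = False] by simp_all
    then show "F = F'" by (simp add: fun_eq_iff prod_eq_iff)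
  qed
  ultimately show thesis by (rule that)
qed

theorem theorem3p9:
  fixes \<pi> :: "'g::ab_group_add \<Rightarrow> 'h::ab_group_add"
    and \<chi> z :: "'g \<Rightarrow> complex"
    and \<xi> :: "'h \<Rightarrow> 'g"
  assumes hom_pi: "\<And>g k. \<pi> (g + k) = \<pi> g + \<pi> k"
    and epi_pi: "surj \<pi>"
    and unit_chi: "\<And>g. cmod (\<chi> g) = 1"
    and hom_chi: "\<And>g k. \<chi> (g + k) = \<chi> g * \<chi> k"
    and unit_z: "\<And>g. cmod (z g) = 1"
    and sqrt_z: "\<And>g. (z g)\<^sup>2 = \<chi> g"
    and section_xi: "\<And>p. \<pi> (\<xi> p) = p"
  shows "equivalence_of_groupoids
    (M_groupoid \<pi> \<xi> ::
      (('h, ('g, 'w::real_vector) universe) galg,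
       (('g, 'w) universe \<Rightarrow> ('g, 'w) universe) \<times> ('g \<Rightarrow> real)) category)
    (N_groupoid \<pi> z)
    (loop_functor \<pi> z \<xi>)"
proof -
  interpret loop_setup \<pi> \<chi> z \<xi>
    by unfold_locales (fact hom_pi hom_chi unit_z sqrt_z section_xi)+
  let ?M = "M_groupoid \<pi> \<xi> :: (('h, ('g, 'w) universe) galg,
    (('g, 'w) universe \<Rightarrow> ('g, 'w) universe) \<times> ('g \<Rightarrow> real)) category"
  show ?thesis
  proof (rule equivalence_of_groupoidsI[OF groupoid_M groupoid_N loop_functor_functor])
    show "bij_betw (on_mor (loop_functor \<pi> z \<xi>) A B) (Hom ?M A B)
        (Hom (N_groupoid \<pi> z) (on_ob (loop_functor \<pi> z \<xi>) A) (on_ob (loop_functor \<pi> z \<xi>) B))"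
      if "A \<in> Ob ?M" "B \<in> Ob ?M" for A B
      using that loop_functor_fully_faithful[of A B]
      by (simp add: M_groupoid_def N_groupoid_def loop_functor_def)
    fix B assume "B \<in> Ob (N_groupoid \<pi> z ::
      (('g, 'g \<Rightarrow> ('g, 'w) universe \<times> ('g, 'w) universe) galg, _) category)"
    then obtain \<phi> where B: "graded_simple B" "graded_iso (centroid B) (loop \<pi> z trivially_graded_reals) \<phi>"
      by (auto simp: N_groupoid_def)
    \<comment> \<open>An object of the target lives in the space in which the loop construction
      lands; \<open>e\<close> places the algebra to be found back in the universe.\<close>
    obtain e :: "('g \<Rightarrow> ('g, 'w) universe \<times> ('g, 'w) universe) \<Rightarrow> ('g, 'w) universe"
      where "linear e" "inj e" by (rule universe_embedding)
    from loop_functor_essentially_surjective[OF this B]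
    show "\<exists>A\<in>Ob ?M. \<exists>f. f \<in> Hom (N_groupoid \<pi> z) (on_ob (loop_functor \<pi> z \<xi>) A) B"
      by (auto simp: M_groupoid_def N_groupoid_def loop_functor_def)
  qed
qed

end
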